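(* Let $(M,L)$ be a Finsler manifold of dimension $n\ge3$ with non-zero horizontal Ricci tensor. If $(M,L)$ is recurrent, then it is m-projectively recurrent.
   Context: Setting. $(M,L)$ is a smooth Finsler manifold of dimension $n$ (with positive definite Finsler metric), $\mathcal{T}M$ is the bundle of nonzero tangent vectors, $\pi:\mathcal{T}M\to M$, and $\pi^{-1}(TM)\to\mathcal{T}M$ is the pullback bundle, whose sections $\overline X$ are called $\pi$-vector fields (1-forms on this bundle are $\pi$-forms). $g$ is the Finsler metric on $\pi^{-1}(TM)$ defined by $L$ (in coordinates $g_{ij}=\frac12\partial^2L^2/\partial y^i\partial y^j$). $\overline\eta(u)=(u,u)$ is the fundamental $\pi$-vector field. $\rho:T(\mathcal{T}M)\to\pi^{-1}(TM)$ is the morphism induced by $d\pi$ and $\gamma:\pi^{-1}(TM)\to T(\mathcal{T}M)$ is the vertical lift. A linear connection $D$ on $\pi^{-1}(TM)$ is regular if $T_u(\mathcal{T}M)=V_u\oplus H_u$ for all $u$, where $V_u=\ker d\pi$ and $H_u=\{X: D_X\overline\eta=0\}$; then $\beta:=(\rho|_{H})^{-1}$ is its horizontal map. The Cartan connection $\nabla$ is the unique regular connection with $\nabla g=0$, $Q(\overline X,\overline Y):=\mathbf T(\beta\overline X,\beta\overline Y)=0$, and $T(\overline X,\overline Y):=\mathbf T(\gamma\overline X,\beta\overline Y)$ satisfying $g(T(\overline X,\overline Y),\overline Z)=g(T(\overline X,\overline Z),\overline Y)$, where $\mathbf T(X,Y)=\nabla_X\rho Y-\nabla_Y\rho X-\rho[X,Y]$.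 Curvature. $\mathbf K(X,Y)\overline Z=-\nabla_X\nabla_Y\overline Z+\nabla_Y\nabla_X\overline Z+\nabla_{[X,Y]}\overline Z$; $R(\overline X,\overline Y)\overline Z=\mathbf K(\beta\overline X,\beta\overline Y)\overline Z$. The horizontal Ricci tensor is $\mathrm{Ric}(\overline X,\overline Y)=\mathrm{trace}\{\overline Z\mapsto R(\overline X,\overline Z)\overline Y\}$; $\mathrm{Ric}_o$ is the $(1,1)$ tensor with $g(\mathrm{Ric}_o\overline X,\overline Y)=\mathrm{Ric}(\overline X,\overline Y)$. The m-projective curvature tensor is $\mathbb H(\overline X,\overline Y)\overline Z=R(\overline X,\overline Y)\overline Z-\frac{1}{2(n-1)}\{\mathrm{Ric}(\overline X,\overline Z)\overline Y-\mathrm{Ric}(\overline Y,\overline Z)\overline X+g(\overline X,\overline Z)\mathrm{Ric}_o\overline Y-g(\overline Y,\overline Z)\mathrm{Ric}_o\overline X\}$. Recurrence. The $h$-covariant derivative of a $\pi$-tensor field $B$ is $(\stackrel{h}{\nabla}B)(\overline W,\dots)=(\nabla_{\beta\overline W}B)(\dots)$. $(M,L)$ is recurrent (resp. m-projectively recurrent) if, for some non-zero $\pi$-form $A$ (the recurrence form), $\stackrel{h}{\nabla}R=A\otimes R$ with $R$ non-zero (resp. $\stackrel{h}{\nabla}\mathbb H=A\otimes\mathbb H$). *)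

theory Defs
  imports "HOL-Analysis.Analysis"
begin

text \<open>\<open>smooth_on S f\<close> is \<open>C\<^sup>\<infinity>\<close>-smoothness; it is only used for open \<open>S\<close>.\<close>

primrec Ck_on :: "nat \<Rightarrow> 'e::real_normed_vector set \<Rightarrow> ('e \<Rightarrow> 'f::real_normed_vector) \<Rightarrow> bool" where
  "Ck_on 0 S f \<longleftrightarrow> continuous_on S f"
| "Ck_on (Suc k) S f \<longleftrightarrow> (\<forall>x\<in>S. f differentiable (at x)) \<and>
     (\<forall>v. Ck_on k S (\<lambda>x. frechet_derivative f (at x) v))"

definition smooth_on :: "'e::real_normed_vector set \<Rightarrow> ('e \<Rightarrow> 'f::real_normed_vector) \<Rightarrow> bool" where
  "smooth_on S f \<longleftrightarrow> (\<forall>k. Ck_on k S f)"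

text \<open>A chart is a pair of its domain and its coordinate map; the coordinate map is
  meaningful on the domain only.\<close>

type_synonym ('a, 'e) chart = "'a set \<times> ('a \<Rightarrow> 'e)"

definition chart_inv :: "('a, 'e) chart \<Rightarrow> 'e \<Rightarrow> 'a" where
  "chart_inv c = inv_into (fst c) (snd c)"

definition chart_image :: "('a, 'e) chart \<Rightarrow> 'e set" where
  "chart_image c = snd c ` fst c"

text \<open>The type \<open>'a\<close> carries the (Hausdorff, second countable) topology of the manifold,
  whose points are all elements of \<open>'a\<close>.\<close>

definition smooth_manifold ::
  "('a::{t2_space, second_countable_topology}, 'e::euclidean_space) chart set \<Rightarrow> bool" where
  "smooth_manifold M \<longleftrightarrow>
     (\<Union>c\<in>M. fst c) = UNIV \<and>
     (\<forall>c\<in>M. open (fst c) \<and> open (chart_image c) \<and>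
        homeomorphism (fst c) (chart_image c) (snd c) (chart_inv c)) \<and>
     (\<forall>c\<in>M. \<forall>d\<in>M. smooth_on (snd c ` (fst c \<inter> fst d)) (snd d \<circ> chart_inv c))"

text \<open>The notions below use only the charts, no topology on \<open>'a\<close>, so that they apply to
  \<open>M\<close> as well as to its (slit) tangent bundle.

  A tangent vector at \<open>p\<close> is the family of its components in the charts around \<open>p\<close>,
  subject to the contravariant transformation law (and extended by \<open>0\<close> to all other
  arguments). The vector space operations are pointwise.\<close>

type_synonym ('a, 'e) tvec = "('a, 'e) chart \<Rightarrow> 'e"

definition vzero :: "'i \<Rightarrow> 'e::real_vector" where
  "vzero = (\<lambda>c. 0)"

definition vadd :: "('i \<Rightarrow> 'e::real_vector) \<Rightarrow> ('i \<Rightarrow> 'e) \<Rightarrow> 'i \<Rightarrow> 'e"  (infixl "+\<^sub>v" 65) where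
  "v +\<^sub>v w = (\<lambda>c. v c + w c)"

definition vsub :: "('i \<Rightarrow> 'e::real_vector) \<Rightarrow> ('i \<Rightarrow> 'e) \<Rightarrow> 'i \<Rightarrow> 'e"  (infixl "-\<^sub>v" 65) where
  "v -\<^sub>v w = (\<lambda>c. v c - w c)"

definition vscale :: "real \<Rightarrow> ('i \<Rightarrow> 'e::real_vector) \<Rightarrow> 'i \<Rightarrow> 'e"  (infixr "*\<^sub>v" 75) where
  "a *\<^sub>v v = (\<lambda>c. a *\<^sub>R v c)"

definition tangent_space :: "('a, 'e::euclidean_space) chart set \<Rightarrow> 'a \<Rightarrow> ('a, 'e) tvec set" where
  "tangent_space M p = {v.
     (\<forall>c. c \<notin> M \<or> p \<notin> fst c \<longrightarrow> v c = 0) \<and>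
     (\<forall>c\<in>M. \<forall>d\<in>M. p \<in> fst c \<inter> fst d \<longrightarrow>
        v d = frechet_derivative (snd d \<circ> chart_inv c) (at (snd c p)) (v c))}"

definition chart_at :: "('a, 'e) chart set \<Rightarrow> 'a \<Rightarrow> ('a, 'e) chart" where
  "chart_at M p = (SOME c. c \<in> M \<and> p \<in> fst c)"

definition smooth_fun ::
  "('a, 'e::euclidean_space) chart set \<Rightarrow> ('a \<Rightarrow> real) \<Rightarrow> bool" where
  "smooth_fun M f \<longleftrightarrow> (\<forall>c\<in>M. smooth_on (chart_image c) (f \<circ> chart_inv c))"

definition vector_field ::
  "('a, 'e::euclidean_space) chart set \<Rightarrow> ('a \<Rightarrow> ('a, 'e) tvec) \<Rightarrow> bool" where
  "vector_field M X \<longleftrightarrow> (\<forall>c\<in>M. (\<forall>p\<in>fst c. X p \<in> tangent_space M p) \<and>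
     smooth_on (chart_image c) (\<lambda>z. X (chart_inv c z) c))"

text \<open>\<open>dir_deriv M p v f\<close> is \<open>v f\<close>, for \<open>v\<close> tangent at \<open>p\<close>; it does not depend on the chart.\<close>

definition dir_deriv ::
  "('a, 'e::euclidean_space) chart set \<Rightarrow> 'a \<Rightarrow> ('a, 'e) tvec \<Rightarrow> ('a \<Rightarrow> real) \<Rightarrow> real" where
  "dir_deriv M p v f = (let c = chart_at M p in
     frechet_derivative (f \<circ> chart_inv c) (at (snd c p)) (v c))"

definition differential ::
  "('a, 'e::euclidean_space) chart set \<Rightarrow> ('b, 'f::euclidean_space) chart set \<Rightarrow> ('a \<Rightarrow> 'b) \<Rightarrow>
   'a \<Rightarrow> ('a, 'e) tvec \<Rightarrow> ('b, 'f) tvec" where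
  "differential M N F p v = (\<lambda>d. if d \<in> N \<and> F p \<in> fst d then
     (let c = chart_at M p in
      frechet_derivative (snd d \<circ> F \<circ> chart_inv c) (at (snd c p)) (v c)) else 0)"

text \<open>In coordinates \<open>[X,Y]\<^sup>i = X\<^sup>j \<partial>\<^sub>j Y\<^sup>i - Y\<^sup>j \<partial>\<^sub>j X\<^sup>i\<close>.\<close>

definition lie_bracket ::
  "('a, 'e::euclidean_space) chart set \<Rightarrow> ('a \<Rightarrow> ('a, 'e) tvec) \<Rightarrow> ('a \<Rightarrow> ('a, 'e) tvec) \<Rightarrow>
   'a \<Rightarrow> ('a, 'e) tvec" where
  "lie_bracket M X Y p = (\<lambda>c. if c \<in> M \<and> p \<in> fst c then
     frechet_derivative (\<lambda>z. Y (chart_inv c z) c) (at (snd c p)) (X p c)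
     - frechet_derivative (\<lambda>z. X (chart_inv c z) c) (at (snd c p)) (Y p c) else 0)"

type_synonym ('a, 'n) tpoint = "'a \<times> ('a, real^'n) tvec"

definition tangent_bundle :: "('a, real^'n) chart set \<Rightarrow> ('a, 'n::finite) tpoint set" where
  "tangent_bundle M = {(p, v). v \<in> tangent_space M p}"

definition slit_bundle :: "('a, real^'n) chart set \<Rightarrow> ('a, 'n::finite) tpoint set" where
  "slit_bundle M = {(p, v). v \<in> tangent_space M p \<and> v \<noteq> vzero}"

definition tangent_chart ::
  "('a, real^'n) chart set \<Rightarrow> ('a, real^'n) chart \<Rightarrow> (('a, 'n::finite) tpoint, (real^'n) \<times> (real^'n)) chart"
where
  "tangent_chart M c =
     ({u \<in> tangent_bundle M. fst u \<in> fst c}, \<lambda>u. (snd c (fst u), snd u c))"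

definition slit_chart ::
  "('a, real^'n) chart set \<Rightarrow> ('a, real^'n) chart \<Rightarrow> (('a, 'n::finite) tpoint, (real^'n) \<times> (real^'n)) chart"
where
  "slit_chart M c =
     ({u \<in> slit_bundle M. fst u \<in> fst c}, \<lambda>u. (snd c (fst u), snd u c))"

definition slit_atlas ::
  "('a, real^'n) chart set \<Rightarrow> (('a, 'n::finite) tpoint, (real^'n) \<times> (real^'n)) chart set" where
  "slit_atlas M = slit_chart M ` M"

text \<open>Tangent vectors of the slit tangent bundle, and sections of the pullback bundle
  (\<open>\<pi>\<close>-vector fields). The fibre of the pullback bundle over \<open>u\<close> is the tangent space of \<open>M\<close>
  at \<open>\<pi> u = fst u\<close>. Values of sections outside \<open>slit_bundle M\<close> are irrelevant.\<close>

type_synonym ('a, 'n) slit_tvec = "(('a, 'n) tpoint, (real^'n) \<times> (real^'n)) tvec"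
type_synonym ('a, 'n) pi_field = "('a, 'n) tpoint \<Rightarrow> ('a, real^'n) tvec"

definition pi_vector_field :: "('a, real^'n) chart set \<Rightarrow> ('a, 'n::finite) pi_field \<Rightarrow> bool" where
  "pi_vector_field M X \<longleftrightarrow>
     (\<forall>u\<in>slit_bundle M. X u \<in> tangent_space M (fst u)) \<and>
     (\<forall>c\<in>M. smooth_on (chart_image (slit_chart M c)) (\<lambda>z. X (chart_inv (slit_chart M c) z) c))"

definition pi_form ::
  "('a, real^'n) chart set \<Rightarrow> (('a, 'n::finite) tpoint \<Rightarrow> ('a, real^'n) tvec \<Rightarrow> real) \<Rightarrow> bool" where
  "pi_form M A \<longleftrightarrow>
     (\<forall>u\<in>slit_bundle M. \<forall>v\<in>tangent_space M (fst u). \<forall>w\<in>tangent_space M (fst u). \<forall>a b.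
        A u (a *\<^sub>v v +\<^sub>v b *\<^sub>v w) = a * A u v + b * A u w) \<and>
     (\<forall>X. pi_vector_field M X \<longrightarrow> smooth_fun (slit_atlas M) (\<lambda>u. A u (X u)))"

definition nonzero_pi_form ::
  "('a, real^'n) chart set \<Rightarrow> (('a, 'n::finite) tpoint \<Rightarrow> ('a, real^'n) tvec \<Rightarrow> real) \<Rightarrow> bool" where
  "nonzero_pi_form M A \<longleftrightarrow> pi_form M A \<and>
     (\<exists>u\<in>slit_bundle M. \<exists>w\<in>tangent_space M (fst u). A u w \<noteq> 0)"

text \<open>The section \<open>u \<mapsto> (u, u)\<close>: only the fibre component \<open>snd u\<close> of \<open>u\<close> is recorded.\<close>

definition fundamental_field :: "('a, 'n::finite) pi_field" where
  "fundamental_field u = snd u"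

definition rho ::
  "('a, real^'n) chart set \<Rightarrow> ('a, 'n::finite) tpoint \<Rightarrow> ('a, 'n) slit_tvec \<Rightarrow> ('a, real^'n) tvec" where
  "rho M u v = differential (slit_atlas M) M fst u v"

text \<open>The vertical lift of \<open>w\<close> is the velocity at \<open>t = 0\<close> of the curve \<open>t \<mapsto> u + t w\<close> in the fibre.\<close>

definition vertical_lift ::
  "('a, real^'n) chart set \<Rightarrow> ('a, 'n::finite) tpoint \<Rightarrow> ('a, real^'n) tvec \<Rightarrow> ('a, 'n) slit_tvec" where
  "vertical_lift M u w = (\<lambda>C. if C \<in> slit_atlas M \<and> u \<in> fst C then
     vector_derivative (\<lambda>t. snd C (fst u, snd u +\<^sub>v t *\<^sub>v w)) (at 0) else 0)"

text \<open>\<open>g\<^sub>u(v,w) = 1/2 \<partial>\<^sup>2/\<partial>s\<partial>t L\<^sup>2(u + s v + t w)\<close> at \<open>s = t = 0\<close>, i.e. the bilinear form with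
  components \<open>1/2 \<partial>\<^sup>2L\<^sup>2/\<partial>y\<^sup>i\<partial>y\<^sup>j\<close>.\<close>

definition finsler_metric ::
  "(('a, 'n::finite) tpoint \<Rightarrow> real) \<Rightarrow> ('a, 'n) tpoint \<Rightarrow> ('a, real^'n) tvec \<Rightarrow> ('a, real^'n) tvec \<Rightarrow> real"
where
  "finsler_metric L u v w =
     (1/2) * deriv (\<lambda>s. deriv (\<lambda>t. (L (fst u, snd u +\<^sub>v s *\<^sub>v v +\<^sub>v t *\<^sub>v w))\<^sup>2) 0) 0"

definition finsler_manifold ::
  "('a::{t2_space, second_countable_topology}, real^'n) chart set \<Rightarrow>
   (('a, 'n::finite) tpoint \<Rightarrow> real) \<Rightarrow> bool" where
  "finsler_manifold M L \<longleftrightarrow>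
     smooth_manifold M \<and>
     (\<forall>c\<in>M. continuous_on (chart_image (tangent_chart M c)) (L \<circ> chart_inv (tangent_chart M c))) \<and>
     smooth_fun (slit_atlas M) L \<and>
     (\<forall>u\<in>slit_bundle M. L u > 0) \<and>
     (\<forall>(p, v)\<in>tangent_bundle M. \<forall>a>0. L (p, a *\<^sub>v v) = a * L (p, v)) \<and>
     (\<forall>u\<in>slit_bundle M. \<forall>w\<in>tangent_space M (fst u). w \<noteq> vzero \<longrightarrow> finsler_metric L u w w > 0)"

text \<open>\<open>D u v X\<close> is \<open>D\<^sub>v X\<close> at the point \<open>u\<close>, for a vector \<open>v\<close> tangent to the slit tangent bundle
  at \<open>u\<close> and a \<open>\<pi>\<close>-vector field \<open>X\<close>. The last clause says that \<open>D\<close> acts on sections, i.e. that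
  values outside the slit bundle do not matter.\<close>

type_synonym ('a, 'n) connection =
  "('a, 'n) tpoint \<Rightarrow> ('a, 'n) slit_tvec \<Rightarrow> ('a, 'n) pi_field \<Rightarrow> ('a, real^'n) tvec"

definition linear_connection ::
  "('a, real^'n) chart set \<Rightarrow> ('a, 'n::finite) connection \<Rightarrow> bool" where
  "linear_connection M D \<longleftrightarrow>
     (\<forall>u\<in>slit_bundle M. \<forall>v\<in>tangent_space (slit_atlas M) u. \<forall>X. pi_vector_field M X \<longrightarrow>
        D u v X \<in> tangent_space M (fst u)) \<and>
     (\<forall>u\<in>slit_bundle M. \<forall>v\<in>tangent_space (slit_atlas M) u. \<forall>w\<in>tangent_space (slit_atlas M) u.
        \<forall>a b X. pi_vector_field M X \<longrightarrow>
        D u (a *\<^sub>v v +\<^sub>v b *\<^sub>v w) X = a *\<^sub>v D u v X +\<^sub>v b *\<^sub>v D u w X) \<and>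
     (\<forall>u\<in>slit_bundle M. \<forall>v\<in>tangent_space (slit_atlas M) u. \<forall>X Y.
        pi_vector_field M X \<longrightarrow> pi_vector_field M Y \<longrightarrow>
        D u v (\<lambda>u. X u +\<^sub>v Y u) = D u v X +\<^sub>v D u v Y) \<and>
     (\<forall>u\<in>slit_bundle M. \<forall>v\<in>tangent_space (slit_atlas M) u. \<forall>f X.
        smooth_fun (slit_atlas M) f \<longrightarrow> pi_vector_field M X \<longrightarrow>
        D u v (\<lambda>u. f u *\<^sub>v X u) =
          dir_deriv (slit_atlas M) u v f *\<^sub>v X u +\<^sub>v f u *\<^sub>v D u v X) \<and>
     (\<forall>V X. vector_field (slit_atlas M) V \<longrightarrow> pi_vector_field M X \<longrightarrow>
        pi_vector_field M (\<lambda>u. D u (V u) X)) \<and>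
     (\<forall>u\<in>slit_bundle M. \<forall>v\<in>tangent_space (slit_atlas M) u. \<forall>X Y.
        pi_vector_field M X \<longrightarrow> pi_vector_field M Y \<longrightarrow> (\<forall>u\<in>slit_bundle M. X u = Y u) \<longrightarrow>
        D u v X = D u v Y)"

definition vertical_space ::
  "('a, real^'n) chart set \<Rightarrow> ('a, 'n::finite) tpoint \<Rightarrow> ('a, 'n) slit_tvec set" where
  "vertical_space M u = {v \<in> tangent_space (slit_atlas M) u. rho M u v = vzero}"

definition horizontal_space ::
  "('a, real^'n) chart set \<Rightarrow> ('a, 'n::finite) connection \<Rightarrow> ('a, 'n) tpoint \<Rightarrow> ('a, 'n) slit_tvec set"
where
  "horizontal_space M D u =
     {v \<in> tangent_space (slit_atlas M) u. D u v fundamental_field = vzero}"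

definition regular_connection ::
  "('a, real^'n) chart set \<Rightarrow> ('a, 'n::finite) connection \<Rightarrow> bool" where
  "regular_connection M D \<longleftrightarrow> linear_connection M D \<and>
     (\<forall>u\<in>slit_bundle M.
        tangent_space (slit_atlas M) u =
          {a +\<^sub>v b | a b. a \<in> vertical_space M u \<and> b \<in> horizontal_space M D u} \<and>
        vertical_space M u \<inter> horizontal_space M D u = {vzero})"

definition horizontal_map ::
  "('a, real^'n) chart set \<Rightarrow> ('a, 'n::finite) connection \<Rightarrow>
   ('a, 'n) tpoint \<Rightarrow> ('a, real^'n) tvec \<Rightarrow> ('a, 'n) slit_tvec" where
  "horizontal_map M D u = inv_into (horizontal_space M D u) (rho M u)"

definition torsion ::
  "('a, real^'n) chart set \<Rightarrow> ('a, 'n::finite) connection \<Rightarrow>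
   (('a, 'n) tpoint \<Rightarrow> ('a, 'n) slit_tvec) \<Rightarrow> (('a, 'n) tpoint \<Rightarrow> ('a, 'n) slit_tvec) \<Rightarrow> ('a, 'n) pi_field"
where
  "torsion M D V W u =
     D u (V u) (\<lambda>u. rho M u (W u)) -\<^sub>v D u (W u) (\<lambda>u. rho M u (V u))
     -\<^sub>v rho M u (lie_bracket (slit_atlas M) V W u)"

definition Q_torsion ::
  "('a, real^'n) chart set \<Rightarrow> ('a, 'n::finite) connection \<Rightarrow>
   ('a, 'n) pi_field \<Rightarrow> ('a, 'n) pi_field \<Rightarrow> ('a, 'n) pi_field" where
  "Q_torsion M D X Y =
     torsion M D (\<lambda>u. horizontal_map M D u (X u)) (\<lambda>u. horizontal_map M D u (Y u))"

definition T_torsion ::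
  "('a, real^'n) chart set \<Rightarrow> ('a, 'n::finite) connection \<Rightarrow>
   ('a, 'n) pi_field \<Rightarrow> ('a, 'n) pi_field \<Rightarrow> ('a, 'n) pi_field" where
  "T_torsion M D X Y =
     torsion M D (\<lambda>u. vertical_lift M u (X u)) (\<lambda>u. horizontal_map M D u (Y u))"

definition metric_connection ::
  "('a, real^'n) chart set \<Rightarrow> (('a, 'n::finite) tpoint \<Rightarrow> real) \<Rightarrow> ('a, 'n) connection \<Rightarrow> bool" where
  "metric_connection M L D \<longleftrightarrow>
     (\<forall>u\<in>slit_bundle M. \<forall>v\<in>tangent_space (slit_atlas M) u. \<forall>X Y.
        pi_vector_field M X \<longrightarrow> pi_vector_field M Y \<longrightarrow>
        dir_deriv (slit_atlas M) u v (\<lambda>u. finsler_metric L u (X u) (Y u)) =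
          finsler_metric L u (D u v X) (Y u) + finsler_metric L u (X u) (D u v Y))"

definition cartan_connection ::
  "('a, real^'n) chart set \<Rightarrow> (('a, 'n::finite) tpoint \<Rightarrow> real) \<Rightarrow> ('a, 'n) connection \<Rightarrow> bool" where
  "cartan_connection M L D \<longleftrightarrow>
     regular_connection M D \<and> metric_connection M L D \<and>
     (\<forall>X Y. pi_vector_field M X \<longrightarrow> pi_vector_field M Y \<longrightarrow>
        (\<forall>u\<in>slit_bundle M. Q_torsion M D X Y u = vzero)) \<and>
     (\<forall>X Y Z. pi_vector_field M X \<longrightarrow> pi_vector_field M Y \<longrightarrow> pi_vector_field M Z \<longrightarrow>
        (\<forall>u\<in>slit_bundle M. finsler_metric L u (T_torsion M D X Y u) (Z u) =
                            finsler_metric L u (T_torsion M D X Z u) (Y u)))"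

definition curvature ::
  "('a, real^'n) chart set \<Rightarrow> ('a, 'n::finite) connection \<Rightarrow>
   (('a, 'n) tpoint \<Rightarrow> ('a, 'n) slit_tvec) \<Rightarrow> (('a, 'n) tpoint \<Rightarrow> ('a, 'n) slit_tvec) \<Rightarrow>
   ('a, 'n) pi_field \<Rightarrow> ('a, 'n) pi_field" where
  "curvature M D V W Z u =
     D u (W u) (\<lambda>u. D u (V u) Z) -\<^sub>v D u (V u) (\<lambda>u. D u (W u) Z)
     +\<^sub>v D u (lie_bracket (slit_atlas M) V W u) Z"

definition h_curvature ::
  "('a, real^'n) chart set \<Rightarrow> ('a, 'n::finite) connection \<Rightarrow>
   ('a, 'n) pi_field \<Rightarrow> ('a, 'n) pi_field \<Rightarrow> ('a, 'n) pi_field \<Rightarrow> ('a, 'n) pi_field" where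
  "h_curvature M D X Y Z =
     curvature M D (\<lambda>u. horizontal_map M D u (X u)) (\<lambda>u. horizontal_map M D u (Y u)) Z"

text \<open>The trace of an endomorphism of the tangent space of \<open>M\<close> at \<open>p\<close>, computed in the
  coordinates of a chart around \<open>p\<close> (it does not depend on the chart).\<close>

definition endo_trace ::
  "('a, real^'n) chart set \<Rightarrow> 'a \<Rightarrow> (('a, real^'n) tvec \<Rightarrow> ('a, real^'n::finite) tvec) \<Rightarrow> real" where
  "endo_trace M p F = (let c = chart_at M p in
     trace (matrix (\<lambda>e. F (THE v. v \<in> tangent_space M p \<and> v c = e) c)))"

text \<open>The endomorphism of the fibre over \<open>u\<close> induced by a tensorial operator \<open>\<Phi>\<close> on
  \<open>\<pi>\<close>-vector fields: \<open>\<Phi> Z\<close> at \<open>u\<close> depends only on \<open>Z u\<close>.\<close>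

definition fibre_map ::
  "('a, real^'n) chart set \<Rightarrow> (('a, 'n::finite) pi_field \<Rightarrow> ('a, 'n) pi_field) \<Rightarrow>
   ('a, 'n) tpoint \<Rightarrow> ('a, real^'n) tvec \<Rightarrow> ('a, real^'n) tvec" where
  "fibre_map M \<Phi> u w = \<Phi> (SOME Z. pi_vector_field M Z \<and> Z u = w) u"

definition h_ricci ::
  "('a, real^'n) chart set \<Rightarrow> ('a, 'n::finite) connection \<Rightarrow>
   ('a, 'n) pi_field \<Rightarrow> ('a, 'n) pi_field \<Rightarrow> ('a, 'n) tpoint \<Rightarrow> real" where
  "h_ricci M D X Y u = endo_trace M (fst u) (fibre_map M (\<lambda>Z. h_curvature M D X Z Y) u)"

definition ricci_op ::
  "('a, real^'n) chart set \<Rightarrow> (('a, 'n::finite) tpoint \<Rightarrow> real) \<Rightarrow> ('a, 'n) connection \<Rightarrow>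
   ('a, 'n) pi_field \<Rightarrow> ('a, 'n) pi_field" where
  "ricci_op M L D X u = (THE w. w \<in> tangent_space M (fst u) \<and>
     (\<forall>Y. pi_vector_field M Y \<longrightarrow> finsler_metric L u w (Y u) = h_ricci M D X Y u))"

definition m_projective_curvature ::
  "('a, real^'n) chart set \<Rightarrow> (('a, 'n::finite) tpoint \<Rightarrow> real) \<Rightarrow> ('a, 'n) connection \<Rightarrow>
   ('a, 'n) pi_field \<Rightarrow> ('a, 'n) pi_field \<Rightarrow> ('a, 'n) pi_field \<Rightarrow> ('a, 'n) pi_field" where
  "m_projective_curvature M L D X Y Z u =
     h_curvature M D X Y Z u -\<^sub>v (1 / (2 * (real CARD('n) - 1))) *\<^sub>v
       (h_ricci M D X Z u *\<^sub>v Y u -\<^sub>v h_ricci M D Y Z u *\<^sub>v X u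
        +\<^sub>v finsler_metric L u (X u) (Z u) *\<^sub>v ricci_op M L D Y u
        -\<^sub>v finsler_metric L u (Y u) (Z u) *\<^sub>v ricci_op M L D X u)"

definition h_nabla ::
  "('a, real^'n) chart set \<Rightarrow> ('a, 'n::finite) connection \<Rightarrow>
   ('a, 'n) pi_field \<Rightarrow> ('a, 'n) pi_field \<Rightarrow> ('a, 'n) pi_field" where
  "h_nabla M D W X u = D u (horizontal_map M D u (W u)) X"

definition h_nabla_tensor ::
  "('a, real^'n) chart set \<Rightarrow> ('a, 'n::finite) connection \<Rightarrow>
   (('a, 'n) pi_field \<Rightarrow> ('a, 'n) pi_field \<Rightarrow> ('a, 'n) pi_field \<Rightarrow> ('a, 'n) pi_field) \<Rightarrow>
   ('a, 'n) pi_field \<Rightarrow> ('a, 'n) pi_field \<Rightarrow> ('a, 'n) pi_field \<Rightarrow> ('a, 'n) pi_field \<Rightarrow> ('a, 'n) pi_field"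
where
  "h_nabla_tensor M D B W X Y Z u =
     h_nabla M D W (B X Y Z) u
     -\<^sub>v B (h_nabla M D W X) Y Z u
     -\<^sub>v B X (h_nabla M D W Y) Z u
     -\<^sub>v B X Y (h_nabla M D W Z) u"

definition recurrent_tensor ::
  "('a, real^'n) chart set \<Rightarrow> ('a, 'n::finite) connection \<Rightarrow>
   (('a, 'n) tpoint \<Rightarrow> ('a, real^'n) tvec \<Rightarrow> real) \<Rightarrow>
   (('a, 'n) pi_field \<Rightarrow> ('a, 'n) pi_field \<Rightarrow> ('a, 'n) pi_field \<Rightarrow> ('a, 'n) pi_field) \<Rightarrow> bool" where
  "recurrent_tensor M D A B \<longleftrightarrow>
     (\<forall>W X Y Z. pi_vector_field M W \<longrightarrow> pi_vector_field M X \<longrightarrow> pi_vector_field M Y \<longrightarrow>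
        pi_vector_field M Z \<longrightarrow>
        (\<forall>u\<in>slit_bundle M. h_nabla_tensor M D B W X Y Z u = A u (W u) *\<^sub>v B X Y Z u))"

text \<open>In the next two definitions \<open>D\<close> is the Cartan connection of \<open>(M, L)\<close>.\<close>

definition recurrent ::
  "('a, real^'n) chart set \<Rightarrow> ('a, 'n::finite) connection \<Rightarrow> bool" where
  "recurrent M D \<longleftrightarrow>
     (\<exists>X Y Z. pi_vector_field M X \<and> pi_vector_field M Y \<and> pi_vector_field M Z \<and>
        (\<exists>u\<in>slit_bundle M. h_curvature M D X Y Z u \<noteq> vzero)) \<and>
     (\<exists>A. nonzero_pi_form M A \<and> recurrent_tensor M D A (h_curvature M D))"

definition m_projectively_recurrent ::
  "('a, real^'n) chart set \<Rightarrow> (('a, 'n::finite) tpoint \<Rightarrow> real) \<Rightarrow> ('a, 'n) connection \<Rightarrow> bool" where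
  "m_projectively_recurrent M L D \<longleftrightarrow>
     (\<exists>A. nonzero_pi_form M A \<and> recurrent_tensor M D A (m_projective_curvature M L D))"

end

theory Submission
  imports Defs
begin

text \<open>
  Let \<open>\<nabla>\<^sup>h R = A \<otimes> R\<close>. The m-projective curvature tensor is obtained from \<open>R\<close> by linear operations
  that commute with the covariant derivative, so it is recurrent with the same form \<open>A\<close>. In
  detail, the horizontal Ricci tensor is a trace of \<open>R\<close>, hence \<open>\<nabla>\<^sup>h Ric = A \<otimes> Ric\<close>
  (\<open>ricci_recurrence\<close>). The operator \<open>Ric\<^sub>o\<close> arises from \<open>Ric\<close> by raising an index with \<open>g\<close>, which is
  parallel for the Cartan connection, hence \<open>\<nabla>\<^sup>h Ric\<^sub>o = A \<otimes> Ric\<^sub>o\<close> (\<open>ricci_op_recurrence\<close>). The other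
  ingredients, the arguments and \<open>g\<close>, are parallel, and the Leibniz rule gives the claim
  (\<open>m_projective_recurrence\<close>).

  The Leibniz rule is available for smooth functions and sections only. The greater part of the
  work is therefore to show that the objects above are smooth and tensorial. This comes down to the
  following points.

  Smooth sections and functions exist in abundance: a bump function on the manifold
  (\<open>cutoff_exists\<close>) extends every coordinate field to a global section. With such local frames,
  any operator that is linear over smooth functions is determined at a point by the values of its
  argument there, and any covariant derivative is given by connection coefficients
  (\<open>derivation_expansion\<close>).

  The horizontal lift is smooth (\<open>\<beta>_vector_field\<close>): its vertical components solve linear equations
  with smooth coefficients, uniquely so because the connection is regular.

  The bracket of vector fields is a vector field and acts on functions as a commutator
  (\<open>commutator_chart\<close>); both rest on the symmetry of second derivatives. It follows that the
  curvature is a smooth tensor in the arguments over which the Ricci tensor is formed.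

  The metric is a smooth bilinear form (\<open>g_chart\<close>), and \<open>Ric\<^sub>o\<close> is smooth, being again the
  solution of nondegenerate linear equations with smooth coefficients (\<open>ricci_op_pi\<close>).
\<close>

section \<open>Smooth functions between Euclidean spaces\<close>

lemma Ck_on_subset: "Ck_on k S f \<Longrightarrow> T \<subseteq> S \<Longrightarrow> Ck_on k T f"
  by (induction k arbitrary: f) (auto intro: continuous_on_subset)

lemma Ck_on_cong:
  assumes "open S" "Ck_on k S f" "\<forall>x\<in>S. f x = g x"
  shows "Ck_on k S g"
  using assms(2,3)
proof (induction k arbitrary: f g)
  case 0
  then show ?case by (metis Ck_on.simps(1) continuous_on_eq)
next
  case (Suc k)
  have *: "(g has_derivative frechet_derivative f (at x)) (at x)" if "x \<in> S" for x
  proof -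
    have "(f has_derivative frechet_derivative f (at x)) (at x)"
      using Suc.prems that by (simp add: frechet_derivative_works[symmetric])
    then show ?thesis
      using has_derivative_transform_within_open[OF _ assms(1) that] Suc.prems(2) by blast
  qed
  then have "\<forall>x\<in>S. frechet_derivative f (at x) v = frechet_derivative g (at x) v" for v
    using frechet_derivative_at by metis
  moreover have "Ck_on k S (\<lambda>x. frechet_derivative f (at x) v)" for v
    using Suc.prems(1) by simp
  ultimately have "Ck_on k S (\<lambda>x. frechet_derivative g (at x) v)" for v
    by (rule Suc.IH[rotated])
  then show ?case using * by (auto simp: differentiable_def)
qed

lemma Ck_on_SucI:
  assumes "open S" and "\<And>x. x \<in> S \<Longrightarrow> (f has_derivative f' x) (at x)"
    and "\<And>v. Ck_on k S (\<lambda>x. f' x v)"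
  shows "Ck_on (Suc k) S f"
proof -
  have "\<forall>x\<in>S. f' x v = frechet_derivative f (at x) v" for v
    using frechet_derivative_at[OF assms(2)] by metis
  then have "Ck_on k S (\<lambda>x. frechet_derivative f (at x) v)" for v
    by (rule Ck_on_cong[OF assms(1,3)])
  then show ?thesis using assms(2) by (auto simp: differentiable_def)
qed

lemma Ck_on_SucD:
  assumes "Ck_on (Suc k) S f"
  shows "x \<in> S \<Longrightarrow> (f has_derivative frechet_derivative f (at x)) (at x)"
    and "Ck_on k S (\<lambda>x. frechet_derivative f (at x) v)"
  using assms by (auto simp: frechet_derivative_works[symmetric])

lemma Ck_on_Suc: "Ck_on (Suc k) S f \<Longrightarrow> Ck_on k S f"
proof (induction k arbitrary: f)
  case 0
  then show ?case
    by (auto intro!: continuous_at_imp_continuous_on differentiable_imp_continuous_within)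
next
  case (Suc k)
  then show ?case using Ck_on.simps(2) by blast
qed

lemma Ck_on_const: "Ck_on k S (\<lambda>x. c)"
  by (induction k arbitrary: c) auto

lemma Ck_on_linear:
  assumes "open S" "bounded_linear f" shows "Ck_on k S f"
proof (cases k)
  case 0
  then show ?thesis using assms by (auto intro: linear_continuous_on)
next
  case (Suc m)
  show ?thesis unfolding Suc
    by (rule Ck_on_SucI[where f' = "\<lambda>x. f"])
       (use assms Ck_on_const in \<open>auto intro: bounded_linear_imp_has_derivative\<close>)
qed

lemma Ck_on_add:
  assumes "open S" "Ck_on k S f" "Ck_on k S g"
  shows "Ck_on k S (\<lambda>x. f x + g x)"
  using assms(2,3)
proof (induction k arbitrary: f g)
  case 0
  then show ?case by (auto intro: continuous_on_add)
next
  case (Suc k)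
  show ?case
    by (rule Ck_on_SucI[where f' = "\<lambda>x v. frechet_derivative f (at x) v + frechet_derivative g (at x) v"])
       (use assms Suc Ck_on_SucD[OF Suc.prems(1)] Ck_on_SucD[OF Suc.prems(2)] in
        \<open>auto intro: has_derivative_add\<close>)
qed

lemma Ck_on_bilinear:
  assumes "open S" "bounded_bilinear b" "Ck_on k S f" "Ck_on k S g"
  shows "Ck_on k S (\<lambda>x. b (f x) (g x))"
  using assms(3,4)
proof (induction k arbitrary: f g)
  case 0
  then show ?case by (auto intro: bounded_bilinear.continuous_on[OF assms(2)])
next
  case (Suc k)
  note f = Ck_on_SucD[OF Suc.prems(1)] Ck_on_Suc[OF Suc.prems(1)]
    and g = Ck_on_SucD[OF Suc.prems(2)] Ck_on_Suc[OF Suc.prems(2)]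
  show ?case
  proof (rule Ck_on_SucI)
    show "((\<lambda>x. b (f x) (g x)) has_derivative (\<lambda>v. b (f x) (frechet_derivative g (at x) v) +
          b (frechet_derivative f (at x) v) (g x))) (at x)" if "x \<in> S" for x
      by (rule bounded_bilinear.FDERIV[OF assms(2) f(1) g(1)]) (fact that)+
  qed (intro Ck_on_add assms(1) Suc.IH f g)+
qed

lemma Ck_on_sum:
  assumes "open S" "\<And>i. i \<in> I \<Longrightarrow> Ck_on k S (f i)"
  shows "Ck_on k S (\<lambda>x. \<Sum>i\<in>I. f i x)"
  using assms(2)
  by (induction I rule: infinite_finite_induct) (auto intro: Ck_on_const Ck_on_add assms(1))

lemma linear_basis_expansion:
  fixes f :: "'e::euclidean_space \<Rightarrow> 'f::real_vector"
  assumes "linear f"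
  shows "f v = (\<Sum>b\<in>Basis. (v \<bullet> b) *\<^sub>R f b)"
  by (subst euclidean_representation[of v, symmetric])
     (simp add: linear_sum[OF assms] linear_scale[OF assms])

text \<open>The direction in which the outer function is differentiated, the derivative of the inner one,
  varies with the point, whereas \<open>Ck_on\<close> speaks of constant directions only. Expanding it in the
  basis of the middle space writes the derivative as a sum of products of functions to which the
  induction hypothesis applies.\<close>

lemma Ck_on_compose:
  fixes f :: "'e::real_normed_vector \<Rightarrow> 'f::euclidean_space" and g :: "'f \<Rightarrow> 'g::real_normed_vector"
  assumes "open S" "open T" "Ck_on k S f" "Ck_on k T g" "f ` S \<subseteq> T"
  shows "Ck_on k S (\<lambda>x. g (f x))"
  using assms(3,4)
proof (induction k arbitrary: g)
  case 0
  then show ?case using assms(5) by (auto intro: continuous_on_compose2)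
next
  case (Suc k)
  note f = Ck_on_SucD[OF Suc.prems(1)] and g = Ck_on_SucD[OF Suc.prems(2)]
  have T: "f x \<in> T" if "x \<in> S" for x using that assms(5) by auto
  show ?case
  proof (rule Ck_on_SucI[where f' = "\<lambda>x v. \<Sum>b\<in>Basis.
        (frechet_derivative f (at x) v \<bullet> b) *\<^sub>R frechet_derivative g (at (f x)) b"])
    fix x assume x: "x \<in> S"
    have "linear (frechet_derivative g (at (f x)))"
      using g(1)[OF T[OF x]] by (simp add: has_derivative_linear)
    then have "(\<lambda>v. \<Sum>b\<in>Basis. (frechet_derivative f (at x) v \<bullet> b) *\<^sub>R frechet_derivative g (at (f x)) b)
      = (\<lambda>v. frechet_derivative g (at (f x)) (frechet_derivative f (at x) v))"
      using linear_basis_expansion by metis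
    then show "((\<lambda>x. g (f x)) has_derivative (\<lambda>v. \<Sum>b\<in>Basis.
        (frechet_derivative f (at x) v \<bullet> b) *\<^sub>R frechet_derivative g (at (f x)) b)) (at x)"
      using has_derivative_compose[OF f(1)[OF x] g(1)[OF T[OF x]]] by simp
  next
    fix v
    show "Ck_on k S (\<lambda>x. \<Sum>b\<in>Basis. (frechet_derivative f (at x) v \<bullet> b) *\<^sub>R
        frechet_derivative g (at (f x)) b)"
      by (intro Ck_on_sum Ck_on_bilinear[OF _ bounded_bilinear_scaleR] assms(1)
            Ck_on_bilinear[OF _ bounded_bilinear_inner] f(2) Ck_on_const Suc.IH
            Ck_on_Suc[OF Suc.prems(1)] g(2))
  qed (rule assms(1))
qed

lemma Ck_on_inverse:
  fixes f :: "'e::real_normed_vector \<Rightarrow> real"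
  assumes "open S" "Ck_on k S f" "\<forall>x\<in>S. f x \<noteq> 0"
  shows "Ck_on k S (\<lambda>x. inverse (f x))"
  using assms(2)
proof (induction k)
  case 0
  then show ?case using assms(3) by (auto intro: continuous_on_inverse)
next
  case (Suc k)
  note f = Ck_on_SucD[OF Suc.prems] and IH = Suc.IH[OF Ck_on_Suc[OF Suc.prems]]
  show ?case
  proof (rule Ck_on_SucI)
    show "((\<lambda>x. inverse (f x)) has_derivative
        (\<lambda>v. (- 1) * (inverse (f x) * frechet_derivative f (at x) v * inverse (f x)))) (at x)"
      if "x \<in> S" for x
      using that assms(3) f(1) by (auto intro!: derivative_eq_intros)
  qed (intro Ck_on_bilinear[OF _ bounded_bilinear_mult] assms(1) Ck_on_const f IH)+
qed

section \<open>Germs of smooth functions\<close>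

text \<open>Smoothness near a point. It is insensitive to what a function does away from the point, which is
  what all constructions with cutoff functions and changes of charts below rely on.\<close>

definition smooth_at :: "('e::real_normed_vector \<Rightarrow> 'f::real_normed_vector) \<Rightarrow> 'e \<Rightarrow> bool" where
  "smooth_at f x \<longleftrightarrow> (\<exists>S. open S \<and> x \<in> S \<and> smooth_on S f)"

lemma smooth_on_imp_at: "open S \<Longrightarrow> smooth_on S f \<Longrightarrow> x \<in> S \<Longrightarrow> smooth_at f x"
  by (auto simp: smooth_at_def)

lemma smooth_on_iff:
  assumes "open S"
  shows "smooth_on S f \<longleftrightarrow> (\<forall>x\<in>S. smooth_at f x)"
proof
  assume *: "\<forall>x\<in>S. smooth_at f x"
  have "Ck_on k S f" if "\<forall>x\<in>S. \<exists>T. open T \<and> x \<in> T \<and> Ck_on k T f" for k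
    using that
  proof (induction k arbitrary: f)
    case 0
    have "continuous (at x) f" if "x \<in> S" for x
      using 0 that by (auto simp: continuous_on_eq_continuous_at)
    then show ?case by (auto intro: continuous_at_imp_continuous_on)
  next
    case (Suc k)
    have "\<forall>x\<in>S. \<exists>T. open T \<and> x \<in> T \<and> Ck_on k T (\<lambda>x. frechet_derivative f (at x) v)" for v
      using Suc.prems Ck_on_SucD(2) by fast
    then show ?case using Suc.IH Suc.prems unfolding Ck_on.simps by blast
  qed
  then show "smooth_on S f" using * unfolding smooth_at_def smooth_on_def by meson
qed (use assms in \<open>auto intro: smooth_on_imp_at\<close>)

lemma eventually_smooth_at: "smooth_at f x \<Longrightarrow> \<forall>\<^sub>F y in nhds x. smooth_at f y"
  unfolding smooth_at_def eventually_nhds by blast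

lemma smooth_on_subset: "smooth_on S f \<Longrightarrow> T \<subseteq> S \<Longrightarrow> smooth_on T f"
  unfolding smooth_on_def using Ck_on_subset by blast

lemma smooth_atE2:
  assumes "smooth_at f x" "smooth_at g x"
  obtains S where "open S" "x \<in> S" "smooth_on S f" "smooth_on S g"
proof -
  obtain S T where "open S" "x \<in> S" "smooth_on S f" "open T" "x \<in> T" "smooth_on T g"
    using assms unfolding smooth_at_def by blast
  then show ?thesis
    by (intro that[of "S \<inter> T"]) (auto elim: smooth_on_subset)
qed

lemma smooth_at_cong:
  assumes "smooth_at f x" "\<forall>\<^sub>F y in nhds x. f y = g y"
  shows "smooth_at g x"
proof -
  obtain S T where "open S" "x \<in> S" "smooth_on S f" "open T" "x \<in> T" "\<forall>y\<in>T. f y = g y"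
    using assms unfolding smooth_at_def eventually_nhds by blast
  note * = this
  then have "smooth_on (S \<inter> T) g"
    using smooth_on_subset[of S f "S \<inter> T"] Ck_on_cong[of "S \<inter> T" _ f g]
    unfolding smooth_on_def by (auto simp: open_Int)
  then show ?thesis
    by (rule smooth_on_imp_at[rotated]) (use * in auto)
qed

lemma smooth_at_differentiable: "smooth_at f x \<Longrightarrow> f differentiable (at x)"
  unfolding smooth_at_def smooth_on_def by (meson Ck_on.simps(2))

lemma smooth_at_has_derivative:
  "smooth_at f x \<Longrightarrow> (f has_derivative frechet_derivative f (at x)) (at x)"
  using smooth_at_differentiable frechet_derivative_works by blast

lemma smooth_at_isCont: "smooth_at f x \<Longrightarrow> isCont f x"
  using smooth_at_differentiable differentiable_imp_continuous_within by blast

lemma smooth_at_const [simp]: "smooth_at (\<lambda>x. c) x"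
  unfolding smooth_at_def smooth_on_def using Ck_on_const open_UNIV by blast

lemma smooth_at_bounded_linear: "bounded_linear f \<Longrightarrow> smooth_at f x"
  unfolding smooth_at_def smooth_on_def using Ck_on_linear open_UNIV by blast

lemma smooth_at_ident [simp]: "smooth_at (\<lambda>x. x) x"
  by (rule smooth_at_bounded_linear) (rule bounded_linear_ident)

lemma smooth_at_add: "smooth_at f x \<Longrightarrow> smooth_at g x \<Longrightarrow> smooth_at (\<lambda>x. f x + g x) x"
  by (erule (1) smooth_atE2) (auto simp: smooth_at_def smooth_on_def intro!: Ck_on_add)

lemma smooth_at_bilinear:
  "bounded_bilinear b \<Longrightarrow> smooth_at f x \<Longrightarrow> smooth_at g x \<Longrightarrow> smooth_at (\<lambda>x. b (f x) (g x)) x"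
  by (erule (1) smooth_atE2) (auto simp: smooth_at_def smooth_on_def intro!: Ck_on_bilinear)

lemmas smooth_at_scaleR = smooth_at_bilinear[OF bounded_bilinear_scaleR]
lemmas smooth_at_mult = smooth_at_bilinear[OF bounded_bilinear_mult]
lemmas smooth_at_inner = smooth_at_bilinear[OF bounded_bilinear_inner]

lemma smooth_at_minus: "smooth_at f x \<Longrightarrow> smooth_at (\<lambda>x. - f x) x"
  using smooth_at_scaleR[OF smooth_at_const[of "-1"], of f x] by simp

lemma smooth_at_diff: "smooth_at f x \<Longrightarrow> smooth_at g x \<Longrightarrow> smooth_at (\<lambda>x. f x - g x) x"
  using smooth_at_add[OF _ smooth_at_minus] by fastforce

lemma smooth_at_sum:
  "(\<And>i. i \<in> I \<Longrightarrow> smooth_at (f i) x) \<Longrightarrow> smooth_at (\<lambda>x. \<Sum>i\<in>I. f i x) x"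
  by (induction I rule: infinite_finite_induct) (auto intro: smooth_at_add)

lemma smooth_at_prod:
  fixes f :: "'i \<Rightarrow> 'e::real_normed_vector \<Rightarrow> real"
  shows "(\<And>i. i \<in> I \<Longrightarrow> smooth_at (f i) x) \<Longrightarrow> smooth_at (\<lambda>x. \<Prod>i\<in>I. f i x) x"
  by (induction I rule: infinite_finite_induct) (auto intro: smooth_at_mult)

lemma smooth_at_compose:
  fixes f :: "'e::real_normed_vector \<Rightarrow> 'f::euclidean_space"
  assumes f: "smooth_at f x" and g: "smooth_at g (f x)"
  shows "smooth_at (\<lambda>x. g (f x)) x"
proof -
  obtain S T where S: "open S" "x \<in> S" "smooth_on S f" and T: "open T" "f x \<in> T" "smooth_on T g"
    using f g unfolding smooth_at_def by blast
  have "continuous_on S f" using S(3) Ck_on.simps(1) unfolding smooth_on_def by blast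
  then have o: "open (S \<inter> f -` T)" using S(1) T(1)
    by (simp add: continuous_on_open_vimage Int_commute)
  have "smooth_on (S \<inter> f -` T) (\<lambda>x. g (f x))"
    unfolding smooth_on_def
  proof
    fix k
    have "Ck_on k (S \<inter> f -` T) f" "Ck_on k T g"
      using S(3) T(3) Ck_on_subset[of k S f] unfolding smooth_on_def by auto
    then show "Ck_on k (S \<inter> f -` T) (\<lambda>x. g (f x))" by (rule Ck_on_compose[OF o T(1)]) auto
  qed
  then show ?thesis
    by (rule smooth_on_imp_at[OF o]) (use S T in auto)
qed

lemma smooth_at_linear:
  fixes f :: "'f::euclidean_space \<Rightarrow> 'g::real_normed_vector"
  assumes "bounded_linear f" "smooth_at g x" shows "smooth_at (\<lambda>x. f (g x)) x"
  using smooth_at_compose[OF assms(2) smooth_at_bounded_linear[OF assms(1)]] .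

lemma smooth_at_inverse:
  fixes f :: "'e::real_normed_vector \<Rightarrow> real"
  assumes f: "smooth_at f x" and "f x \<noteq> 0"
  shows "smooth_at (\<lambda>x. inverse (f x)) x"
proof -
  obtain S where S: "open S" "x \<in> S" "smooth_on S f"
    using f unfolding smooth_at_def by blast
  have "continuous_on S f" using S(3) Ck_on.simps(1) unfolding smooth_on_def by blast
  then have o: "open (S \<inter> f -` (- {0}))" using S(1)
    by (metis Int_commute closed_singleton continuous_on_open_vimage open_Compl)
  have "smooth_on (S \<inter> f -` (- {0})) (\<lambda>x. inverse (f x))"
    unfolding smooth_on_def
  proof
    fix k
    have "Ck_on k (S \<inter> f -` (- {0})) f"
      using S(3) Ck_on_subset[of k S f] unfolding smooth_on_def by auto
    then show "Ck_on k (S \<inter> f -` (- {0})) (\<lambda>x. inverse (f x))" by (rule Ck_on_inverse[OF o]) auto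
  qed
  then show ?thesis
    by (rule smooth_on_imp_at[OF o]) (use S assms(2) in auto)
qed

lemma smooth_at_divide:
  fixes f g :: "'e::real_normed_vector \<Rightarrow> real"
  shows "smooth_at f x \<Longrightarrow> smooth_at g x \<Longrightarrow> g x \<noteq> 0 \<Longrightarrow> smooth_at (\<lambda>x. f x / g x) x"
  unfolding divide_inverse by (intro smooth_at_mult smooth_at_inverse)

text \<open>As for compositions, a direction that varies with the point is expanded in a basis.\<close>

lemma smooth_at_frechet_derivative:
  fixes f :: "'e::euclidean_space \<Rightarrow> 'f::real_normed_vector"
  assumes f: "smooth_at f x" and v: "smooth_at v x"
  shows "smooth_at (\<lambda>y. frechet_derivative f (at y) (v y)) x"
proof -
  have "smooth_at (\<lambda>y. frechet_derivative f (at y) b) x" for b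
  proof -
    obtain S where "open S" "x \<in> S" "smooth_on S f" using f unfolding smooth_at_def by blast
    moreover from this(3) have "smooth_on S (\<lambda>y. frechet_derivative f (at y) b)"
      unfolding smooth_on_def using Ck_on_SucD(2) by blast
    ultimately show ?thesis unfolding smooth_at_def by blast
  qed
  then have "smooth_at (\<lambda>y. \<Sum>b\<in>Basis. (v y \<bullet> b) *\<^sub>R frechet_derivative f (at y) b) x"
    by (intro smooth_at_sum smooth_at_scaleR smooth_at_inner v smooth_at_const)
  moreover have "\<forall>\<^sub>F y in nhds x. (\<Sum>b\<in>Basis. (v y \<bullet> b) *\<^sub>R frechet_derivative f (at y) b)
      = frechet_derivative f (at y) (v y)"
    using eventually_smooth_at[OF f]
    by eventually_elim (metis smooth_at_has_derivative has_derivative_linear linear_basis_expansion)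
  ultimately show ?thesis by (rule smooth_at_cong)
qed

lemma smooth_at_vec_lambda:
  fixes f :: "'n::finite \<Rightarrow> 'e::real_normed_vector \<Rightarrow> real"
  assumes "\<And>i. smooth_at (f i) x"
  shows "smooth_at (\<lambda>x. \<chi> i. f i x) x"
proof -
  have "(\<lambda>x. \<chi> i. f i x) = (\<lambda>x. \<Sum>i\<in>UNIV. f i x *\<^sub>R axis i 1)"
    by (auto simp: vec_eq_iff axis_def if_distrib cong: if_cong)
  then show ?thesis
    using assms by (auto intro!: smooth_at_sum smooth_at_scaleR)
qed

lemma smooth_at_snd: "smooth_at f x \<Longrightarrow> smooth_at (\<lambda>x. snd (f x)) x"
  for f :: "'e::real_normed_vector \<Rightarrow> 'a::euclidean_space \<times> 'b::euclidean_space"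
  by (rule smooth_at_linear[OF bounded_linear_snd])

lemma smooth_at_Pair:
  fixes f :: "'e::real_normed_vector \<Rightarrow> 'a::euclidean_space" and g :: "'e \<Rightarrow> 'b::euclidean_space"
  assumes "smooth_at f x" "smooth_at g x"
  shows "smooth_at (\<lambda>x. (f x, g x)) x"
proof -
  have "bounded_linear (\<lambda>a::'a. (a, 0::'b))" "bounded_linear (\<lambda>b::'b. (0::'a, b))"
    by (auto intro!: bounded_linear_Pair bounded_linear_zero bounded_linear_ident)
  from smooth_at_add[OF smooth_at_linear[OF this(1) assms(1)] smooth_at_linear[OF this(2) assms(2)]]
  show ?thesis by simp
qed

lemma smooth_at_det:
  fixes A :: "'e::real_normed_vector \<Rightarrow> real^'n^'n::finite"
  assumes "\<And>i j. smooth_at (\<lambda>x. A x $ i $ j) x"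
  shows "smooth_at (\<lambda>x. det (A x)) x"
  unfolding det_def
  by (intro smooth_at_sum smooth_at_mult smooth_at_prod smooth_at_const assms)

text \<open>Cramer's rule writes the solution as a quotient of determinants, which are polynomials in the
  coefficients. This is why horizontal lifts and the Ricci operator, both of which are given by
  linear equations, are smooth.\<close>

lemma smooth_at_linear_solution:
  fixes A :: "'e::real_normed_vector \<Rightarrow> real^'n^'n::finite"
  assumes A: "\<And>i j. smooth_at (\<lambda>x. A x $ i $ j) x" and r: "\<And>i. smooth_at (\<lambda>x. r x $ i) x"
    and inj: "\<And>w. A x *v w = 0 \<Longrightarrow> w = 0"
    and sol: "\<forall>\<^sub>F y in nhds x. A y *v b y = r y"
  shows "smooth_at b x"
proof -
  have "inj ((*v) (A x))"
    using inj by (simp add: linear_injective_0)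
  then have d: "det (A x) \<noteq> 0"
    using det_nz_iff_inj by (metis matrix_of_matrix_vector_mul matrix_vector_mul_linear)
  have "isCont (\<lambda>x. det (A x)) x" by (intro smooth_at_isCont smooth_at_det A)
  then have "\<forall>\<^sub>F y in at x. det (A y) \<noteq> 0"
    using d isCont_def tendsto_imp_eventually_ne by blast
  then have "\<forall>\<^sub>F y in nhds x. det (A y) \<noteq> 0"
    using d by (simp add: eventually_nhds_conv_at)
  then have "\<forall>\<^sub>F y in nhds x. (\<chi> k. det (\<chi> i j. if j = k then r y $ i else A y $ i $ j) / det (A y)) = b y"
    using sol by eventually_elim (simp add: cramer)
  moreover have "smooth_at (\<lambda>y. \<chi> k. det (\<chi> i j. if j = k then r y $ i else A y $ i $ j) / det (A y)) x"
  proof (intro smooth_at_vec_lambda smooth_at_divide smooth_at_det A d)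
    fix k i j
    show "smooth_at (\<lambda>y. (\<chi> i j. if j = k then r y $ i else A y $ i $ j) $ i $ j) x"
      by (cases "j = k") (use A r in auto)
  qed
  ultimately show ?thesis using smooth_at_cong by blast
qed

section \<open>Symmetry of second derivatives\<close>

lemma smooth_at_has_real_derivative_line:
  fixes f :: "'e::euclidean_space \<Rightarrow> real"
  assumes "smooth_at f (a + s *\<^sub>R v)"
  shows "((\<lambda>s. f (a + s *\<^sub>R v)) has_real_derivative frechet_derivative f (at (a + s *\<^sub>R v)) v) (at s)"
proof -
  note d = smooth_at_has_derivative[OF assms]
  have "((\<lambda>s. a + s *\<^sub>R v) has_derivative (\<lambda>h. h *\<^sub>R v)) (at s)"
    by (auto intro!: derivative_eq_intros)
  note has_derivative_compose[OF this d]
  moreover have "(\<lambda>h. frechet_derivative f (at (a + s *\<^sub>R v)) (h *\<^sub>R v)) =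
      (*) (frechet_derivative f (at (a + s *\<^sub>R v)) v)"
    using linear_scale[OF has_derivative_linear[OF d]] by (simp add: fun_eq_iff)
  ultimately show ?thesis
    unfolding has_field_derivative_def by simp
qed

text \<open>The mean value theorem in the direction \<open>v\<close>, then in the direction \<open>w\<close>. The second difference is
  symmetric in \<open>v\<close> and \<open>w\<close>, so the two mixed derivatives agree at some points arbitrarily close to
  \<open>x\<close>, hence by continuity at \<open>x\<close>.\<close>

lemma second_difference_mean_value:
  fixes f :: "'e::euclidean_space \<Rightarrow> real"
  assumes sm: "\<And>y. dist x y \<le> h * (norm v + norm w) \<Longrightarrow> smooth_at f y" and h: "h > 0"
  obtains y where "dist x y \<le> h * (norm v + norm w)"
    "f (x + h *\<^sub>R v + h *\<^sub>R w) - f (x + h *\<^sub>R v) - f (x + h *\<^sub>R w) + f x =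
      h * h * frechet_derivative (\<lambda>z. frechet_derivative f (at z) v) (at y) w"
proof -
  have near: "dist x (x + s *\<^sub>R v + t *\<^sub>R w) \<le> h * (norm v + norm w)"
    if "0 \<le> s" "s \<le> h" "0 \<le> t" "t \<le> h" for s t
  proof -
    have "norm (s *\<^sub>R v + t *\<^sub>R w) \<le> s * norm v + t * norm w"
      using norm_triangle_ineq[of "s *\<^sub>R v" "t *\<^sub>R w"] that by simp
    also have "\<dots> \<le> h * (norm v + norm w)"
      using that by (simp add: distrib_left add_mono mult_right_mono)
    finally show ?thesis
      by (metis (no_types) add.assoc add_diff_cancel_left' dist_commute dist_norm)
  qed
  define \<phi> where "\<phi> s = f (x + h *\<^sub>R w + s *\<^sub>R v) - f (x + s *\<^sub>R v)" for s
  have "\<exists>z>0. z < h \<and> \<phi> h - \<phi> 0 = (h - 0) *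
      (frechet_derivative f (at (x + h *\<^sub>R w + z *\<^sub>R v)) v - frechet_derivative f (at (x + z *\<^sub>R v)) v)"
  proof (rule MVT2[OF h])
    fix s assume s: "0 \<le> s" "s \<le> h"
    have "smooth_at f (x + h *\<^sub>R w + s *\<^sub>R v)"
      using sm[OF near[OF s, of h]] h by (simp add: add.assoc add.commute add.left_commute)
    moreover have "smooth_at f (x + s *\<^sub>R v)" using sm[OF near[OF s, of 0]] h by simp
    ultimately show "(\<phi> has_real_derivative frechet_derivative f (at (x + h *\<^sub>R w + s *\<^sub>R v)) v
        - frechet_derivative f (at (x + s *\<^sub>R v)) v) (at s)"
      unfolding \<phi>_def by (intro DERIV_diff smooth_at_has_real_derivative_line)
  qed
  then obtain s where s: "0 < s" "s < h" and 1: "\<phi> h - \<phi> 0 = h *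
      (frechet_derivative f (at (x + h *\<^sub>R w + s *\<^sub>R v)) v - frechet_derivative f (at (x + s *\<^sub>R v)) v)"
    by auto
  define \<psi> where "\<psi> t = frechet_derivative f (at (x + s *\<^sub>R v + t *\<^sub>R w)) v" for t
  have "\<exists>z>0. z < h \<and> \<psi> h - \<psi> 0 = (h - 0) *
      frechet_derivative (\<lambda>z. frechet_derivative f (at z) v) (at (x + s *\<^sub>R v + z *\<^sub>R w)) w"
    unfolding \<psi>_def
    by (rule MVT2[OF h])
       (use s sm near in \<open>auto intro!: smooth_at_has_real_derivative_line smooth_at_frechet_derivative\<close>)
  then obtain t where t: "0 < t" "t < h" and 2: "\<psi> h - \<psi> 0 = h *
      frechet_derivative (\<lambda>z. frechet_derivative f (at z) v) (at (x + s *\<^sub>R v + t *\<^sub>R w)) w"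
    by auto
  have "f (x + h *\<^sub>R v + h *\<^sub>R w) - f (x + h *\<^sub>R v) - f (x + h *\<^sub>R w) + f x = \<phi> h - \<phi> 0"
    unfolding \<phi>_def by (simp add: algebra_simps)
  also have "\<dots> = h * (\<psi> h - \<psi> 0)"
    using 1 unfolding \<psi>_def by (simp add: algebra_simps)
  also have "\<dots> = h * h * frechet_derivative (\<lambda>z. frechet_derivative f (at z) v) (at (x + s *\<^sub>R v + t *\<^sub>R w)) w"
    using 2 by simp
  finally show ?thesis using near[of s t] s t that by auto
qed

lemma smooth_at_tendsto: "smooth_at f x \<Longrightarrow> (f \<longlongrightarrow> f x) (nhds x)"
  using smooth_at_isCont unfolding isCont_def by (metis tendsto_at_iff_tendsto_nhds)

lemma second_derivative_symmetric_real:
  fixes f :: "'e::euclidean_space \<Rightarrow> real"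
  assumes "smooth_at f x"
  shows "frechet_derivative (\<lambda>y. frechet_derivative f (at y) v) (at x) w =
    frechet_derivative (\<lambda>y. frechet_derivative f (at y) w) (at x) v" (is "?A v w x = ?A w v x")
proof (rule ccontr)
  assume ne: "?A v w x \<noteq> ?A w v x"
  define e where "e = \<bar>?A v w x - ?A w v x\<bar> / 2"
  have e: "e > 0" using ne unfolding e_def by simp
  have c: "isCont (?A v w) x" "isCont (?A w v) x"
    by (intro smooth_at_isCont smooth_at_frechet_derivative assms smooth_at_const)+
  have "\<forall>\<^sub>F y in nhds x. smooth_at f y \<and> dist (?A v w y) (?A v w x) < e \<and> dist (?A w v y) (?A w v x) < e"
    using c e unfolding isCont_def by (intro tendstoD[OF smooth_at_tendsto] smooth_at_frechet_derivative smooth_at_const eventually_conj eventually_smooth_at assms tendstoD)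
  then obtain r where r: "r > 0" and
    ball: "\<And>y. dist y x < r \<Longrightarrow> smooth_at f y \<and> dist (?A v w y) (?A v w x) < e \<and> dist (?A w v y) (?A w v x) < e"
    unfolding eventually_nhds_metric by auto
  define h where "h = r / (2 * (norm v + norm w + 1))"
  have pos: "norm v + norm w + 1 > 0" using norm_ge_zero[of v] norm_ge_zero[of w] by linarith
  have h: "h > 0" using r pos unfolding h_def by simp
  have "h * (norm v + norm w) \<le> h * (norm v + norm w + 1)" using h by simp
  also have "\<dots> = r / 2" using pos unfolding h_def by (simp add: field_simps)
  finally have hr: "h * (norm v + norm w) < r" using r by simp
  have sm: "smooth_at f y" if "dist x y \<le> h * (norm v + norm w)" for y
    using ball[of y] that hr by (simp add: dist_commute)
  obtain y where y: "dist x y \<le> h * (norm v + norm w)"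
    and 1: "f (x + h *\<^sub>R v + h *\<^sub>R w) - f (x + h *\<^sub>R v) - f (x + h *\<^sub>R w) + f x = h * h * ?A v w y"
    using second_difference_mean_value[OF sm h] by blast
  have sm': "smooth_at f y" if "dist x y \<le> h * (norm w + norm v)" for y
    using sm[of y] that by (simp add: add.commute)
  obtain z where z: "dist x z \<le> h * (norm w + norm v)"
    and 2: "f (x + h *\<^sub>R w + h *\<^sub>R v) - f (x + h *\<^sub>R w) - f (x + h *\<^sub>R v) + f x = h * h * ?A w v z"
    using second_difference_mean_value[OF sm' h] by blast
  have "h * h * ?A v w y = h * h * ?A w v z"
    unfolding 1[symmetric] 2[symmetric] by (simp add: algebra_simps)
  then have "?A v w y = ?A w v z" using h by simp
  moreover have "dist (?A v w y) (?A v w x) < e" "dist (?A w v z) (?A w v x) < e"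
    using ball[of y] ball[of z] y z hr by (auto simp: dist_commute add.commute)
  ultimately have "dist (?A v w x) (?A v w y) < \<bar>?A v w x - ?A w v x\<bar> / 2"
    "dist (?A w v x) (?A v w y) < \<bar>?A v w x - ?A w v x\<bar> / 2"
    unfolding e_def by (simp_all only: dist_commute)
  then have "dist (?A v w x) (?A w v x) < \<bar>?A v w x - ?A w v x\<bar>"
    by (rule dist_triangle_half_l)
  then show False by (simp add: dist_real_def)
qed

lemma frechet_derivative_inner_right:
  "f differentiable (at x) \<Longrightarrow>
    frechet_derivative (\<lambda>y. f y \<bullet> b) (at x) v = frechet_derivative f (at x) v \<bullet> b"
  by (metis bounded_linear.has_derivative[OF bounded_linear_inner_left] frechet_derivative_at
      frechet_derivative_works)

lemma frechet_derivative_cong: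
  assumes "\<forall>\<^sub>F y in nhds x. f y = g y"
  shows "frechet_derivative f (at x) = frechet_derivative g (at x)"
proof -
  have e: "\<forall>\<^sub>F y in at x. f y = g y" and e': "f x = g x"
    using assms by (auto simp: eventually_nhds_conv_at)
  have "(f has_derivative D) (at x) \<longleftrightarrow> (g has_derivative D) (at x)" for D
    using has_derivative_transform_eventually[of f D x UNIV g]
      has_derivative_transform_eventually[of g D x UNIV f] e e' by (auto simp: eq_commute)
  then show ?thesis unfolding frechet_derivative_def by simp
qed

text \<open>The scalar case, applied to each component.\<close>

lemma second_derivative_symmetric:
  fixes f :: "'e::euclidean_space \<Rightarrow> 'f::euclidean_space"
  assumes "smooth_at f x"
  shows "frechet_derivative (\<lambda>y. frechet_derivative f (at y) v) (at x) w =
    frechet_derivative (\<lambda>y. frechet_derivative f (at y) w) (at x) v"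
proof (rule euclidean_eqI)
  fix b :: 'f assume "b \<in> Basis"
  have *: "frechet_derivative (\<lambda>y. frechet_derivative f (at y) v) (at x) w \<bullet> b =
     frechet_derivative (\<lambda>y. frechet_derivative (\<lambda>y. f y \<bullet> b) (at y) v) (at x) w" for v w
  proof -
    have "frechet_derivative (\<lambda>y. frechet_derivative f (at y) v) (at x) w \<bullet> b =
      frechet_derivative (\<lambda>y. frechet_derivative f (at y) v \<bullet> b) (at x) w"
      by (intro frechet_derivative_inner_right[symmetric] smooth_at_differentiable
          smooth_at_frechet_derivative assms smooth_at_const)
    also have "\<dots> = frechet_derivative (\<lambda>y. frechet_derivative (\<lambda>y. f y \<bullet> b) (at y) v) (at x) w"
      by (rule arg_cong[where f="\<lambda>F. F w"], rule frechet_derivative_cong)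
         (use eventually_smooth_at[OF assms] in
           \<open>eventually_elim, simp add: frechet_derivative_inner_right smooth_at_differentiable\<close>)
    finally show ?thesis .
  qed
  show "frechet_derivative (\<lambda>y. frechet_derivative f (at y) v) (at x) w \<bullet> b =
    frechet_derivative (\<lambda>y. frechet_derivative f (at y) w) (at x) v \<bullet> b"
    unfolding * by (intro second_derivative_symmetric_real smooth_at_inner assms smooth_at_const)
qed

section \<open>Bump functions\<close>

text \<open>The powers of \<open>1/x\<close> are there because derivatives of \<open>exp (-1/x)\<close> produce them: the linear span of
  this family is closed under differentiation.\<close>

definition flat_exp :: "nat \<Rightarrow> real \<Rightarrow> real" where
  "flat_exp n x = (if x > 0 then exp (- inverse x) * inverse x ^ n else 0)"

text \<open>One term of the exponential series of \<open>y = 1/x\<close> gives \<open>y^(n+2) / (n+2)! \<le> exp y\<close>. The bound is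
  quadratic so that the derivative at the origin is seen to be \<open>0\<close>.\<close>

lemma flat_exp_bound: "\<bar>flat_exp n x\<bar> \<le> fact (n + 2) * x\<^sup>2"
proof (cases "x > 0")
  case True
  define y where "y = inverse x"
  have y: "y > 0" using True y_def by simp
  have "y ^ (n + 2) / fact (n + 2) \<le> exp y"
  proof -
    have "(\<lambda>k. y ^ k / fact k) sums exp y"
      using exp_converges[of y] by (simp add: divide_inverse mult.commute)
    then have "(\<Sum>k\<in>{n + 2}. y ^ k / fact k) \<le> exp y"
      using sum_le_suminf[of "\<lambda>k. y ^ k / fact k" "{n + 2}"] y by (simp add: sums_iff)
    then show ?thesis by simp
  qed
  then have "y ^ (n + 2) \<le> fact (n + 2) * exp y"
    by (subst (asm) pos_divide_le_eq) (simp_all add: mult.commute del: fact_Suc add_2_eq_Suc')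
  then have "y ^ n * exp (- y) \<le> fact (n + 2) * inverse y ^ 2"
    using y by (simp add: field_simps exp_minus power_add power2_eq_square del: fact_Suc add_2_eq_Suc')
  then show ?thesis using True y_def by (simp add: flat_exp_def mult.commute)
qed (simp add: flat_exp_def)

lemma flat_exp_deriv:
  "(flat_exp n has_real_derivative flat_exp (n + 2) x - real n * flat_exp (n + 1) x) (at x)"
proof -
  consider "x > 0" | "x < 0" | "x = 0" by linarith
  then show ?thesis
  proof cases
    case 1
    have "((\<lambda>x. exp (- inverse x) * inverse x ^ n) has_real_derivative
        flat_exp (n + 2) x - real n * flat_exp (n + 1) x) (at x)"
    proof -
      define y where "y = inverse x"
      have "(inverse has_real_derivative - (y * y)) (at x)"
        using DERIV_inverse[of x] 1 unfolding y_def by simp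
      then have i: "((\<lambda>x. - inverse x) has_real_derivative y * y) (at x)"
        and p: "((\<lambda>x. inverse x ^ n) has_real_derivative of_nat n * (- (y * y) * inverse x ^ (n - Suc 0))) (at x)"
        using DERIV_minus[of inverse "- (y * y)"] DERIV_power[of inverse "- (y * y)"] by auto
      have "of_nat n * (- (y * y) * inverse x ^ (n - Suc 0)) = - real n * y ^ (n + 1)"
        unfolding y_def[symmetric] by (cases n) (auto simp: algebra_simps)
      with p have "((\<lambda>x. inverse x ^ n) has_real_derivative - real n * y ^ (n + 1)) (at x)"
        by (simp only:)
      from DERIV_mult[OF DERIV_fun_exp[OF i] this] 1 show ?thesis
        unfolding y_def[symmetric]
        by (simp add: flat_exp_def y_def[symmetric] algebra_simps power_add)
    qed
    then show ?thesis
      by (rule has_field_derivative_transform_within_open[where S = "{0<..}"])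
         (use 1 in \<open>auto simp: flat_exp_def\<close>)
  next
    case 2
    have "((\<lambda>x. 0) has_real_derivative flat_exp (n + 2) x - real n * flat_exp (n + 1) x) (at x)"
      using 2 by (simp add: flat_exp_def)
    then show ?thesis
      by (rule has_field_derivative_transform_within_open[where S = "{..<0}"])
         (use 2 in \<open>auto simp: flat_exp_def\<close>)
  next
    case 3
    have "((\<lambda>h. flat_exp n h / h) \<longlongrightarrow> 0) (at 0)"
    proof (rule Lim_null_comparison)
      show "\<forall>\<^sub>F h in at 0. norm (flat_exp n h / h) \<le> fact (n + 2) * \<bar>h\<bar>"
      proof (rule always_eventually, rule)
        fix h :: real
        show "norm (flat_exp n h / h) \<le> fact (n + 2) * \<bar>h\<bar>"
        proof (cases "h = 0")
          case False
          have "\<bar>flat_exp n h\<bar> \<le> fact (n + 2) * \<bar>h\<bar> * \<bar>h\<bar>"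
            using flat_exp_bound[of n h] by (simp only: power2_eq_square mult.assoc abs_mult_self_eq)
          then show ?thesis using False by (simp only: pos_divide_le_eq real_norm_def abs_divide zero_less_abs_iff not_False_eq_True)
        qed simp
      qed
      show "((\<lambda>h. fact (n + 2) * \<bar>h\<bar>) \<longlongrightarrow> 0) (at (0::real))"
        by (auto intro!: tendsto_eq_intros)
    qed
    moreover have "flat_exp m 0 = 0" for m by (simp add: flat_exp_def)
    ultimately show ?thesis using 3 by (simp add: has_field_derivative_iff)
  qed
qed

lemma smooth_at_flat_exp: "smooth_at (flat_exp n) x"
proof -
  have "Ck_on k UNIV (flat_exp n)" for k
  proof (induction k arbitrary: n)
    case 0
    then show ?case
      by (auto intro!: continuous_at_imp_continuous_on DERIV_isCont flat_exp_deriv)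
  next
    case (Suc k)
    show ?case
    proof (rule Ck_on_SucI)
      show "(flat_exp n has_derivative
          (\<lambda>v. (flat_exp (n + 2) x + (- real n) * flat_exp (n + 1) x) * v)) (at x)" for x
        using flat_exp_deriv[of n x] by (simp add: has_field_derivative_def)
    next
      fix v
      show "Ck_on k UNIV (\<lambda>x. (flat_exp (n + 2) x + (- real n) * flat_exp (n + 1) x) * v)"
        by (intro Ck_on_bilinear[OF _ bounded_bilinear_mult] Ck_on_add Ck_on_const Suc.IH) auto
    qed simp
  qed
  then show ?thesis unfolding smooth_at_def smooth_on_def by blast
qed

text \<open>The quotient \<open>\<phi>(t) / (\<phi>(t) + \<phi>(1 - t))\<close> with \<open>\<phi>(t) = exp (-1/t)\<close> is a smooth step, equal to \<open>0\<close>
  for \<open>t \<le> 0\<close> and to \<open>1\<close> for \<open>t \<ge> 1\<close>. Here \<open>t\<close> falls from \<open>2\<close> at the centre to \<open>0\<close> at the distance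
  \<open>r\<close>, so that the function is constant near the centre.\<close>

lemma bump_function:
  fixes a :: "'e::euclidean_space"
  assumes "r > 0"
  obtains f :: "'e \<Rightarrow> real" where "\<And>x. smooth_at f x" "\<forall>\<^sub>F x in nhds a. f x = 1" "\<And>x. x \<notin> cball a r \<Longrightarrow> f x = 0"
proof -
  define t where "t x = 2 - 2 * inverse (r * r) * ((x - a) \<bullet> (x - a))" for x
  define f where "f x = flat_exp 0 (t x) / (flat_exp 0 (t x) + flat_exp 0 (1 - t x))" for x
  have pos: "flat_exp 0 s + flat_exp 0 (1 - s) > 0" for s
    by (auto simp: flat_exp_def add_pos_pos)
  have t: "smooth_at t x" for x unfolding t_def
    by (intro smooth_at_diff smooth_at_mult smooth_at_inner smooth_at_const smooth_at_ident)
  have "smooth_at f x" for x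
    unfolding f_def
    by (intro smooth_at_divide smooth_at_add smooth_at_compose[OF _ smooth_at_flat_exp] smooth_at_diff
        smooth_at_const t) (use pos[of "t x"] in simp)
  moreover have "\<forall>\<^sub>F x in nhds a. f x = 1"
  proof -
    have "(t \<longlongrightarrow> t a) (nhds a)"
      by (rule smooth_at_tendsto[OF t])
    moreover have "t a > 1" by (simp add: t_def)
    ultimately have "\<forall>\<^sub>F x in nhds a. t x > 1" by (rule order_tendstoD)
    then show ?thesis by eventually_elim (simp add: f_def flat_exp_def)
  qed
  moreover have "f x = 0" if "x \<notin> cball a r" for x
  proof -
    have "r < norm (x - a)" using that by (simp add: dist_norm norm_minus_commute)
    then have "r * r < (x - a) \<bullet> (x - a)"
      unfolding power2_norm_eq_inner[symmetric] power2_eq_square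
      using assms by (intro mult_strict_mono) auto
    then have "t x \<le> 0" using assms unfolding t_def by (simp add: field_simps)
    then show ?thesis by (simp add: f_def flat_exp_def)
  qed
  ultimately show ?thesis using that by blast
qed

section \<open>Charts and tangent vectors\<close>

text \<open>What a manifold and its slit tangent bundle have in common, stated through charts alone since the
  slit tangent bundle is described by its charts only.\<close>

locale smooth_atlas =
  fixes M :: "('a, 'e::euclidean_space) chart set"
  assumes inj_chart: "c \<in> M \<Longrightarrow> inj_on (snd c) (fst c)"
    and open_overlap: "c \<in> M \<Longrightarrow> d \<in> M \<Longrightarrow> open (snd c ` (fst c \<inter> fst d))"
    and smooth_transition: "c \<in> M \<Longrightarrow> d \<in> M \<Longrightarrow> p \<in> fst c \<Longrightarrow> p \<in> fst d \<Longrightarrow>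
        smooth_at (snd d \<circ> chart_inv c) (snd c p)"

definition points :: "('a, 'e) chart set \<Rightarrow> 'a set" where
  "points M = (\<Union>c\<in>M. fst c)"

text \<open>The derivative at \<open>p\<close> of the change of coordinates from \<open>c\<close> to \<open>d\<close>.\<close>

definition jac :: "('a, 'e::real_normed_vector) chart \<Rightarrow> ('a, 'e) chart \<Rightarrow> 'a \<Rightarrow> 'e \<Rightarrow> 'e" where
  "jac c d p = frechet_derivative (snd d \<circ> chart_inv c) (at (snd c p))"

text \<open>The neighbourhood filter of \<open>p\<close>, carried over from Euclidean space by a chart. The chart that is
  chosen here, as in the next two definitions, does not matter: see \<open>eventually_point_nhds\<close>,
  \<open>smooth_germ_iff\<close> and \<open>vec_deriv_chart\<close>.\<close>

definition point_nhds :: "('a, 'e::real_normed_vector) chart set \<Rightarrow> 'a \<Rightarrow> 'a filter" where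
  "point_nhds M p = filtermap (chart_inv (chart_at M p)) (nhds (snd (chart_at M p) p))"

definition smooth_germ ::
  "('a, 'e::real_normed_vector) chart set \<Rightarrow> ('a \<Rightarrow> 'f::real_normed_vector) \<Rightarrow> 'a \<Rightarrow> bool" where
  "smooth_germ M F p \<longleftrightarrow> smooth_at (\<lambda>x. F (chart_inv (chart_at M p) x)) (snd (chart_at M p) p)"

text \<open>Directional derivatives of functions with values in a vector space; they serve for scalar
  functions and for the component functions of vector fields alike.\<close>

definition vec_deriv ::
  "('a, 'e::euclidean_space) chart set \<Rightarrow> 'a \<Rightarrow> ('a, 'e) tvec \<Rightarrow> ('a \<Rightarrow> 'f::real_normed_vector) \<Rightarrow> 'f" where
  "vec_deriv M p v F = frechet_derivative (\<lambda>x. F (chart_inv (chart_at M p) x))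
     (at (snd (chart_at M p) p)) (v (chart_at M p))"

lemma dir_deriv_eq_vec_deriv: "dir_deriv M p v f = vec_deriv M p v f"
  by (simp add: dir_deriv_def vec_deriv_def Let_def comp_def)

text \<open>The tangent vector at \<open>p\<close> whose components in the chart \<open>c\<close> are \<open>e\<close>.\<close>

definition tvec_of ::
  "('a, 'e::euclidean_space) chart set \<Rightarrow> ('a, 'e) chart \<Rightarrow> 'a \<Rightarrow> 'e \<Rightarrow> ('a, 'e) tvec" where
  "tvec_of M c p e = (\<lambda>d. if d \<in> M \<and> p \<in> fst d then jac c d p e else 0)"

declare split_paired_All [simp del] split_paired_Ex [simp del]

lemmas tvec_simps = vadd_def vsub_def vscale_def vzero_def

context smooth_atlas
begin

lemma chart_inv_eq: "c \<in> M \<Longrightarrow> p \<in> fst c \<Longrightarrow> chart_inv c (snd c p) = p"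
  unfolding chart_inv_def using inj_chart by simp

lemma open_chart_image: "c \<in> M \<Longrightarrow> open (chart_image c)"
  unfolding chart_image_def using open_overlap[of c c] by simp

lemma chart_at: "p \<in> points M \<Longrightarrow> chart_at M p \<in> M \<and> p \<in> fst (chart_at M p)"
  unfolding chart_at_def points_def by (rule someI_ex) auto

lemma pointsI: "c \<in> M \<Longrightarrow> p \<in> fst c \<Longrightarrow> p \<in> points M"
  by (auto simp: points_def)

lemma chart_at': "c \<in> M \<Longrightarrow> p \<in> fst c \<Longrightarrow> chart_at M p \<in> M"
  "c \<in> M \<Longrightarrow> p \<in> fst c \<Longrightarrow> p \<in> fst (chart_at M p)"
  using chart_at pointsI by blast+

lemma eventually_overlap:
  assumes "c \<in> M" "d \<in> M" "p \<in> fst c" "p \<in> fst d"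
  shows "\<forall>\<^sub>F x in nhds (snd c p). \<exists>q. q \<in> fst c \<and> q \<in> fst d \<and> x = snd c q"
  using eventually_nhds_in_open[OF open_overlap[OF assms(1,2)], of "snd c p"] assms
  by (auto elim!: eventually_mono)

text \<open>Changes of coordinates are continuous.\<close>

lemma eventually_transfer_chart:
  assumes "c \<in> M" "d \<in> M" "p \<in> fst c" "p \<in> fst d"
    and "\<forall>\<^sub>F x in nhds (snd d p). P (chart_inv d x)"
  shows "\<forall>\<^sub>F x in nhds (snd c p). P (chart_inv c x)"
proof -
  have "((snd d \<circ> chart_inv c) \<longlongrightarrow> snd d p) (nhds (snd c p))"
    using smooth_at_tendsto[OF smooth_transition[OF assms(1-4)]] chart_inv_eq assms by simp
  then have "\<forall>\<^sub>F x in nhds (snd c p). P (chart_inv d ((snd d \<circ> chart_inv c) x))"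
    using assms(5) by (auto simp: filterlim_iff elim!: allE[of _ "\<lambda>x. P (chart_inv d x)"])
  with eventually_overlap[OF assms(1-4)] show ?thesis
    by eventually_elim (auto simp: assms chart_inv_eq)
qed

lemma eventually_point_nhds:
  assumes "c \<in> M" "p \<in> fst c"
  shows "eventually P (point_nhds M p) \<longleftrightarrow> (\<forall>\<^sub>F x in nhds (snd c p). P (chart_inv c x))"
  unfolding point_nhds_def eventually_filtermap
  using eventually_transfer_chart[of c "chart_at M p" p P] eventually_transfer_chart[of "chart_at M p" c p P]
    assms chart_at' by blast

lemma eventually_in_chart:
  assumes "c \<in> M" "p \<in> fst c"
  shows "\<forall>\<^sub>F q in point_nhds M p. q \<in> fst c"
  unfolding eventually_point_nhds[OF assms]
  using eventually_overlap[OF assms(1,1,2,2)] by eventually_elim (auto simp: assms chart_inv_eq)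

lemma eventually_point_nhds_self:
  "p \<in> points M \<Longrightarrow> eventually P (point_nhds M p) \<Longrightarrow> P p"
  using eventually_nhds_x_imp_x chart_at chart_inv_eq unfolding point_nhds_def eventually_filtermap
  by metis

lemma smooth_germ_iff:
  assumes "c \<in> M" "p \<in> fst c"
  shows "smooth_germ M F p \<longleftrightarrow> smooth_at (\<lambda>x. F (chart_inv c x)) (snd c p)"
proof -
  have *: "smooth_at (\<lambda>x. F (chart_inv c x)) (snd c p)"
    if "smooth_at (\<lambda>x. F (chart_inv d x)) (snd d p)" "c \<in> M" "d \<in> M" "p \<in> fst c" "p \<in> fst d" for c d
  proof -
    have "smooth_at (\<lambda>x. F (chart_inv d ((snd d \<circ> chart_inv c) x))) (snd c p)"
      by (rule smooth_at_compose[OF smooth_transition]) (auto simp: that chart_inv_eq)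
    moreover have "\<forall>\<^sub>F x in nhds (snd c p). F (chart_inv d ((snd d \<circ> chart_inv c) x)) = F (chart_inv c x)"
      using eventually_overlap[OF that(2-5)] by eventually_elim (auto simp: that chart_inv_eq)
    ultimately show ?thesis by (rule smooth_at_cong)
  qed
  show ?thesis unfolding smooth_germ_def using * assms chart_at' by blast
qed

lemma smooth_germ_cong:
  assumes "p \<in> points M" "smooth_germ M F p" "\<forall>\<^sub>F q in point_nhds M p. F q = G q"
  shows "smooth_germ M G p"
  using assms smooth_at_cong chart_at[OF assms(1)]
  by (auto simp: smooth_germ_def point_nhds_def eventually_filtermap)

lemma eventually_smooth_germ:
  assumes "p \<in> points M" "smooth_germ M F p"
  shows "\<forall>\<^sub>F q in point_nhds M p. smooth_germ M F q"
proof -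
  define c where "c = chart_at M p"
  have c: "c \<in> M" "p \<in> fst c" using chart_at[OF assms(1)] by (auto simp: c_def)
  have "\<forall>\<^sub>F x in nhds (snd c p). smooth_at (\<lambda>x. F (chart_inv c x)) x"
    using assms(2) eventually_smooth_at unfolding smooth_germ_iff[OF c] by blast
  then show ?thesis unfolding eventually_point_nhds[OF c]
    using eventually_overlap[OF c(1,1) c(2,2)]
    by eventually_elim (auto simp: c chart_inv_eq smooth_germ_iff[OF c(1)])
qed

lemma smooth_germ_chart:
  assumes "c \<in> M" "p \<in> fst c" shows "smooth_germ M (snd c) p"
  unfolding smooth_germ_iff[OF assms] using smooth_transition[OF assms(1,1,2,2)] by (simp add: comp_def)

lemma smooth_fun_iff: "smooth_fun M f \<longleftrightarrow> (\<forall>p\<in>points M. smooth_germ M f p)"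
proof
  assume *: "smooth_fun M f"
  show "\<forall>p\<in>points M. smooth_germ M f p"
  proof
    fix p assume "p \<in> points M"
    then have c: "chart_at M p \<in> M" "p \<in> fst (chart_at M p)" using chart_at by auto
    then have "smooth_on (chart_image (chart_at M p)) (f \<circ> chart_inv (chart_at M p))"
      using * by (auto simp: smooth_fun_def)
    then show "smooth_germ M f p" unfolding smooth_germ_def
      unfolding smooth_on_iff[OF open_chart_image[OF c(1)]] using c(2) by (auto simp: chart_image_def comp_def)
  qed
next
  assume *: "\<forall>p\<in>points M. smooth_germ M f p"
  show "smooth_fun M f"
    unfolding smooth_fun_def
  proof
    fix c assume c: "c \<in> M"
    show "smooth_on (chart_image c) (f \<circ> chart_inv c)"
      unfolding smooth_on_iff[OF open_chart_image[OF c]]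
      by (auto simp: chart_image_def comp_def smooth_germ_iff[OF c, symmetric] * pointsI[OF c])
  qed
qed

lemma smooth_on_chart_iff:
  assumes c: "c \<in> M"
  shows "smooth_on (chart_image c) (\<lambda>x. F (chart_inv c x)) \<longleftrightarrow> (\<forall>p\<in>fst c. smooth_germ M F p)"
  unfolding smooth_on_iff[OF open_chart_image[OF c]]
  by (auto simp: chart_image_def smooth_germ_iff[OF c])

lemma smooth_germ_const [simp]: "smooth_germ M (\<lambda>q. k) p"
  by (simp add: smooth_germ_def)

lemma smooth_germ_add: "smooth_germ M F p \<Longrightarrow> smooth_germ M G p \<Longrightarrow> smooth_germ M (\<lambda>q. F q + G q) p"
  unfolding smooth_germ_def by (rule smooth_at_add)

lemma smooth_germ_diff: "smooth_germ M F p \<Longrightarrow> smooth_germ M G p \<Longrightarrow> smooth_germ M (\<lambda>q. F q - G q) p"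
  unfolding smooth_germ_def by (rule smooth_at_diff)

lemma smooth_germ_scaleR: "smooth_germ M F p \<Longrightarrow> smooth_germ M G p \<Longrightarrow> smooth_germ M (\<lambda>q. F q *\<^sub>R G q) p"
  unfolding smooth_germ_def by (rule smooth_at_scaleR)

lemma smooth_germ_mult: "smooth_germ M F p \<Longrightarrow> smooth_germ M G p \<Longrightarrow> smooth_germ M (\<lambda>q. F q * G q) p"
  for F G :: "'a \<Rightarrow> real"
  unfolding smooth_germ_def by (rule smooth_at_mult)

lemma smooth_germ_sum:
  "(\<And>i. i \<in> I \<Longrightarrow> smooth_germ M (F i) p) \<Longrightarrow> smooth_germ M (\<lambda>q. \<Sum>i\<in>I. F i q) p"
  unfolding smooth_germ_def by (rule smooth_at_sum)

lemma smooth_germ_compose: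
  fixes F :: "'a \<Rightarrow> 'f::euclidean_space"
  assumes "p \<in> points M" "smooth_germ M F p" "smooth_at g (F p)"
  shows "smooth_germ M (\<lambda>q. g (F q)) p"
  using assms(2) unfolding smooth_germ_def
  by (rule smooth_at_compose) (use assms chart_at chart_inv_eq in metis)

lemma smooth_germ_linear:
  fixes F :: "'a \<Rightarrow> 'f::euclidean_space"
  assumes "bounded_linear h" "smooth_germ M F p"
  shows "smooth_germ M (\<lambda>q. h (F q)) p"
  using assms unfolding smooth_germ_def by (rule smooth_at_linear)

lemma smooth_germ_frechet_derivative:
  fixes f :: "'f::euclidean_space \<Rightarrow> 'g::real_normed_vector"
  assumes "p \<in> points M" "smooth_germ M F p" "smooth_at f (F p)" "smooth_germ M v p"
  shows "smooth_germ M (\<lambda>q. frechet_derivative f (at (F q)) (v q)) p"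
proof -
  define \<Phi> where "\<Phi> z = frechet_derivative f (at (fst z)) (snd z)" for z
  have "smooth_at \<Phi> (F p, v p)"
  proof -
    have *: "smooth_at (\<lambda>z. \<Sum>b\<in>Basis. (snd z \<bullet> b) *\<^sub>R frechet_derivative f (at (fst z)) b) (F p, v p)"
      using assms(3)
      by (intro smooth_at_sum smooth_at_scaleR smooth_at_inner smooth_at_snd smooth_at_ident smooth_at_const
        smooth_at_compose[of fst _ "\<lambda>y. frechet_derivative f (at y) _"] smooth_at_frechet_derivative
        smooth_at_bounded_linear[OF bounded_linear_fst]) auto
    have "\<forall>\<^sub>F z in nhds (F p, v p). smooth_at f (fst z)"
      using eventually_smooth_at[OF assms(3)] filterlim_iff[of fst "nhds (F p)" "nhds (F p, v p)"]
        smooth_at_tendsto[OF smooth_at_bounded_linear[OF bounded_linear_fst], of "(F p, v p)"] by auto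
    then have "\<forall>\<^sub>F z in nhds (F p, v p).
       (\<Sum>b\<in>Basis. (snd z \<bullet> b) *\<^sub>R frechet_derivative f (at (fst z)) b) = \<Phi> z"
      unfolding \<Phi>_def
      by eventually_elim (metis smooth_at_has_derivative has_derivative_linear linear_basis_expansion)
    with * show ?thesis by (rule smooth_at_cong)
  qed
  moreover have "smooth_germ M (\<lambda>q. (F q, v q)) p"
    using assms(2,4) unfolding smooth_germ_def by (rule smooth_at_Pair)
  ultimately have "smooth_germ M (\<lambda>q. \<Phi> (F q, v q)) p"
    using smooth_germ_compose[OF assms(1), of "\<lambda>q. (F q, v q)" \<Phi>] by blast
  then show ?thesis by (simp add: \<Phi>_def)
qed

lemma smooth_germ_linear_solution:
  fixes A :: "'a \<Rightarrow> real^'n^'n::finite"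
  assumes "p \<in> points M" and "\<And>i j. smooth_germ M (\<lambda>q. A q $ i $ j) p"
    and "\<And>i. smooth_germ M (\<lambda>q. r q $ i) p"
    and "\<And>w. A p *v w = 0 \<Longrightarrow> w = 0"
    and "\<forall>\<^sub>F q in point_nhds M p. A q *v b q = r q"
  shows "smooth_germ M b p"
proof -
  have "chart_inv (chart_at M p) (snd (chart_at M p) p) = p"
    using chart_at[OF assms(1)] chart_inv_eq by blast
  with assms(2-5) show ?thesis
    unfolding smooth_germ_def point_nhds_def eventually_filtermap
    by (intro smooth_at_linear_solution[of "\<lambda>x. A (chart_inv (chart_at M p) x)" _
          "\<lambda>x. r (chart_inv (chart_at M p) x)"]) auto
qed

context
  fixes p c d
  assumes c: "c \<in> M" "p \<in> fst c" and d: "d \<in> M" "p \<in> fst d"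
begin

lemma transition_has_derivative: "((snd d \<circ> chart_inv c) has_derivative jac c d p) (at (snd c p))"
  unfolding jac_def using smooth_at_has_derivative[OF smooth_transition[OF c(1) d(1) c(2) d(2)]] .

lemma linear_jac: "linear (jac c d p)"
  using transition_has_derivative by (rule has_derivative_linear)

lemma frechet_derivative_change_chart:
  assumes F: "smooth_germ M F p"
  shows "frechet_derivative (\<lambda>x. F (chart_inv c x)) (at (snd c p)) e =
    frechet_derivative (\<lambda>x. F (chart_inv d x)) (at (snd d p)) (jac c d p e)"
proof -
  have F': "smooth_at (\<lambda>x. F (chart_inv d x)) ((snd d \<circ> chart_inv c) (snd c p))"
    using F[unfolded smooth_germ_iff[OF d]] chart_inv_eq[OF c] by simp
  have "((\<lambda>x. F (chart_inv d ((snd d \<circ> chart_inv c) x))) has_derivative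
     (\<lambda>e. frechet_derivative (\<lambda>x. F (chart_inv d x)) (at ((snd d \<circ> chart_inv c) (snd c p))) (jac c d p e)))
     (at (snd c p))"
    by (rule has_derivative_compose[OF transition_has_derivative smooth_at_has_derivative[OF F']])
  then have "frechet_derivative (\<lambda>x. F (chart_inv d ((snd d \<circ> chart_inv c) x))) (at (snd c p)) e =
     frechet_derivative (\<lambda>x. F (chart_inv d x)) (at (snd d p)) (jac c d p e)"
    by (subst frechet_derivative_at[symmetric]) (auto simp: chart_inv_eq[OF c])
  moreover have "\<forall>\<^sub>F x in nhds (snd c p). F (chart_inv d ((snd d \<circ> chart_inv c) x)) = F (chart_inv c x)"
    using eventually_overlap[OF c(1) d(1) c(2) d(2)] by eventually_elim (auto simp: c d chart_inv_eq)
  ultimately show ?thesis using frechet_derivative_cong by metis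
qed

end

lemma jac_self:
  assumes "c \<in> M" "p \<in> fst c" shows "jac c c p e = e"
proof -
  have "\<forall>\<^sub>F x in nhds (snd c p). (snd c \<circ> chart_inv c) x = x"
    using eventually_overlap[OF assms(1,1) assms(2,2)]
    by eventually_elim (auto simp: assms chart_inv_eq)
  then have "frechet_derivative (snd c \<circ> chart_inv c) (at (snd c p)) = frechet_derivative (\<lambda>x. x) (at (snd c p))"
    by (rule frechet_derivative_cong)
  then show ?thesis by (simp add: jac_def)
qed

text \<open>The cocycle condition is the chain rule applied to the coordinate map of the third chart.\<close>

lemma jac_jac:
  assumes "c \<in> M" "p \<in> fst c" "d \<in> M" "p \<in> fst d" "e \<in> M" "p \<in> fst e"
  shows "jac d e p (jac c d p v) = jac c e p v"
  using frechet_derivative_change_chart[OF assms(1-4) smooth_germ_chart[OF assms(5,6)]]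
  by (simp add: jac_def comp_def)

lemma tangent_space_iff:
  "v \<in> tangent_space M p \<longleftrightarrow> (\<forall>c. c \<notin> M \<or> p \<notin> fst c \<longrightarrow> v c = 0) \<and>
     (\<forall>c\<in>M. \<forall>d\<in>M. p \<in> fst c \<and> p \<in> fst d \<longrightarrow> v d = jac c d p (v c))"
  by (auto simp: tangent_space_def jac_def)

lemma tangent_jac:
  "v \<in> tangent_space M p \<Longrightarrow> c \<in> M \<Longrightarrow> p \<in> fst c \<Longrightarrow> d \<in> M \<Longrightarrow> p \<in> fst d \<Longrightarrow> v d = jac c d p (v c)"
  unfolding tangent_space_iff by blast

lemma tangent_outside: "v \<in> tangent_space M p \<Longrightarrow> c \<notin> M \<or> p \<notin> fst c \<Longrightarrow> v c = 0"
  unfolding tangent_space_iff by blast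

lemma tangent_eqI:
  assumes "v \<in> tangent_space M p" "w \<in> tangent_space M p" "c \<in> M" "p \<in> fst c" "v c = w c"
  shows "v = w"
proof
  fix d show "v d = w d"
  proof (cases "d \<in> M \<and> p \<in> fst d")
    case True
    then show ?thesis using assms tangent_jac[of v p c d] tangent_jac[of w p c d] by simp
  next
    case False
    then show ?thesis using tangent_outside[OF assms(1), of d] tangent_outside[OF assms(2), of d] by auto
  qed
qed

lemma tvec_of_component: "c \<in> M \<Longrightarrow> p \<in> fst c \<Longrightarrow> tvec_of M c p e c = e"
  by (simp add: tvec_of_def jac_self)

lemma tvec_of_tangent: "c \<in> M \<Longrightarrow> p \<in> fst c \<Longrightarrow> tvec_of M c p e \<in> tangent_space M p"
  by (auto simp: tangent_space_iff tvec_of_def jac_jac)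

lemma tvec_of_component_eq: "v \<in> tangent_space M p \<Longrightarrow> c \<in> M \<Longrightarrow> p \<in> fst c \<Longrightarrow> tvec_of M c p (v c) = v"
  by (rule tangent_eqI[OF tvec_of_tangent]) (auto simp: tvec_of_component)

lemma linear_combination_tangent:
  assumes "v \<in> tangent_space M p" "w \<in> tangent_space M p"
  shows "(\<lambda>c. a *\<^sub>R v c + b *\<^sub>R w c) \<in> tangent_space M p"
proof -
  have "a *\<^sub>R v d + b *\<^sub>R w d = jac c d p (a *\<^sub>R v c + b *\<^sub>R w c)"
    if "c \<in> M" "p \<in> fst c" "d \<in> M" "p \<in> fst d" for c d
    using linear_jac[OF that] tangent_jac[OF assms(1) that] tangent_jac[OF assms(2) that]
    by (simp only: linear_add linear_scale)
  moreover have "a *\<^sub>R v c + b *\<^sub>R w c = 0" if "c \<notin> M \<or> p \<notin> fst c" for c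
    using tangent_outside[OF assms(1) that] tangent_outside[OF assms(2) that] by simp
  ultimately show ?thesis unfolding tangent_space_iff by blast
qed

lemma vzero_tangent [simp]: "vzero \<in> tangent_space M p"
  unfolding tangent_space_iff by (simp add: tvec_simps linear_0[OF linear_jac])

lemma vadd_tangent: "v \<in> tangent_space M p \<Longrightarrow> w \<in> tangent_space M p \<Longrightarrow> v +\<^sub>v w \<in> tangent_space M p"
  using linear_combination_tangent[of v p w 1 1] by (simp add: tvec_simps)

lemma vscale_tangent: "v \<in> tangent_space M p \<Longrightarrow> a *\<^sub>v v \<in> tangent_space M p"
  using linear_combination_tangent[of v p v a 0] by (simp add: tvec_simps)

lemma vec_deriv_chart:
  assumes "c \<in> M" "p \<in> fst c" "v \<in> tangent_space M p" "smooth_germ M F p"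
  shows "vec_deriv M p v F = frechet_derivative (\<lambda>x. F (chart_inv c x)) (at (snd c p)) (v c)"
  unfolding vec_deriv_def
  using frechet_derivative_change_chart[of "chart_at M p" p c F "v (chart_at M p)"]
    tangent_jac[of v p "chart_at M p" c] assms chart_at' by metis

lemma vec_deriv_cong:
  assumes "p \<in> points M" "\<forall>\<^sub>F q in point_nhds M p. F q = G q"
  shows "vec_deriv M p v F = vec_deriv M p v G"
  unfolding vec_deriv_def
  using assms frechet_derivative_cong unfolding point_nhds_def eventually_filtermap by metis

lemma vec_deriv_linear_vec:
  assumes "p \<in> points M" "smooth_germ M F p"
  shows "vec_deriv M p (v +\<^sub>v w) F = vec_deriv M p v F + vec_deriv M p w F"
    and "vec_deriv M p (a *\<^sub>v v) F = a *\<^sub>R vec_deriv M p v F"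
proof -
  have "linear (frechet_derivative (\<lambda>x. F (chart_inv (chart_at M p) x)) (at (snd (chart_at M p) p)))"
    using assms(2) smooth_at_has_derivative has_derivative_linear unfolding smooth_germ_def by blast
  then show "vec_deriv M p (v +\<^sub>v w) F = vec_deriv M p v F + vec_deriv M p w F"
    "vec_deriv M p (a *\<^sub>v v) F = a *\<^sub>R vec_deriv M p v F"
    by (auto simp: vec_deriv_def tvec_simps linear_add linear_scale)
qed

lemma vec_deriv_const: "vec_deriv M p v (\<lambda>q. k) = 0"
  by (simp add: vec_deriv_def)

lemma vec_deriv_bilinear:
  assumes "bounded_bilinear b" "smooth_germ M F p" "smooth_germ M G p"
    and "p \<in> points M"
  shows "vec_deriv M p v (\<lambda>q. b (F q) (G q)) = b (F p) (vec_deriv M p v G) + b (vec_deriv M p v F) (G p)"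
proof -
  have "chart_inv (chart_at M p) (snd (chart_at M p) p) = p"
    using chart_at[OF assms(4)] chart_inv_eq by blast
  with bounded_bilinear.FDERIV[OF assms(1) assms(2,3)[unfolded smooth_germ_def, THEN smooth_at_has_derivative]]
  show ?thesis unfolding vec_deriv_def
    by (subst frechet_derivative_at[symmetric]) auto
qed

lemma vec_deriv_add:
  assumes "smooth_germ M F p" "smooth_germ M G p"
  shows "vec_deriv M p v (\<lambda>q. F q + G q) = vec_deriv M p v F + vec_deriv M p v G"
  unfolding vec_deriv_def
  using has_derivative_add[OF smooth_at_has_derivative smooth_at_has_derivative] assms(1,2)
  by (subst frechet_derivative_at[symmetric]) (auto simp: smooth_germ_def)

lemma vec_deriv_sum:
  assumes "\<And>i. i \<in> I \<Longrightarrow> smooth_germ M (F i) p"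
  shows "vec_deriv M p v (\<lambda>q. \<Sum>i\<in>I. F i q) = (\<Sum>i\<in>I. vec_deriv M p v (F i))"
  unfolding vec_deriv_def
  by (subst frechet_derivative_at[OF has_derivative_sum[OF smooth_at_has_derivative], symmetric])
     (use assms in \<open>auto simp: smooth_germ_def\<close>)

lemma vec_deriv_bounded_linear:
  assumes "bounded_linear h" "smooth_germ M F p"
  shows "vec_deriv M p v (\<lambda>q. h (F q)) = h (vec_deriv M p v F)"
  unfolding vec_deriv_def
  using bounded_linear.has_derivative[OF assms(1) smooth_at_has_derivative] assms(2)
  by (subst frechet_derivative_at[symmetric]) (auto simp: smooth_germ_def)

lemma vec_deriv_coordinates:
  assumes "c \<in> M" "p \<in> fst c" "v \<in> tangent_space M p"
  shows "vec_deriv M p v (snd c) = v c"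
  using vec_deriv_chart[OF assms smooth_germ_chart[OF assms(1,2)]] jac_self[OF assms(1,2)]
  by (simp add: jac_def comp_def)

end

section \<open>Vector fields and the Lie bracket\<close>

text \<open>The product rule for \<open>Df(y) (w y)\<close>: one term differentiates \<open>Df\<close> and one differentiates \<open>w\<close>.\<close>

lemma frechet_derivative_along:
  fixes f :: "'e::euclidean_space \<Rightarrow> 'f::real_normed_vector"
  assumes f: "smooth_at f x" and w: "smooth_at w x"
  shows "frechet_derivative (\<lambda>y. frechet_derivative f (at y) (w y)) (at x) h =
    frechet_derivative (\<lambda>y. frechet_derivative f (at y) (w x)) (at x) h +
    frechet_derivative f (at x) (frechet_derivative w (at x) h)"
proof -
  let ?D = "\<lambda>b y. frechet_derivative f (at y) b"
  have lin: "linear (frechet_derivative f (at y))" if "smooth_at f y" for y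
    using that smooth_at_has_derivative has_derivative_linear by blast
  have D: "smooth_at (?D b) x" for b by (rule smooth_at_frechet_derivative[OF f smooth_at_const])
  have expand: "\<forall>\<^sub>F y in nhds x. frechet_derivative f (at y) (v y) = (\<Sum>b\<in>Basis. (v y \<bullet> b) *\<^sub>R ?D b y)" for v
    using eventually_smooth_at[OF f] by eventually_elim (metis lin linear_basis_expansion)
  have d: "frechet_derivative (\<lambda>y. frechet_derivative f (at y) (v y)) (at x) h =
     (\<Sum>b\<in>Basis. (v x \<bullet> b) *\<^sub>R frechet_derivative (?D b) (at x) h
        + (frechet_derivative v (at x) h \<bullet> b) *\<^sub>R ?D b x)" if "smooth_at v x" for v
  proof -
    note v = smooth_at_has_derivative[OF that]
    have "((\<lambda>y. \<Sum>b\<in>Basis. (v y \<bullet> b) *\<^sub>R ?D b y) has_derivative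
      (\<lambda>h. \<Sum>b\<in>Basis. (v x \<bullet> b) *\<^sub>R frechet_derivative (?D b) (at x) h
        + (frechet_derivative v (at x) h \<bullet> b) *\<^sub>R ?D b x)) (at x)"
      by (intro has_derivative_sum has_derivative_scaleR has_derivative_inner_left v
          smooth_at_has_derivative[OF D])
    then show ?thesis
      unfolding frechet_derivative_cong[OF expand] by (simp add: frechet_derivative_at[symmetric])
  qed
  have "frechet_derivative f (at x) (frechet_derivative w (at x) h) =
     (\<Sum>b\<in>Basis. (frechet_derivative w (at x) h \<bullet> b) *\<^sub>R ?D b x)"
    using lin[OF f] by (rule linear_basis_expansion)
  then show ?thesis
    unfolding d[OF w] d[of "\<lambda>y. w x", OF smooth_at_const] by (simp add: sum.distrib)
qed

context smooth_atlas
begin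

lemma vector_field_iff:
  "vector_field M X \<longleftrightarrow> (\<forall>p\<in>points M. X p \<in> tangent_space M p) \<and>
     (\<forall>c\<in>M. \<forall>p\<in>fst c. smooth_germ M (\<lambda>q. X q c) p)"
proof -
  have "vector_field M X \<longleftrightarrow> (\<forall>c\<in>M. \<forall>p\<in>fst c. X p \<in> tangent_space M p) \<and>
     (\<forall>c\<in>M. smooth_on (chart_image c) (\<lambda>z. X (chart_inv c z) c))"
    unfolding vector_field_def by blast
  also have "\<dots> \<longleftrightarrow> (\<forall>c\<in>M. \<forall>p\<in>fst c. X p \<in> tangent_space M p) \<and>
     (\<forall>c\<in>M. \<forall>p\<in>fst c. smooth_germ M (\<lambda>q. X q c) p)"
    using smooth_on_chart_iff[where F = "\<lambda>q. X q _"] by blast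
  finally show ?thesis unfolding points_def by blast
qed

lemma smooth_germ_jac:
  assumes "c \<in> M" "p \<in> fst c" "d \<in> M" "p \<in> fst d" "smooth_germ M v p"
  shows "smooth_germ M (\<lambda>q. jac c d q (v q)) p"
  unfolding jac_def
  by (rule smooth_germ_frechet_derivative[OF _ smooth_germ_chart])
     (use assms smooth_transition pointsI in auto)

text \<open>Smoothness of the components needs checking in a single chart around each point, because the
  transformation law carries it to all other charts.\<close>

lemma vector_fieldI:
  assumes "\<And>p. p \<in> points M \<Longrightarrow> X p \<in> tangent_space M p"
    and "\<And>p. p \<in> points M \<Longrightarrow> \<exists>c\<in>M. p \<in> fst c \<and> smooth_germ M (\<lambda>q. X q c) p"
  shows "vector_field M X"
  unfolding vector_field_iff
proof (intro conjI ballI)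
  fix d p assume d: "d \<in> M" "p \<in> fst d"
  then obtain c where c: "c \<in> M" "p \<in> fst c" and s: "smooth_germ M (\<lambda>q. X q c) p"
    using assms(2) pointsI by blast
  have "smooth_germ M (\<lambda>q. jac c d q (X q c)) p" by (rule smooth_germ_jac[OF c d s])
  moreover have "\<forall>\<^sub>F q in point_nhds M p. jac c d q (X q c) = X q d"
    using eventually_in_chart[OF c] eventually_in_chart[OF d]
    by eventually_elim (metis assms(1) c(1) d(1) pointsI tangent_jac)
  ultimately show "smooth_germ M (\<lambda>q. X q d) p"
    by (rule smooth_germ_cong[OF pointsI[OF d]])
qed (use assms in blast)

lemma vector_field_tangent: "vector_field M X \<Longrightarrow> p \<in> points M \<Longrightarrow> X p \<in> tangent_space M p"
  by (simp add: vector_field_iff)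

lemma vector_field_smooth: "vector_field M X \<Longrightarrow> c \<in> M \<Longrightarrow> p \<in> fst c \<Longrightarrow> smooth_germ M (\<lambda>q. X q c) p"
  by (simp add: vector_field_iff)

lemma vec_deriv_field_chart:
  assumes X: "vector_field M X" and F: "smooth_germ M F p" and c: "c \<in> M" "p \<in> fst c"
  shows "\<forall>\<^sub>F q in point_nhds M p. vec_deriv M q (X q) F =
     frechet_derivative (\<lambda>x. F (chart_inv c x)) (at (snd c q)) (X q c)"
  using eventually_in_chart[OF c] eventually_smooth_germ[OF pointsI[OF c] F]
  by eventually_elim (use vec_deriv_chart c pointsI vector_field_tangent[OF X] in blast)

lemma smooth_germ_vec_deriv:
  assumes X: "vector_field M X" and F: "smooth_germ M F p" and p: "p \<in> points M"
  shows "smooth_germ M (\<lambda>q. vec_deriv M q (X q) F) p"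
proof -
  obtain c where c: "c \<in> M" "p \<in> fst c" using p by (auto simp: points_def)
  have "smooth_germ M (\<lambda>q. frechet_derivative (\<lambda>x. F (chart_inv c x)) (at (snd c q)) (X q c)) p"
    using smooth_germ_frechet_derivative[OF p smooth_germ_chart[OF c] F[unfolded smooth_germ_iff[OF c]]
      vector_field_smooth[OF X c]] .
  then show ?thesis
    by (rule smooth_germ_cong[OF p]) (use vec_deriv_field_chart[OF X F c] in eventually_elim, simp)
qed

lemma lie_bracket_chart:
  assumes X: "vector_field M X" and Y: "vector_field M Y" and c: "c \<in> M" "p \<in> fst c"
  shows "lie_bracket M X Y p c = vec_deriv M p (X p) (\<lambda>q. Y q c) - vec_deriv M p (Y p) (\<lambda>q. X q c)"
  using vec_deriv_chart[OF c vector_field_tangent[OF X pointsI[OF c]] vector_field_smooth[OF Y c]]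
    vec_deriv_chart[OF c vector_field_tangent[OF Y pointsI[OF c]] vector_field_smooth[OF X c]] c
  by (simp add: lie_bracket_def)

text \<open>In \<open>X (Y F) - Y (X F)\<close> the second derivatives of \<open>F\<close> cancel by symmetry, and what is left is the
  derivative of \<open>F\<close> along the coordinate expression of the bracket. For scalar \<open>F\<close> this describes how
  the bracket acts on functions. For the coordinate map of another chart it is the transformation
  law of the bracket, as \<open>X\<close> applied to coordinates gives the components of \<open>X\<close>.\<close>

lemma commutator_chart:
  fixes F :: "'a \<Rightarrow> 'f::euclidean_space"
  assumes X: "vector_field M X" and Y: "vector_field M Y" and F: "smooth_germ M F p"
    and c: "c \<in> M" "p \<in> fst c"
  shows "vec_deriv M p (X p) (\<lambda>q. vec_deriv M q (Y q) F) - vec_deriv M p (Y p) (\<lambda>q. vec_deriv M q (X q) F)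
    = frechet_derivative (\<lambda>x. F (chart_inv c x)) (at (snd c p)) (lie_bracket M X Y p c)"
proof -
  note p = pointsI[OF c]
  let ?f = "\<lambda>x. F (chart_inv c x)" and ?x = "snd c p"
  let ?D2 = "\<lambda>v w. frechet_derivative (\<lambda>y. frechet_derivative ?f (at y) w) (at ?x) v"
  note f = F[unfolded smooth_germ_iff[OF c]]
  have *: "vec_deriv M p (X p) (\<lambda>q. vec_deriv M q (Y q) F) =
     ?D2 (X p c) (Y p c) + frechet_derivative ?f (at ?x)
       (frechet_derivative (\<lambda>x. Y (chart_inv c x) c) (at ?x) (X p c))"
    if X: "vector_field M X" and Y: "vector_field M Y" for X Y
  proof -
    have "vec_deriv M p (X p) (\<lambda>q. vec_deriv M q (Y q) F) =
       frechet_derivative (\<lambda>x. vec_deriv M (chart_inv c x) (Y (chart_inv c x)) F) (at ?x) (X p c)"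
      by (rule vec_deriv_chart[OF c vector_field_tangent[OF X p] smooth_germ_vec_deriv[OF Y F p]])
    also have "frechet_derivative (\<lambda>x. vec_deriv M (chart_inv c x) (Y (chart_inv c x)) F) (at ?x) =
       frechet_derivative (\<lambda>x. frechet_derivative ?f (at x) (Y (chart_inv c x) c)) (at ?x)"
    proof (rule frechet_derivative_cong)
      show "\<forall>\<^sub>F x in nhds ?x. vec_deriv M (chart_inv c x) (Y (chart_inv c x)) F =
          frechet_derivative ?f (at x) (Y (chart_inv c x) c)"
        using vec_deriv_field_chart[OF Y F c, unfolded eventually_point_nhds[OF c]]
          eventually_overlap[OF c(1,1) c(2,2)]
        by eventually_elim (auto simp: chart_inv_eq c)
    qed
    also have "\<dots> (X p c) = ?D2 (X p c) (Y p c) + frechet_derivative ?f (at ?x)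
       (frechet_derivative (\<lambda>x. Y (chart_inv c x) c) (at ?x) (X p c))"
      by (subst frechet_derivative_along[OF f vector_field_smooth[OF Y c, unfolded smooth_germ_iff[OF c]]])
         (simp add: chart_inv_eq c)
    finally show ?thesis .
  qed
  have "linear (frechet_derivative ?f (at ?x))"
    using f smooth_at_has_derivative has_derivative_linear by blast
  then show ?thesis
    unfolding *[OF X Y] *[OF Y X] second_derivative_symmetric[OF f, of "Y p c" "X p c"]
    using c by (simp add: lie_bracket_def linear_diff)
qed

lemma lie_bracket_tangent:
  assumes X: "vector_field M X" and Y: "vector_field M Y"
  shows "lie_bracket M X Y p \<in> tangent_space M p"
  unfolding tangent_space_iff
proof (intro conjI ballI allI impI)
  fix c d assume cd: "c \<in> M" "d \<in> M" "p \<in> fst c \<and> p \<in> fst d"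
  then have c: "c \<in> M" "p \<in> fst c" and d: "d \<in> M" "p \<in> fst d" by auto
  have *: "\<forall>\<^sub>F q in point_nhds M p. vec_deriv M q (Y q) (snd d) = Y q d" if "vector_field M Y" for Y
    using eventually_in_chart[OF d]
    by eventually_elim (use vec_deriv_coordinates d pointsI vector_field_tangent[OF that] in blast)
  have "jac c d p (lie_bracket M X Y p c) =
     vec_deriv M p (X p) (\<lambda>q. vec_deriv M q (Y q) (snd d)) - vec_deriv M p (Y p) (\<lambda>q. vec_deriv M q (X q) (snd d))"
    unfolding commutator_chart[OF X Y smooth_germ_chart[OF d] c] jac_def by (simp add: comp_def)
  also have "\<dots> = lie_bracket M X Y p d"
    unfolding lie_bracket_chart[OF X Y d] vec_deriv_cong[OF pointsI[OF d] *[OF X]]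
      vec_deriv_cong[OF pointsI[OF d] *[OF Y]] ..
  finally show "lie_bracket M X Y p d = jac c d p (lie_bracket M X Y p c)" by simp
qed (auto simp: lie_bracket_def)

lemma lie_bracket_vector_field:
  assumes X: "vector_field M X" and Y: "vector_field M Y"
  shows "vector_field M (lie_bracket M X Y)"
proof (rule vector_fieldI[OF lie_bracket_tangent[OF X Y]])
  fix p assume p: "p \<in> points M"
  then obtain c where c: "c \<in> M" "p \<in> fst c" by (auto simp: points_def)
  have "smooth_germ M (\<lambda>q. vec_deriv M q (X q) (\<lambda>q. Y q c) - vec_deriv M q (Y q) (\<lambda>q. X q c)) p"
    by (intro smooth_germ_diff smooth_germ_vec_deriv X Y p vector_field_smooth c)
  moreover have "\<forall>\<^sub>F q in point_nhds M p. vec_deriv M q (X q) (\<lambda>q. Y q c) - vec_deriv M q (Y q) (\<lambda>q. X q c)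
      = lie_bracket M X Y q c"
    using eventually_in_chart[OF c] by eventually_elim (simp add: lie_bracket_chart[OF X Y c(1)])
  ultimately have "smooth_germ M (\<lambda>q. lie_bracket M X Y q c) p"
    by (rule smooth_germ_cong[OF p])
  with c show "\<exists>c\<in>M. p \<in> fst c \<and> smooth_germ M (\<lambda>q. lie_bracket M X Y q c) p"
    by blast
qed

lemma commutator_deriv:
  fixes F :: "'a \<Rightarrow> 'f::euclidean_space"
  assumes X: "vector_field M X" and Y: "vector_field M Y" and F: "smooth_germ M F p" and p: "p \<in> points M"
  shows "vec_deriv M p (lie_bracket M X Y p) F =
    vec_deriv M p (X p) (\<lambda>q. vec_deriv M q (Y q) F) - vec_deriv M p (Y p) (\<lambda>q. vec_deriv M q (X q) F)"
proof -
  obtain c where c: "c \<in> M" "p \<in> fst c" using p by (auto simp: points_def)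
  show ?thesis unfolding commutator_chart[OF X Y F c]
    by (rule vec_deriv_chart[OF c lie_bracket_tangent[OF X Y] F])
qed

lemma vector_field_scale:
  assumes X: "vector_field M X" and f: "smooth_fun M f"
  shows "vector_field M (\<lambda>p. f p *\<^sub>v X p)"
  unfolding vector_field_iff
proof (intro conjI ballI)
  fix c p assume c: "c \<in> M" "p \<in> fst c"
  then show "smooth_germ M (\<lambda>q. (f q *\<^sub>v X q) c) p"
    using smooth_germ_scaleR[OF _ vector_field_smooth[OF X c]] f pointsI[OF c]
    unfolding smooth_fun_iff vscale_def by blast
qed (use X vscale_tangent vector_field_tangent in blast)

lemma vector_field_add:
  assumes X: "vector_field M X" and Y: "vector_field M Y"
  shows "vector_field M (\<lambda>p. X p +\<^sub>v Y p)"
  unfolding vector_field_iff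
proof (intro conjI ballI)
  fix c p assume c: "c \<in> M" "p \<in> fst c"
  then show "smooth_germ M (\<lambda>q. (X q +\<^sub>v Y q) c) p"
    using smooth_germ_add[OF vector_field_smooth[OF X c] vector_field_smooth[OF Y c]]
    unfolding vadd_def by blast
qed (use X Y vadd_tangent vector_field_tangent in blast)

lemma lie_bracket_scale_right:
  assumes X: "vector_field M X" and Y: "vector_field M Y" and f: "smooth_fun M f" and p: "p \<in> points M"
  shows "lie_bracket M X (\<lambda>p. f p *\<^sub>v Y p) p = vec_deriv M p (X p) f *\<^sub>v Y p +\<^sub>v f p *\<^sub>v lie_bracket M X Y p"
proof -
  obtain c where c: "c \<in> M" "p \<in> fst c" using p by (auto simp: points_def)
  have f': "smooth_germ M f p" using f p by (simp add: smooth_fun_iff)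
  note fY = vector_field_scale[OF Y f]
  show ?thesis
  proof (rule tangent_eqI[OF lie_bracket_tangent[OF X fY] _ c])
    show "vec_deriv M p (X p) f *\<^sub>v Y p +\<^sub>v f p *\<^sub>v lie_bracket M X Y p \<in> tangent_space M p"
      by (intro vadd_tangent vscale_tangent lie_bracket_tangent X Y vector_field_tangent p)
    show "lie_bracket M X (\<lambda>p. f p *\<^sub>v Y p) p c =
        (vec_deriv M p (X p) f *\<^sub>v Y p +\<^sub>v f p *\<^sub>v lie_bracket M X Y p) c"
      unfolding lie_bracket_chart[OF X fY c] vec_deriv_linear_vec(2)[OF p vector_field_smooth[OF X c]]
      using vec_deriv_bilinear[OF bounded_bilinear_scaleR f' vector_field_smooth[OF Y c] p, of "X p"]
      by (simp add: tvec_simps lie_bracket_chart[OF X Y c] algebra_simps)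
  qed
qed

lemma lie_bracket_add_right:
  assumes X: "vector_field M X" and Y: "vector_field M Y" and Z: "vector_field M Z" and p: "p \<in> points M"
  shows "lie_bracket M X (\<lambda>p. Y p +\<^sub>v Z p) p = lie_bracket M X Y p +\<^sub>v lie_bracket M X Z p"
proof -
  obtain c where c: "c \<in> M" "p \<in> fst c" using p by (auto simp: points_def)
  note YZ = vector_field_add[OF Y Z]
  show ?thesis
  proof (rule tangent_eqI[OF lie_bracket_tangent[OF X YZ] _ c])
    show "lie_bracket M X Y p +\<^sub>v lie_bracket M X Z p \<in> tangent_space M p"
      by (intro vadd_tangent lie_bracket_tangent X Y Z)
    show "lie_bracket M X (\<lambda>p. Y p +\<^sub>v Z p) p c = (lie_bracket M X Y p +\<^sub>v lie_bracket M X Z p) c"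
      unfolding lie_bracket_chart[OF X YZ c] vec_deriv_linear_vec(1)[OF p vector_field_smooth[OF X c]]
      using vec_deriv_add[OF vector_field_smooth[OF Y c] vector_field_smooth[OF Z c], of "X p"]
      by (simp add: tvec_simps lie_bracket_chart[OF X Y c] lie_bracket_chart[OF X Z c])
  qed
qed

end

section \<open>The slit tangent bundle\<close>

context smooth_atlas
begin

lemma vec_deriv_compose:
  fixes F :: "'a \<Rightarrow> 'f::euclidean_space"
  assumes p: "p \<in> points M" and F: "smooth_germ M F p" and g: "smooth_at g (F p)"
  shows "vec_deriv M p v (\<lambda>q. g (F q)) = frechet_derivative g (at (F p)) (vec_deriv M p v F)"
proof -
  have e: "chart_inv (chart_at M p) (snd (chart_at M p) p) = p"
    using chart_at[OF p] chart_inv_eq by blast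
  from has_derivative_compose[OF smooth_at_has_derivative[OF F[unfolded smooth_germ_def]]
      smooth_at_has_derivative[of g]] g
  have "((\<lambda>x. g (F (chart_inv (chart_at M p) x))) has_derivative
    (\<lambda>h. frechet_derivative g (at (F p)) (frechet_derivative (\<lambda>x. F (chart_inv (chart_at M p) x))
       (at (snd (chart_at M p) p)) h))) (at (snd (chart_at M p) p))"
    by (simp add: e)
  then show ?thesis unfolding vec_deriv_def by (subst frechet_derivative_at[symmetric]) auto
qed

end

locale tangent_atlas =
  fixes M :: "('a::{t2_space, second_countable_topology}, real^'n::finite) chart set"
  assumes manifold: "smooth_manifold M"
begin

lemma chart_facts:
  assumes "c \<in> M"
  shows "open (fst c)" "open (chart_image c)" "homeomorphism (fst c) (chart_image c) (snd c) (chart_inv c)"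
  using manifold assms by (auto simp: smooth_manifold_def)

sublocale base: smooth_atlas M
proof
  fix c d p assume c: "c \<in> M"
  note h = chart_facts[OF c]
  show "inj_on (snd c) (fst c)"
    by (rule inj_on_inverseI[of _ "chart_inv c"]) (rule homeomorphism_apply1[OF h(3)])
  assume d: "d \<in> M"
  have "snd c ` (fst c \<inter> fst d) = chart_image c \<inter> chart_inv c -` fst d"
  proof
    show "snd c ` (fst c \<inter> fst d) \<subseteq> chart_image c \<inter> chart_inv c -` fst d"
      by (auto simp: chart_image_def homeomorphism_apply1[OF h(3)])
    show "chart_image c \<inter> chart_inv c -` fst d \<subseteq> snd c ` (fst c \<inter> fst d)"
    proof
      fix x assume x: "x \<in> chart_image c \<inter> chart_inv c -` fst d"
      then have "x = snd c (chart_inv c x)" "chart_inv c x \<in> fst c"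
        using homeomorphism_apply2[OF h(3)] homeomorphism_image2[OF h(3)] by auto
      with x show "x \<in> snd c ` (fst c \<inter> fst d)" by auto
    qed
  qed
  moreover have "continuous_on (chart_image c) (chart_inv c)" using h(3) homeomorphism_cont2 by blast
  ultimately show o: "open (snd c ` (fst c \<inter> fst d))"
    using h(2) chart_facts(1)[OF d] by (metis Int_commute continuous_on_open_vimage)
  assume "p \<in> fst c" "p \<in> fst d"
  then show "smooth_at (snd d \<circ> chart_inv c) (snd c p)"
    using manifold c d o by (intro smooth_on_imp_at[OF o]) (auto simp: smooth_manifold_def)
qed

lemma points_base [simp]: "points M = UNIV"
  using manifold by (simp add: points_def smooth_manifold_def)

lemma slit_chart_simps:
  "u \<in> fst (slit_chart M c) \<longleftrightarrow> u \<in> slit_bundle M \<and> fst u \<in> fst c"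
  "snd (slit_chart M c) u = (snd c (fst u), snd u c)"
  by (auto simp: slit_chart_def)

lemma slit_bundle_iff: "u \<in> slit_bundle M \<longleftrightarrow> snd u \<in> tangent_space M (fst u) \<and> snd u \<noteq> vzero"
  by (auto simp: slit_bundle_def split_beta)

lemma slit_component_nonzero:
  assumes "u \<in> slit_bundle M" "c \<in> M" "fst u \<in> fst c"
  shows "snd u c \<noteq> 0"
proof
  assume "snd u c = 0"
  then have "snd u = vzero"
    using assms base.vzero_tangent[of "fst u"]
    by (intro base.tangent_eqI[of "snd u" "fst u" vzero c]) (auto simp: slit_bundle_iff, simp add: vzero_def)
  then show False using assms by (simp add: slit_bundle_iff)
qed

text \<open>The nonzero vectors in a fibre correspond to the nonzero component vectors.\<close>

lemma slit_chart_overlap: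
  assumes c: "c \<in> M" and d: "d \<in> M"
  shows "snd (slit_chart M c) ` (fst (slit_chart M c) \<inter> fst (slit_chart M d)) = (snd c ` (fst c \<inter> fst d)) \<times> (- {0 :: real^'n})"
proof
  show "snd (slit_chart M c) ` (fst (slit_chart M c) \<inter> fst (slit_chart M d)) \<subseteq> (snd c ` (fst c \<inter> fst d)) \<times> (- {0 :: real^'n})"
    using slit_component_nonzero[OF _ c] by (intro image_subsetI) (simp add: slit_chart_simps)
  show "(snd c ` (fst c \<inter> fst d)) \<times> (- {0 :: real^'n}) \<subseteq> snd (slit_chart M c) ` (fst (slit_chart M c) \<inter> fst (slit_chart M d))"
  proof
    fix z assume "z \<in> (snd c ` (fst c \<inter> fst d)) \<times> (- {0 :: real^'n})"
    then obtain p y where z: "z = (snd c p, y)" and y: "y \<noteq> 0" and p: "p \<in> fst c" "p \<in> fst d" by auto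
    define u where "u = (p, tvec_of M c p y)"
    have "tvec_of M c p y c = y" by (rule base.tvec_of_component[OF c p(1)])
    then have "snd (slit_chart M c) u = (snd c p, y)" "tvec_of M c p y \<noteq> vzero"
      using y by (auto simp: u_def slit_chart_simps tvec_simps)
    moreover from this(2) have "u \<in> fst (slit_chart M c) \<inter> fst (slit_chart M d)"
      using p base.tvec_of_tangent[OF c p(1)] by (auto simp: u_def slit_chart_simps slit_bundle_iff)
    ultimately show "z \<in> snd (slit_chart M c) ` (fst (slit_chart M c) \<inter> fst (slit_chart M d))"
      unfolding z by (metis imageI)
  qed
qed

lemma inj_slit_chart:
  assumes c: "c \<in> M" shows "inj_on (snd (slit_chart M c)) (fst (slit_chart M c))"
proof (rule inj_onI)
  fix u w assume u: "u \<in> fst (slit_chart M c)" and w: "w \<in> fst (slit_chart M c)"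
    and "snd (slit_chart M c) u = snd (slit_chart M c) w"
  then have 1: "snd c (fst u) = snd c (fst w)" and 2: "snd u c = snd w c" by (auto simp: slit_chart_simps)
  from 1 have 3: "fst u = fst w"
    using u w base.inj_chart[OF c] by (auto simp: slit_chart_simps dest: inj_onD)
  have "snd u = snd w"
    by (rule base.tangent_eqI[of _ "fst u" _ c]) (use u w 2 3 c in \<open>auto simp: slit_chart_simps slit_bundle_iff\<close>)
  with 3 show "u = w" by (simp add: prod_eq_iff)
qed

lemma slit_chart_inv_eq:
  "c \<in> M \<Longrightarrow> u \<in> slit_bundle M \<Longrightarrow> fst u \<in> fst c \<Longrightarrow> chart_inv (slit_chart M c) (snd c (fst u), snd u c) = u"
  unfolding chart_inv_def using inv_into_f_f[OF inj_slit_chart, of c u] by (simp add: slit_chart_simps)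

lemma slit_chart_inv_Pair:
  "c \<in> M \<Longrightarrow> (p, v) \<in> slit_bundle M \<Longrightarrow> p \<in> fst c \<Longrightarrow> chart_inv (slit_chart M c) (snd c p, v c) = (p, v)"
  using slit_chart_inv_eq[of c "(p, v)"] by simp

text \<open>The change of coordinates \<open>(x, y) \<mapsto> (\<tau> x, D\<tau>(x) y)\<close> is smooth because \<open>\<tau>\<close> is.\<close>

sublocale slit: smooth_atlas "slit_atlas M"
proof
  fix C D u assume C: "C \<in> slit_atlas M"
  then obtain c where c: "c \<in> M" "C = slit_chart M c" by (auto simp: slit_atlas_def)
  show "inj_on (snd C) (fst C)" using inj_slit_chart c by simp
  assume D: "D \<in> slit_atlas M"
  then obtain d where d: "d \<in> M" "D = slit_chart M d" by (auto simp: slit_atlas_def)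
  show o: "open (snd C ` (fst C \<inter> fst D))"
    unfolding c(2) d(2) slit_chart_overlap[OF c(1) d(1)]
    by (intro open_Times base.open_overlap c d) auto
  assume u: "u \<in> fst C" "u \<in> fst D"
  then have p: "fst u \<in> fst c" "fst u \<in> fst d" "u \<in> slit_bundle M" by (auto simp: c d slit_chart_simps)
  define \<tau> where "\<tau> = snd d \<circ> chart_inv c"
  have \<tau>: "smooth_at \<tau> (fst (snd C u))"
    using base.smooth_transition[OF c(1) d(1) p(1,2)] by (simp add: \<tau>_def c slit_chart_simps)
  have f: "smooth_at fst (snd C u)" by (rule smooth_at_bounded_linear[OF bounded_linear_fst])
  have \<tau>f: "smooth_at (\<lambda>z. \<tau> (fst z)) (snd C u)"
    by (rule smooth_at_compose[OF f \<tau>])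
  have "smooth_at (\<lambda>z. (\<tau> (fst z), \<Sum>b\<in>Basis. (snd z \<bullet> b) *\<^sub>R frechet_derivative \<tau> (at (fst z)) b)) (snd C u)"
    by (intro smooth_at_Pair \<tau>f smooth_at_sum smooth_at_scaleR smooth_at_inner smooth_at_snd smooth_at_ident
        smooth_at_const smooth_at_compose[OF f] smooth_at_frechet_derivative[OF \<tau>])
  moreover have "\<forall>\<^sub>F z in nhds (snd C u).
    (\<tau> (fst z), \<Sum>b\<in>Basis. (snd z \<bullet> b) *\<^sub>R frechet_derivative \<tau> (at (fst z)) b) = (snd D \<circ> chart_inv C) z"
  proof -
    have "\<forall>\<^sub>F z in nhds (snd C u). z \<in> snd C ` (fst C \<inter> fst D)"
      by (rule eventually_nhds_in_open[OF o]) (use u in auto)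
    then show ?thesis
    proof eventually_elim
      case (elim z)
      then obtain w where w: "w \<in> slit_bundle M" "fst w \<in> fst c" "fst w \<in> fst d" and z: "z = (snd c (fst w), snd w c)"
        by (auto simp: c d slit_chart_simps)
      have "\<tau> (snd c (fst w)) = snd d (fst w)" using base.chart_inv_eq[OF c(1) w(2)] by (simp add: \<tau>_def)
      moreover have "(\<Sum>b\<in>Basis. (snd w c \<bullet> b) *\<^sub>R frechet_derivative \<tau> (at (snd c (fst w))) b) = jac c d (fst w) (snd w c)"
        using linear_basis_expansion[OF base.linear_jac[OF c(1) w(2) d(1) w(3)], of "snd w c"]
        by (simp add: jac_def \<tau>_def)
      moreover have "\<dots> = snd w d"
        using base.tangent_jac[OF _ c(1) w(2) d(1) w(3), of "snd w"] w(1) by (simp add: slit_bundle_iff)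
      ultimately show ?case
        by (simp add: z c(2) d(2) slit_chart_inv_eq[OF c(1) w(1,2)] slit_chart_simps)
    qed
  qed
  ultimately show "smooth_at (snd D \<circ> chart_inv C) (snd C u)" by (rule smooth_at_cong)
qed

abbreviation "S \<equiv> slit_atlas M"

abbreviation "\<T> \<equiv> slit_bundle M"

lemma slit_chart_atlas: "c \<in> M \<Longrightarrow> slit_chart M c \<in> S"
  by (simp add: slit_atlas_def)

lemma base_chart_exists: obtains c where "c \<in> M" "p \<in> fst c"
  using points_base unfolding points_def by blast

lemma points_slit [simp]: "points S = \<T>"
proof
  show "\<T> \<subseteq> points S"
  proof
    fix u assume u: "u \<in> \<T>"
    obtain c where "c \<in> M" "fst u \<in> fst c" by (rule base_chart_exists)
    with u show "u \<in> points S"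
      by (intro slit.pointsI[OF slit_chart_atlas]) (auto simp: slit_chart_simps)
  qed
qed (auto simp: points_def slit_atlas_def slit_chart_simps)

lemma slit_chartI: "u \<in> \<T> \<Longrightarrow> fst u \<in> fst c \<Longrightarrow> u \<in> fst (slit_chart M c)"
  by (simp add: slit_chart_simps)

lemma eventually_slit:
  assumes "u \<in> \<T>" shows "\<forall>\<^sub>F w in point_nhds S u. w \<in> \<T>"
proof -
  obtain c where c: "c \<in> M" "fst u \<in> fst c" by (rule base_chart_exists)
  show ?thesis
    using slit.eventually_in_chart[OF slit_chart_atlas[OF c(1)] slit_chartI[OF assms c(2)]]
    by eventually_elim (simp add: slit_chart_simps)
qed

lemma eventually_pullback:
  assumes u: "u \<in> \<T>" and P: "eventually P (point_nhds M (fst u))"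
  shows "\<forall>\<^sub>F w in point_nhds S u. P (fst w)"
proof -
  obtain c where c: "c \<in> M" "fst u \<in> fst c" by (rule base_chart_exists)
  note C = slit_chart_atlas[OF c(1)] slit_chartI[OF u c(2)]
  have "(fst \<longlongrightarrow> snd c (fst u)) (nhds (snd (slit_chart M c) u))"
    using smooth_at_tendsto[OF smooth_at_bounded_linear[OF bounded_linear_fst], of "snd (slit_chart M c) u"]
    by (simp add: slit_chart_simps)
  then have "\<forall>\<^sub>F z in nhds (snd (slit_chart M c) u). P (chart_inv c (fst z))"
    using P[unfolded base.eventually_point_nhds[OF c]] unfolding filterlim_iff by blast
  with slit.eventually_overlap[OF C(1,1) C(2,2)] show ?thesis
    unfolding slit.eventually_point_nhds[OF C]
    by eventually_elim
       (auto simp: slit_chart_simps slit_chart_inv_Pair[OF c(1)] base.chart_inv_eq[OF c(1)])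
qed

lemma smooth_germ_pullback:
  assumes u: "u \<in> \<T>" and F: "smooth_germ M F (fst u)"
  shows "smooth_germ S (\<lambda>w. F (fst w)) u"
proof -
  obtain c where c: "c \<in> M" "fst u \<in> fst c" by (rule base_chart_exists)
  note C = slit_chart_atlas[OF c(1)] slit_chartI[OF u c(2)]
  have f: "smooth_at fst (snd (slit_chart M c) u)" by (rule smooth_at_bounded_linear[OF bounded_linear_fst])
  have "smooth_at (\<lambda>z. F (chart_inv c (fst z))) (snd (slit_chart M c) u)"
    by (rule smooth_at_compose[OF f, of "\<lambda>x. F (chart_inv c x)"])
       (use F[unfolded base.smooth_germ_iff[OF c]] in \<open>simp add: slit_chart_simps\<close>)
  then show ?thesis unfolding slit.smooth_germ_iff[OF C]
  proof (rule smooth_at_cong)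
    show "\<forall>\<^sub>F z in nhds (snd (slit_chart M c) u). F (chart_inv c (fst z)) = F (fst (chart_inv (slit_chart M c) z))"
      using slit.eventually_overlap[OF C(1,1) C(2,2)]
      by eventually_elim (auto simp: slit_chart_simps slit_chart_inv_Pair[OF c(1)] base.chart_inv_eq[OF c(1)])
  qed
qed

lemma smooth_fun_slit_iff:
  "smooth_fun S f \<longleftrightarrow> (\<forall>u\<in>\<T>. smooth_germ S f u)"
  using slit.smooth_fun_iff by simp

lemma rho_eq_vec_deriv:
  assumes "d \<in> M" "fst u \<in> fst d"
  shows "rho M u v d = vec_deriv S u v (\<lambda>w. snd d (fst w))"
  using assms by (simp add: rho_def differential_def vec_deriv_def Let_def comp_def)

text \<open>In bundle coordinates \<open>(x, y)\<close> the projection is \<open>(x, y) \<mapsto> x\<close>, so \<open>rho\<close> keeps the first half of the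
  components.\<close>

lemma rho_component:
  assumes u: "u \<in> \<T>" and v: "v \<in> tangent_space S u" and d: "d \<in> M" "fst u \<in> fst d"
  shows "rho M u v d = fst (v (slit_chart M d))"
proof -
  note C = slit_chart_atlas[OF d(1)] slit_chartI[OF u d(2)]
  have "rho M u v d = vec_deriv S u v (\<lambda>w. fst (snd (slit_chart M d) w))"
    unfolding rho_eq_vec_deriv[OF d] by (simp add: slit_chart_simps)
  also have "\<dots> = fst (vec_deriv S u v (snd (slit_chart M d)))"
    by (rule slit.vec_deriv_bounded_linear[OF bounded_linear_fst slit.smooth_germ_chart[OF C]])
  finally show ?thesis using slit.vec_deriv_coordinates[OF C v] by simp
qed

lemma rho_tangent:
  assumes u: "u \<in> \<T>" and v: "v \<in> tangent_space S u"
  shows "rho M u v \<in> tangent_space M (fst u)"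
  unfolding base.tangent_space_iff
proof (intro conjI ballI allI impI)
  fix c d assume cd: "c \<in> M" "d \<in> M" "fst u \<in> fst c \<and> fst u \<in> fst d"
  then have c: "c \<in> M" "fst u \<in> fst c" and d: "d \<in> M" "fst u \<in> fst d" by auto
  have "rho M u v d = vec_deriv S u v (\<lambda>w. (snd d \<circ> chart_inv c) (snd c (fst w)))"
    unfolding rho_eq_vec_deriv[OF d]
  proof (rule slit.vec_deriv_cong)
    show "\<forall>\<^sub>F w in point_nhds S u. snd d (fst w) = (snd d \<circ> chart_inv c) (snd c (fst w))"
      using eventually_pullback[OF u base.eventually_in_chart[OF c]]
      by eventually_elim (simp add: base.chart_inv_eq[OF c(1)])
  qed (use u in simp)
  also have "\<dots> = jac c d (fst u) (rho M u v c)"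
    unfolding rho_eq_vec_deriv[OF c] jac_def
    by (rule slit.vec_deriv_compose)
       (use u base.smooth_germ_chart[OF c] base.smooth_transition[OF c(1) d(1) c(2) d(2)] in
         \<open>auto intro: smooth_germ_pullback simp: comp_def\<close>)
  finally show "rho M u v d = jac c d (fst u) (rho M u v c)" .
qed (auto simp: rho_def differential_def)

section \<open>Sections of the pullback bundle\<close>

lemma pi_vector_field_iff:
  "pi_vector_field M X \<longleftrightarrow> (\<forall>u\<in>\<T>. X u \<in> tangent_space M (fst u)) \<and>
     (\<forall>c\<in>M. \<forall>u\<in>\<T>. fst u \<in> fst c \<longrightarrow> smooth_germ S (\<lambda>u. X u c) u)"
  unfolding pi_vector_field_def
  using slit.smooth_on_chart_iff[OF slit_chart_atlas, where F = "\<lambda>u. X u _"]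
  by (auto simp: slit_chart_simps)

lemma pi_tangent: "pi_vector_field M X \<Longrightarrow> u \<in> \<T> \<Longrightarrow> X u \<in> tangent_space M (fst u)"
  by (simp add: pi_vector_field_iff)

lemma pi_smooth:
  "pi_vector_field M X \<Longrightarrow> c \<in> M \<Longrightarrow> u \<in> \<T> \<Longrightarrow> fst u \<in> fst c \<Longrightarrow> smooth_germ S (\<lambda>u. X u c) u"
  by (simp add: pi_vector_field_iff)

text \<open>As for vector fields, one chart around each point suffices.\<close>

lemma pi_vector_fieldI:
  assumes T: "\<And>u. u \<in> \<T> \<Longrightarrow> X u \<in> tangent_space M (fst u)"
    and "\<And>u. u \<in> \<T> \<Longrightarrow> \<exists>c\<in>M. fst u \<in> fst c \<and> smooth_germ S (\<lambda>u. X u c) u"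
  shows "pi_vector_field M X"
  unfolding pi_vector_field_iff
proof (intro conjI ballI impI)
  fix d u assume d: "d \<in> M" "fst u \<in> fst d" and u: "u \<in> \<T>"
  then obtain c where c: "c \<in> M" "fst u \<in> fst c" and s: "smooth_germ S (\<lambda>u. X u c) u"
    using assms(2) by blast
  have up: "u \<in> points S" using u by simp
  have "smooth_germ S (\<lambda>w. frechet_derivative (snd d \<circ> chart_inv c) (at (snd c (fst w))) (X w c)) u"
    by (rule slit.smooth_germ_frechet_derivative[OF up
          smooth_germ_pullback[OF u base.smooth_germ_chart[OF c]]
          base.smooth_transition[OF c(1) d(1) c(2) d(2)] s])
  then show "smooth_germ S (\<lambda>u. X u d) u"
  proof (rule slit.smooth_germ_cong[OF up])
    show "\<forall>\<^sub>F w in point_nhds S u.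
       frechet_derivative (snd d \<circ> chart_inv c) (at (snd c (fst w))) (X w c) = X w d"
      using eventually_slit[OF u] eventually_pullback[OF u base.eventually_in_chart[OF c]]
        eventually_pullback[OF u base.eventually_in_chart[OF d]]
      by eventually_elim (metis T base.tangent_jac c(1) d(1) jac_def)
  qed
qed (use T in blast)

lemma pi_add:
  assumes "pi_vector_field M X" "pi_vector_field M Y" shows "pi_vector_field M (\<lambda>u. X u +\<^sub>v Y u)"
  using assms base.vadd_tangent slit.smooth_germ_add[of "\<lambda>u. X u _" _ "\<lambda>u. Y u _"]
  unfolding pi_vector_field_iff by (auto simp: vadd_def)

lemma pi_scale:
  assumes "pi_vector_field M X" "smooth_fun S f" shows "pi_vector_field M (\<lambda>u. f u *\<^sub>v X u)"
  using assms base.vscale_tangent slit.smooth_germ_scaleR[of f _ "\<lambda>u. X u _"]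
  unfolding pi_vector_field_iff smooth_fun_slit_iff by (auto simp: vscale_def)

lemma smooth_fun_const: "smooth_fun S (\<lambda>u. k)"
  by (simp add: smooth_fun_slit_iff)

lemma pi_sub:
  assumes "pi_vector_field M X" "pi_vector_field M Y" shows "pi_vector_field M (\<lambda>u. X u -\<^sub>v Y u)"
  using pi_add[OF assms(1) pi_scale[OF assms(2) smooth_fun_const[of "-1"]]] by (simp add: tvec_simps)

lemma pi_vzero: "pi_vector_field M (\<lambda>u. vzero)"
  unfolding pi_vector_field_iff by (simp add: vzero_def[abs_def] base.vzero_tangent[unfolded vzero_def])

lemma fundamental_field_pi: "pi_vector_field M fundamental_field"
  unfolding pi_vector_field_iff
proof (intro conjI ballI impI)
  fix c u assume c: "c \<in> M" and u: "u \<in> \<T>" "fst u \<in> fst c"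
  have "smooth_germ S (\<lambda>w. snd (snd (slit_chart M c) w)) u"
    by (rule slit.smooth_germ_linear[OF bounded_linear_snd slit.smooth_germ_chart])
       (use c u in \<open>auto simp: slit_chart_atlas slit_chart_simps\<close>)
  then show "smooth_germ S (\<lambda>u. fundamental_field u c) u"
    by (simp add: slit_chart_simps fundamental_field_def)
qed (auto simp: slit_bundle_iff fundamental_field_def)

text \<open>Near every point outside the domain of \<open>c\<close> the function vanishes identically; that is the form
  in which the closed support is used, to extend by zero what is defined over the domain of \<open>c\<close>.
  Being constant near \<open>p\<close>, it does not disturb derivatives at \<open>p\<close>.\<close>

definition cutoff :: "('a, real^'n) chart \<Rightarrow> 'a \<Rightarrow> ('a \<Rightarrow> real) \<Rightarrow> bool" where
  "cutoff c p f \<longleftrightarrow> (\<forall>q. smooth_germ M f q) \<and> (\<forall>\<^sub>F q in point_nhds M p. f q = 1) \<and>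
     (\<forall>q. q \<notin> fst c \<longrightarrow> (\<forall>\<^sub>F q' in point_nhds M q. f q' = 0))"

text \<open>A bump function in coordinates, extended by zero. Its support is the image of a closed ball, hence
  compact, hence closed since the manifold is Hausdorff.\<close>

lemma cutoff_exists:
  assumes c: "c \<in> M" "p \<in> fst c"
  obtains f where "cutoff c p f"
proof -
  have "open (chart_image c)" "snd c p \<in> chart_image c"
    using chart_facts(2)[OF c(1)] c(2) by (auto simp: chart_image_def)
  then obtain r where r: "r > 0" "cball (snd c p) r \<subseteq> chart_image c" using open_contains_cball by blast
  obtain b :: "real^'n \<Rightarrow> real" where b: "\<And>x. smooth_at b x" "\<forall>\<^sub>F x in nhds (snd c p). b x = 1"
    "\<And>x. x \<notin> cball (snd c p) r \<Longrightarrow> b x = 0"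
    using bump_function[OF r(1)] by blast
  define K where "K = chart_inv c ` cball (snd c p) r"
  have "compact K" unfolding K_def
    using r(2) homeomorphism_cont2[OF chart_facts(3)[OF c(1)]]
    by (intro compact_continuous_image compact_cball) (rule continuous_on_subset)
  then have K: "open (- K)" using compact_imp_closed by blast
  define f where "f q = (if q \<in> fst c then b (snd c q) else 0)" for q
  have f0: "f q = 0" if "q \<notin> K" for q
  proof (cases "q \<in> fst c")
    case True
    then have "snd c q \<notin> cball (snd c p) r" using that base.chart_inv_eq[OF c(1) True] unfolding K_def by force
    then show ?thesis using b(3) by (simp add: f_def)
  qed (simp add: f_def)
  have Kc: "K \<subseteq> fst c"
    using r(2) homeomorphism_image2[OF chart_facts(3)[OF c(1)]] unfolding K_def by blast
  have out: "\<forall>\<^sub>F q' in point_nhds M q. f q' = 0" if "q \<notin> fst c" for q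
  proof -
    obtain d where d: "d \<in> M" "q \<in> fst d" by (rule base_chart_exists)
    have "isCont (chart_inv d) (snd d q)"
      using homeomorphism_cont2[OF chart_facts(3)[OF d(1)]] chart_facts(2)[OF d(1)] d(2)
      by (auto simp: continuous_on_eq_continuous_at chart_image_def)
    then have "(chart_inv d \<longlongrightarrow> q) (nhds (snd d q))"
      using base.chart_inv_eq[OF d] unfolding isCont_def by (metis tendsto_at_iff_tendsto_nhds)
    then have "\<forall>\<^sub>F x in nhds (snd d q). chart_inv d x \<in> - K"
      using topological_tendstoD[OF _ K] that Kc by blast
    then show ?thesis unfolding base.eventually_point_nhds[OF d]
      by eventually_elim (simp add: f0)
  qed
  have "smooth_germ M f q" for q
  proof (cases "q \<in> fst c")
    case True
    have "smooth_germ M (\<lambda>q. b (snd c q)) q"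
      by (rule base.smooth_germ_compose[OF _ base.smooth_germ_chart[OF c(1) True] b(1)]) simp
    then show ?thesis
      by (rule base.smooth_germ_cong[rotated])
         (use base.eventually_in_chart[OF c(1) True] in \<open>auto simp: f_def elim!: eventually_mono\<close>)
  next
    case False
    show ?thesis
      by (rule base.smooth_germ_cong[OF _ base.smooth_germ_const[of 0]])
         (use out[OF False] in \<open>auto elim!: eventually_mono\<close>)
  qed
  moreover have "\<forall>\<^sub>F q in point_nhds M p. f q = 1"
    unfolding base.eventually_point_nhds[OF c] using b(2) base.eventually_overlap[OF c(1,1) c(2,2)]
    by eventually_elim (auto simp: f_def base.chart_inv_eq[OF c(1)])
  ultimately show ?thesis using that out unfolding cutoff_def by blast
qed

context
  fixes c p f
  assumes c: "c \<in> M" and f: "cutoff c p f"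
begin

lemma cutoff_smooth: "smooth_fun S (\<lambda>u. f (fst u))"
  using f smooth_germ_pullback unfolding smooth_fun_slit_iff cutoff_def by blast

lemma cutoff_outside: "q \<notin> fst c \<Longrightarrow> f q = 0"
  using f base.eventually_point_nhds_self[of q "\<lambda>q. f q = 0"] unfolding cutoff_def by auto

lemma cutoff_center: "f p = 1"
  using f base.eventually_point_nhds_self[of p "\<lambda>q. f q = 1"] unfolding cutoff_def by auto

lemma eventually_cutoff:
  "u \<in> \<T> \<Longrightarrow> fst u = p \<Longrightarrow> \<forall>\<^sub>F w in point_nhds S u. f (fst w) = 1"
  using f eventually_pullback[of u "\<lambda>q. f q = 1"] unfolding cutoff_def by auto

lemma cutoff_smooth_germ_extend:
  fixes F :: "('a, 'n) tpoint \<Rightarrow> 'f::real_normed_vector"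
  assumes u: "u \<in> \<T>" and F: "fst u \<in> fst c \<Longrightarrow> smooth_germ S F u"
  shows "smooth_germ S (\<lambda>w. f (fst w) *\<^sub>R F w) u"
proof (cases "fst u \<in> fst c")
  case True
  then show ?thesis using slit.smooth_germ_scaleR cutoff_smooth F u unfolding smooth_fun_slit_iff by blast
next
  case False
  then have "\<forall>\<^sub>F w in point_nhds S u. f (fst w) = 0"
    using f eventually_pullback[OF u, of "\<lambda>q. f q = 0"] unfolding cutoff_def by blast
  then have "\<forall>\<^sub>F w in point_nhds S u. 0 = f (fst w) *\<^sub>R F w"
    by eventually_elim simp
  then show ?thesis by (rule slit.smooth_germ_cong[OF _ slit.smooth_germ_const, rotated]) (use u in simp)
qed

lemma cutoff_component_smooth:
  fixes X :: "('a, 'n) pi_field"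
  assumes X: "pi_vector_field M X"
  shows "smooth_fun S (\<lambda>u. f (fst u) * X u c $ i)"
  unfolding smooth_fun_slit_iff
  using cutoff_smooth_germ_extend[of _ "\<lambda>u. X u c $ i"]
    slit.smooth_germ_linear[OF bounded_linear_vec_nth pi_smooth[OF X c]] by simp

lemma cutoff_tangent: "f q *\<^sub>v tvec_of M c q e \<in> tangent_space M q"
proof (cases "q \<in> fst c")
  case False
  then have "f q *\<^sub>v tvec_of M c q e = vzero" by (simp add: cutoff_outside tvec_simps)
  then show ?thesis by simp
qed (intro base.vscale_tangent base.tvec_of_tangent c)

lemma cutoff_pi_field: "pi_vector_field M (\<lambda>u. f (fst u) *\<^sub>v tvec_of M c (fst u) e)"
proof (rule pi_vector_fieldI[OF cutoff_tangent])
  fix u assume u: "u \<in> \<T>"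
  obtain d where d: "d \<in> M" "fst u \<in> fst d" by (rule base_chart_exists)
  have "smooth_germ S (\<lambda>w. f (fst w) *\<^sub>R tvec_of M c (fst w) e d) u"
  proof (rule cutoff_smooth_germ_extend[OF u])
    assume uc: "fst u \<in> fst c"
    have "smooth_germ M (\<lambda>q. jac c d q e) (fst u)"
      by (rule base.smooth_germ_jac[OF c uc d base.smooth_germ_const])
    then have "smooth_germ M (\<lambda>q. tvec_of M c q e d) (fst u)"
      by (rule base.smooth_germ_cong[rotated])
         (use base.eventually_in_chart[OF d] d in \<open>auto simp: tvec_of_def elim!: eventually_mono\<close>)
    then show "smooth_germ S (\<lambda>w. tvec_of M c (fst w) e d) u"
      by (rule smooth_germ_pullback[OF u])
  qed
  then show "\<exists>d\<in>M. fst u \<in> fst d \<and> smooth_germ S (\<lambda>u. (f (fst u) *\<^sub>v tvec_of M c (fst u) e) d) u"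
    using d by (auto simp: vscale_def)
qed

lemma cutoff_vector_field:
  "vector_field S (\<lambda>u. f (fst u) *\<^sub>v tvec_of S (slit_chart M c) u e)"
proof (rule slit.vector_fieldI)
  fix u assume "u \<in> points S"
  then have u: "u \<in> \<T>" by simp
  show "f (fst u) *\<^sub>v tvec_of S (slit_chart M c) u e \<in> tangent_space S u"
  proof (cases "fst u \<in> fst c")
    case False
    then have "f (fst u) *\<^sub>v tvec_of S (slit_chart M c) u e = vzero"
      by (simp add: cutoff_outside tvec_simps)
    then show ?thesis by simp
  qed (intro slit.vscale_tangent slit.tvec_of_tangent slit_chart_atlas c slit_chartI u)
  obtain d where d: "d \<in> M" "fst u \<in> fst d" by (rule base_chart_exists)
  note D = slit_chart_atlas[OF d(1)] slit_chartI[OF u d(2)]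
  have "smooth_germ S (\<lambda>w. f (fst w) *\<^sub>R tvec_of S (slit_chart M c) w e (slit_chart M d)) u"
  proof (rule cutoff_smooth_germ_extend[OF u])
    assume uc: "fst u \<in> fst c"
    have "smooth_germ S (\<lambda>q. jac (slit_chart M c) (slit_chart M d) q e) u"
      by (rule slit.smooth_germ_jac[OF slit_chart_atlas[OF c] slit_chartI[OF u uc] D slit.smooth_germ_const])
    then show "smooth_germ S (\<lambda>q. tvec_of S (slit_chart M c) q e (slit_chart M d)) u"
      by (rule slit.smooth_germ_cong[rotated])
         (use slit.eventually_in_chart[OF D] D u in \<open>auto simp: tvec_of_def elim!: eventually_mono\<close>)
  qed
  then show "\<exists>C\<in>S. u \<in> fst C \<and>
      smooth_germ S (\<lambda>u. (f (fst u) *\<^sub>v tvec_of S (slit_chart M c) u e) C) u"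
    using D by (auto simp: vscale_def)
qed

end

lemma pi_field_through:
  assumes "u \<in> \<T>" "w \<in> tangent_space M (fst u)"
  obtains Z where "pi_vector_field M Z" "Z u = w"
proof -
  obtain c where c: "c \<in> M" "fst u \<in> fst c" by (rule base_chart_exists)
  obtain f where f: "cutoff c (fst u) f" by (rule cutoff_exists[OF c])
  show ?thesis
    by (rule that[OF cutoff_pi_field[OF c(1) f, of "w c"]])
       (simp add: cutoff_center[OF c(1) f] base.tvec_of_component_eq[OF assms(2) c] vscale_def)
qed

end

section \<open>Local frames and tensoriality\<close>

lemma linear_axis_expansion:
  fixes h :: "real^'n::finite \<Rightarrow> 'b::real_vector"
  assumes "linear h"
  shows "h v = (\<Sum>i\<in>UNIV. (v $ i) *\<^sub>R h (axis i 1))"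
proof -
  have "h v = h (\<Sum>i\<in>UNIV. (v $ i) *\<^sub>R axis i 1)"
    using basis_expansion[of v] by (simp add: scalar_mult_eq_scaleR)
  then show ?thesis by (simp add: linear_sum[OF assms] linear_scale[OF assms])
qed

lemma (in smooth_atlas) tvec_of_linear:
  assumes "c \<in> M" "p \<in> fst c"
  shows "tvec_of M c p (a *\<^sub>R e + b *\<^sub>R e') = a *\<^sub>v tvec_of M c p e +\<^sub>v b *\<^sub>v tvec_of M c p e'"
  using linear_jac[OF assms] by (auto simp: tvec_of_def tvec_simps fun_eq_iff linear_add linear_scale)

context tangent_atlas
begin

text \<open>Connections, curvature and the Ricci tensor act on global sections only. These global sections
  agree near the centre of the cutoff with the coordinate frame of the chart.\<close>

definition frame :: "('a, real^'n) chart \<Rightarrow> ('a \<Rightarrow> real) \<Rightarrow> 'n \<Rightarrow> ('a, 'n) pi_field" where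
  "frame c f i = (\<lambda>u. f (fst u) *\<^sub>v tvec_of M c (fst u) (axis i 1))"

lemma tangent_expansion:
  assumes c: "c \<in> M" "p \<in> fst c" and v: "v \<in> tangent_space M p"
  shows "v d = (\<Sum>i\<in>UNIV. (v c $ i) *\<^sub>R tvec_of M c p (axis i 1) d)"
proof -
  have "linear (\<lambda>e. tvec_of M c p e d)"
    using base.linear_jac[OF c, of d] by (cases "d \<in> M \<and> p \<in> fst d") (auto simp: tvec_of_def linear_zero)
  from linear_axis_expansion[OF this, of "v c"] show ?thesis
    unfolding base.tvec_of_component_eq[OF v c] .
qed

lemma frame_pi: "c \<in> M \<Longrightarrow> cutoff c p f \<Longrightarrow> pi_vector_field M (frame c f i)"
  unfolding frame_def by (rule cutoff_pi_field)

text \<open>A section has no global components, but its components times the cutoff are global functions.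
  With the cutoff in the frame, the sum reproduces the section times the square of the cutoff.\<close>

lemma frame_expansion:
  assumes c: "c \<in> M" and f: "cutoff c p f" and X: "pi_vector_field M X" and u: "u \<in> \<T>"
  shows "X u = (1 - f (fst u) * f (fst u)) *\<^sub>v X u +\<^sub>v
    (\<lambda>d. \<Sum>i\<in>UNIV. (f (fst u) * X u c $ i) *\<^sub>R frame c f i u d)"
proof (cases "fst u \<in> fst c")
  case True
  have "(\<Sum>i\<in>UNIV. (f (fst u) * X u c $ i) *\<^sub>R frame c f i u d) = (f (fst u) * f (fst u)) *\<^sub>R X u d" for d
    by (subst (2) tangent_expansion[OF c True pi_tangent[OF X u]])
       (simp add: frame_def vscale_def scaleR_sum_right mult_ac)
  then show ?thesis by (simp add: tvec_simps fun_eq_iff algebra_simps)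
next
  case False
  then have "f (fst u) = 0" using cutoff_outside[OF c f] by blast
  then show ?thesis by (simp add: tvec_simps)
qed

lemma derivation_sum:
  fixes \<Phi> :: "('a, 'n) pi_field \<Rightarrow> 'v::real_vector"
  assumes add: "\<And>X Y. pi_vector_field M X \<Longrightarrow> pi_vector_field M Y \<Longrightarrow> \<Phi> (\<lambda>u. X u +\<^sub>v Y u) = \<Phi> X + \<Phi> Y"
    and scale: "\<And>X f. pi_vector_field M X \<Longrightarrow> smooth_fun S f \<Longrightarrow>
      \<Phi> (\<lambda>u. f u *\<^sub>v X u) = \<delta> f *\<^sub>R ev X + f u *\<^sub>R \<Phi> X"
    and g: "\<And>i. i \<in> I \<Longrightarrow> smooth_fun S (g i)" and Y: "\<And>i. i \<in> I \<Longrightarrow> pi_vector_field M (Y i)"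
    and I: "finite I"
  shows "pi_vector_field M (\<lambda>u d. \<Sum>i\<in>I. g i u *\<^sub>R Y i u d) \<and>
    \<Phi> (\<lambda>u d. \<Sum>i\<in>I. g i u *\<^sub>R Y i u d) = (\<Sum>i\<in>I. \<delta> (g i) *\<^sub>R ev (Y i) + g i u *\<^sub>R \<Phi> (Y i))"
  using I g Y
proof (induction I)
  case empty
  have z: "pi_vector_field M (\<lambda>u d. 0)" using pi_vzero by (simp add: vzero_def)
  from add[OF z z] show ?case using z by (simp add: vadd_def)
next
  case (insert i I)
  then have IH: "pi_vector_field M (\<lambda>u d. \<Sum>i\<in>I. g i u *\<^sub>R Y i u d)"
    "\<Phi> (\<lambda>u d. \<Sum>i\<in>I. g i u *\<^sub>R Y i u d) = (\<Sum>i\<in>I. \<delta> (g i) *\<^sub>R ev (Y i) + g i u *\<^sub>R \<Phi> (Y i))"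
    by auto
  have gi: "smooth_fun S (g i)" and Yi: "pi_vector_field M (Y i)" using insert by auto
  have eq: "(\<lambda>u d. \<Sum>i\<in>insert i I. g i u *\<^sub>R Y i u d) =
      (\<lambda>u. g i u *\<^sub>v Y i u +\<^sub>v (\<lambda>d. \<Sum>i\<in>I. g i u *\<^sub>R Y i u d))"
    using insert by (simp add: tvec_simps)
  show ?case unfolding eq
    using pi_add[OF pi_scale[OF Yi gi] IH(1)] add[OF pi_scale[OF Yi gi] IH(1)] scale[OF Yi gi] IH(2) insert
    by simp
qed

text \<open>Covers tensorial operators (\<open>\<delta> = 0\<close>) and covariant derivatives (\<open>\<delta>\<close> a directional derivative)
  together. The value at \<open>u\<close> is expressed through components and the frame near \<open>u\<close>, without first
  proving that the operator is local: it is enough to apply it to the identity of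
  \<open>frame_expansion\<close>, where the remainder has the coefficient \<open>0\<close> at \<open>u\<close>.\<close>

lemma derivation_expansion:
  fixes \<Phi> :: "('a, 'n) pi_field \<Rightarrow> 'v::real_vector"
  assumes add: "\<And>X Y. pi_vector_field M X \<Longrightarrow> pi_vector_field M Y \<Longrightarrow> \<Phi> (\<lambda>u. X u +\<^sub>v Y u) = \<Phi> X + \<Phi> Y"
    and scale: "\<And>X f. pi_vector_field M X \<Longrightarrow> smooth_fun S f \<Longrightarrow>
      \<Phi> (\<lambda>u. f u *\<^sub>v X u) = \<delta> f *\<^sub>R ev X + f u *\<^sub>R \<Phi> X"
    and cong: "\<And>X Y. pi_vector_field M X \<Longrightarrow> pi_vector_field M Y \<Longrightarrow> \<forall>u\<in>\<T>. X u = Y u \<Longrightarrow> \<Phi> X = \<Phi> Y"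
    and c: "c \<in> M" and f: "cutoff c (fst u) f" and X: "pi_vector_field M X" and u: "u \<in> \<T>"
  shows "\<Phi> X = \<delta> (\<lambda>u. 1 - f (fst u) * f (fst u)) *\<^sub>R ev X +
    (\<Sum>i\<in>UNIV. \<delta> (\<lambda>u. f (fst u) * X u c $ i) *\<^sub>R ev (frame c f i) + (X u c $ i) *\<^sub>R \<Phi> (frame c f i))"
proof -
  let ?S = "\<lambda>u d. \<Sum>i\<in>UNIV. (f (fst u) * X u c $ i) *\<^sub>R frame c f i u d"
  have S: "pi_vector_field M ?S \<and> \<Phi> ?S =
    (\<Sum>i\<in>UNIV. \<delta> (\<lambda>u. f (fst u) * X u c $ i) *\<^sub>R ev (frame c f i) + (f (fst u) * X u c $ i) *\<^sub>R \<Phi> (frame c f i))"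
    by (rule derivation_sum[where g = "\<lambda>i u. f (fst u) * X u c $ i" and Y = "\<lambda>i. frame c f i", OF add scale])
       (use cutoff_component_smooth[OF c f X] frame_pi[OF c f] in auto)
  have ff: "smooth_fun S (\<lambda>u. 1 - f (fst u) * f (fst u))"
    using cutoff_smooth[OF c f] unfolding smooth_fun_slit_iff
    by (auto intro!: slit.smooth_germ_diff slit.smooth_germ_mult)
  note fX = pi_scale[OF X ff]
  have "\<Phi> X = \<Phi> (\<lambda>u. (1 - f (fst u) * f (fst u)) *\<^sub>v X u +\<^sub>v ?S u)"
    using frame_expansion[OF c f X] by (intro cong X pi_add fX) (use S in auto)
  also have "\<dots> = \<Phi> (\<lambda>u. (1 - f (fst u) * f (fst u)) *\<^sub>v X u) + \<Phi> ?S"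
    using S by (intro add fX) auto
  finally show ?thesis
    using S scale[OF X ff] cutoff_center[OF c f] by simp
qed

text \<open>Hence the value of a tensorial operator at \<open>u\<close> depends on the value of the section at \<open>u\<close> alone.\<close>

lemma tensor_expansion:
  fixes \<Phi> :: "('a, 'n) pi_field \<Rightarrow> 'v::real_vector"
  assumes add: "\<And>X Y. pi_vector_field M X \<Longrightarrow> pi_vector_field M Y \<Longrightarrow> \<Phi> (\<lambda>u. X u +\<^sub>v Y u) = \<Phi> X + \<Phi> Y"
    and scale: "\<And>X f. pi_vector_field M X \<Longrightarrow> smooth_fun S f \<Longrightarrow>
      \<Phi> (\<lambda>u. f u *\<^sub>v X u) = f u *\<^sub>R \<Phi> X"
    and cong: "\<And>X Y. pi_vector_field M X \<Longrightarrow> pi_vector_field M Y \<Longrightarrow> \<forall>u\<in>\<T>. X u = Y u \<Longrightarrow> \<Phi> X = \<Phi> Y"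
    and c: "c \<in> M" and f: "cutoff c (fst u) f" and X: "pi_vector_field M X" and u: "u \<in> \<T>"
  shows "\<Phi> X = (\<Sum>i\<in>UNIV. (X u c $ i) *\<^sub>R \<Phi> (frame c f i))"
proof -
  have "\<Phi> X = 0 *\<^sub>R 0 + (\<Sum>i\<in>UNIV. 0 *\<^sub>R 0 + (X u c $ i) *\<^sub>R \<Phi> (frame c f i))"
    by (rule derivation_expansion[where \<delta> = "\<lambda>f. 0" and ev = "\<lambda>X. 0", OF add _ cong c f X u])
       (simp_all add: scale)
  then show ?thesis by simp
qed

lemma rho_linear:
  assumes "u \<in> \<T>" "v \<in> tangent_space S u" "w \<in> tangent_space S u"
  shows "rho M u (a *\<^sub>v v +\<^sub>v b *\<^sub>v w) = a *\<^sub>v rho M u v +\<^sub>v b *\<^sub>v rho M u w"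
proof
  fix d
  note vw = slit.vadd_tangent[OF slit.vscale_tangent[OF assms(2)] slit.vscale_tangent[OF assms(3)], of a b]
  show "rho M u (a *\<^sub>v v +\<^sub>v b *\<^sub>v w) d = (a *\<^sub>v rho M u v +\<^sub>v b *\<^sub>v rho M u w) d"
  proof (cases "d \<in> M \<and> fst u \<in> fst d")
    case True
    then show ?thesis using rho_component[OF assms(1)] assms(2,3) vw by (simp add: tvec_simps)
  qed (auto simp: rho_def differential_def tvec_simps)
qed

end

section \<open>Connections and their horizontal maps\<close>

locale pi_connection = tangent_atlas M
  for M :: "('a::{t2_space, second_countable_topology}, real^'n::finite) chart set" +
  fixes D :: "('a, 'n) connection"
  assumes linear: "linear_connection M D"
begin

lemma D_tangent:
  "u \<in> \<T> \<Longrightarrow> v \<in> tangent_space S u \<Longrightarrow> pi_vector_field M X \<Longrightarrow> D u v X \<in> tangent_space M (fst u)"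
  using linear[unfolded linear_connection_def, THEN conjunct1] by blast

lemma D_linear_vec:
  "u \<in> \<T> \<Longrightarrow> v \<in> tangent_space S u \<Longrightarrow> w \<in> tangent_space S u \<Longrightarrow> pi_vector_field M X \<Longrightarrow>
   D u (a *\<^sub>v v +\<^sub>v b *\<^sub>v w) X = a *\<^sub>v D u v X +\<^sub>v b *\<^sub>v D u w X"
  using linear unfolding linear_connection_def by blast

lemma D_add:
  "u \<in> \<T> \<Longrightarrow> v \<in> tangent_space S u \<Longrightarrow> pi_vector_field M X \<Longrightarrow> pi_vector_field M Y \<Longrightarrow>
   D u v (\<lambda>u. X u +\<^sub>v Y u) = D u v X +\<^sub>v D u v Y"
  using linear unfolding linear_connection_def by blast

lemma D_scale:
  "u \<in> \<T> \<Longrightarrow> v \<in> tangent_space S u \<Longrightarrow> smooth_fun S f \<Longrightarrow> pi_vector_field M X \<Longrightarrow>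
   D u v (\<lambda>u. f u *\<^sub>v X u) = vec_deriv S u v f *\<^sub>v X u +\<^sub>v f u *\<^sub>v D u v X"
  using linear unfolding linear_connection_def dir_deriv_eq_vec_deriv by blast

lemma D_smooth:
  "vector_field S V \<Longrightarrow> pi_vector_field M X \<Longrightarrow> pi_vector_field M (\<lambda>u. D u (V u) X)"
  using linear unfolding linear_connection_def by blast

lemma D_cong:
  assumes "u \<in> \<T>" "v \<in> tangent_space S u" "pi_vector_field M X" "pi_vector_field M Y"
    and "\<And>u. u \<in> \<T> \<Longrightarrow> X u = Y u"
  shows "D u v X = D u v Y"
proof -
  have "\<forall>u\<in>\<T>. X u = Y u" using assms(5) by blast
  then show ?thesis
    using linear[unfolded linear_connection_def, THEN conjunct2, THEN conjunct2, THEN conjunct2,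
      THEN conjunct2, THEN conjunct2, THEN bspec, OF assms(1), THEN bspec, OF assms(2)] assms(3,4)
    by blast
qed

lemma D_sub:
  assumes "u \<in> \<T>" "v \<in> tangent_space S u" "pi_vector_field M X" "pi_vector_field M Y"
  shows "D u v (\<lambda>u. X u -\<^sub>v Y u) = D u v X -\<^sub>v D u v Y"
proof -
  have "D u v (\<lambda>u. X u +\<^sub>v (-1) *\<^sub>v Y u) = D u v X +\<^sub>v (-1) *\<^sub>v D u v Y"
    using D_add[OF assms(1-3) pi_scale[OF assms(4) smooth_fun_const[of "-1"]]]
      D_scale[OF assms(1,2) smooth_fun_const assms(4), of "-1"]
    by (simp add: slit.vec_deriv_const tvec_simps)
  then show ?thesis by (simp add: tvec_simps)
qed

lemma D_add_vec:
  "u \<in> \<T> \<Longrightarrow> v \<in> tangent_space S u \<Longrightarrow> w \<in> tangent_space S u \<Longrightarrow> pi_vector_field M X \<Longrightarrow>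
   D u (v +\<^sub>v w) X = D u v X +\<^sub>v D u w X"
  using D_linear_vec[of u v w X 1 1] by (simp add: tvec_simps)

lemma D_scale_vec:
  "u \<in> \<T> \<Longrightarrow> v \<in> tangent_space S u \<Longrightarrow> pi_vector_field M X \<Longrightarrow>
   D u (a *\<^sub>v v) X = a *\<^sub>v D u v X"
  using D_linear_vec[of u v v X a 0] by (simp add: tvec_simps)

text \<open>The coordinate formula for a covariant derivative; the components of \<open>D u v (frame c f i)\<close> are the
  connection coefficients. The cutoff is constant near \<open>u\<close> and so has disappeared.\<close>

lemma D_chart:
  assumes u: "u \<in> \<T>" and v: "v \<in> tangent_space S u" and X: "pi_vector_field M X"
    and c: "c \<in> M" "fst u \<in> fst c" and f: "cutoff c (fst u) f"
  shows "D u v X c = vec_deriv S u v (\<lambda>u. X u c) + (\<Sum>i\<in>UNIV. (X u c $ i) *\<^sub>R D u v (frame c f i) c)"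
proof -
  have up: "u \<in> points S" using u by simp
  have "D u v X c = vec_deriv S u v (\<lambda>u. 1 - f (fst u) * f (fst u)) *\<^sub>R X u c +
    (\<Sum>i\<in>UNIV. vec_deriv S u v (\<lambda>u. f (fst u) * X u c $ i) *\<^sub>R frame c f i u c +
       (X u c $ i) *\<^sub>R D u v (frame c f i) c)"
  proof (rule derivation_expansion[of "\<lambda>X. D u v X c" "vec_deriv S u v" "\<lambda>X. X u c" u c f X, OF _ _ _ c(1) f X u])
    show "D u v (\<lambda>u. X u +\<^sub>v Y u) c = D u v X c + D u v Y c"
      if "pi_vector_field M X" "pi_vector_field M Y" for X Y
      unfolding D_add[OF u v that] by (simp add: vadd_def)
    show "D u v (\<lambda>u. f u *\<^sub>v X u) c = vec_deriv S u v f *\<^sub>R X u c + f u *\<^sub>R D u v X c"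
      if "pi_vector_field M X" "smooth_fun S f" for X f
      unfolding D_scale[OF u v that(2,1)] by (simp add: tvec_simps)
    show "D u v X c = D u v Y c"
      if "pi_vector_field M X" "pi_vector_field M Y" "\<forall>u\<in>\<T>. X u = Y u" for X Y
      using D_cong[OF u v that(1,2)] that(3) by simp
  qed
  moreover have "vec_deriv S u v (\<lambda>u. 1 - f (fst u) * f (fst u)) = vec_deriv S u v (\<lambda>u. 0)"
    by (rule slit.vec_deriv_cong[OF up])
       (use eventually_cutoff[OF c(1) f u] in \<open>auto elim!: eventually_mono\<close>)
  moreover have "vec_deriv S u v (\<lambda>u. f (fst u) * X u c $ i) = vec_deriv S u v (\<lambda>u. X u c) $ i" for i
  proof -
    have "vec_deriv S u v (\<lambda>u. f (fst u) * X u c $ i) = vec_deriv S u v (\<lambda>u. X u c $ i)"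
      by (rule slit.vec_deriv_cong[OF up])
         (use eventually_cutoff[OF c(1) f u] in \<open>auto elim!: eventually_mono\<close>)
    then show ?thesis
      using slit.vec_deriv_bounded_linear[OF bounded_linear_vec_nth pi_smooth[OF X c(1) u c(2)]] by simp
  qed
  moreover have "frame c f i u c = axis i 1" for i
    using base.tvec_of_component[OF c] cutoff_center[OF c(1) f] by (simp add: frame_def tvec_simps)
  moreover have "(\<Sum>i\<in>UNIV. (w $ i) *\<^sub>R axis i 1) = w" for w :: "real^'n"
    using linear_axis_expansion[OF linear_id, of w] by simp
  ultimately show ?thesis by (simp add: slit.vec_deriv_const sum.distrib)
qed

end

locale regular_pi_connection = pi_connection +
  assumes regular: "regular_connection M D"
begin

abbreviation "\<beta> \<equiv> horizontal_map M D"

lemma horizontal_tangent: "v \<in> horizontal_space M D u \<Longrightarrow> v \<in> tangent_space S u"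
  by (simp add: horizontal_space_def)

lemma horizontal_combination:
  assumes u: "u \<in> \<T>" and v: "v \<in> horizontal_space M D u" "w \<in> horizontal_space M D u"
  shows "a *\<^sub>v v +\<^sub>v b *\<^sub>v w \<in> horizontal_space M D u"
  using D_linear_vec[OF u horizontal_tangent[OF v(1)] horizontal_tangent[OF v(2)] fundamental_field_pi, of a b]
    v slit.vadd_tangent slit.vscale_tangent
  unfolding horizontal_space_def by (simp add: tvec_simps)

text \<open>The difference is horizontal and vertical, and regularity makes it vanish.\<close>

lemma horizontal_rho_inj:
  assumes u: "u \<in> \<T>" and v: "v \<in> horizontal_space M D u" "w \<in> horizontal_space M D u"
    and eq: "rho M u v = rho M u w"
  shows "v = w"
proof -
  let ?z = "1 *\<^sub>v v +\<^sub>v (-1) *\<^sub>v w"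
  have h: "?z \<in> horizontal_space M D u" by (rule horizontal_combination[OF u v])
  have "rho M u ?z = vzero"
    using rho_linear[OF u horizontal_tangent[OF v(1)] horizontal_tangent[OF v(2)], of 1 "-1"] eq
    by (simp add: tvec_simps)
  then have "?z \<in> vertical_space M u"
    using horizontal_tangent[OF h] by (simp add: vertical_space_def)
  then have "?z = vzero" using h regular u unfolding regular_connection_def by blast
  then show ?thesis by (simp add: tvec_simps fun_eq_iff)
qed

text \<open>Lift \<open>w\<close> arbitrarily and discard the vertical part.\<close>

lemma horizontal_rho_surj:
  assumes u: "u \<in> \<T>" and w: "w \<in> tangent_space M (fst u)"
  shows "\<exists>v\<in>horizontal_space M D u. rho M u v = w"
proof -
  obtain c where c: "c \<in> M" "fst u \<in> fst c" by (rule base_chart_exists)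
  note C = slit_chart_atlas[OF c(1)] slit_chartI[OF u c(2)]
  define v where "v = tvec_of S (slit_chart M c) u (w c, 0)"
  have v: "v \<in> tangent_space S u" unfolding v_def by (rule slit.tvec_of_tangent[OF C])
  have rv: "rho M u v = w"
    by (rule base.tangent_eqI[OF rho_tangent[OF u v] w c])
       (use rho_component[OF u v c] in \<open>simp add: v_def slit.tvec_of_component[OF C]\<close>)
  have "v \<in> {a +\<^sub>v b | a b. a \<in> vertical_space M u \<and> b \<in> horizontal_space M D u}"
    using regular u v unfolding regular_connection_def by blast
  then obtain a b where ab: "v = a +\<^sub>v b" "a \<in> vertical_space M u" "b \<in> horizontal_space M D u" by blast
  have "rho M u v = rho M u a +\<^sub>v rho M u b"
    using rho_linear[OF u _ horizontal_tangent[OF ab(3)], of a 1 1] ab(1,2)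
    by (simp add: vertical_space_def tvec_simps)
  then have "rho M u b = w" using ab(2) rv by (simp add: vertical_space_def tvec_simps)
  with ab(3) show ?thesis by blast
qed

lemma
  assumes u: "u \<in> \<T>" and w: "w \<in> tangent_space M (fst u)"
  shows \<beta>_horizontal: "\<beta> u w \<in> horizontal_space M D u" and rho_\<beta>: "rho M u (\<beta> u w) = w"
proof -
  have "w \<in> rho M u ` horizontal_space M D u" using horizontal_rho_surj[OF u w] by auto
  then show "\<beta> u w \<in> horizontal_space M D u" "rho M u (\<beta> u w) = w"
    unfolding horizontal_map_def by (rule inv_into_into, rule f_inv_into_f)
qed

lemma \<beta>_tangent: "u \<in> \<T> \<Longrightarrow> w \<in> tangent_space M (fst u) \<Longrightarrow> \<beta> u w \<in> tangent_space S u"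
  using \<beta>_horizontal horizontal_tangent by blast

lemma \<beta>_linear:
  assumes u: "u \<in> \<T>" and v: "v \<in> tangent_space M (fst u)" and w: "w \<in> tangent_space M (fst u)"
  shows "\<beta> u (a *\<^sub>v v +\<^sub>v b *\<^sub>v w) = a *\<^sub>v \<beta> u v +\<^sub>v b *\<^sub>v \<beta> u w"
proof (rule horizontal_rho_inj[OF u])
  have vw: "a *\<^sub>v v +\<^sub>v b *\<^sub>v w \<in> tangent_space M (fst u)"
    by (intro base.vadd_tangent base.vscale_tangent v w)
  show "\<beta> u (a *\<^sub>v v +\<^sub>v b *\<^sub>v w) \<in> horizontal_space M D u" by (rule \<beta>_horizontal[OF u vw])
  show "a *\<^sub>v \<beta> u v +\<^sub>v b *\<^sub>v \<beta> u w \<in> horizontal_space M D u"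
    by (intro horizontal_combination \<beta>_horizontal u v w)
  show "rho M u (\<beta> u (a *\<^sub>v v +\<^sub>v b *\<^sub>v w)) = rho M u (a *\<^sub>v \<beta> u v +\<^sub>v b *\<^sub>v \<beta> u w)"
    by (simp add: rho_\<beta>[OF u vw] rho_linear[OF u \<beta>_tangent[OF u v] \<beta>_tangent[OF u w]] rho_\<beta>[OF u v] rho_\<beta>[OF u w])
qed

text \<open>A tangent vector with components \<open>(a, b)\<close> is horizontal when \<open>L (a, b) = 0\<close>, where \<open>L\<close> sends it to the
  components of the derivative of the fundamental field. Regularity says that \<open>b \<mapsto> L (0, b)\<close> is
  injective, so \<open>b\<close> solves a linear system with smooth coefficients.\<close>

lemma \<beta>_vector_field:
  assumes X: "pi_vector_field M X"
  shows "vector_field S (\<lambda>u. \<beta> u (X u))"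
proof (rule slit.vector_fieldI)
  fix u0 assume "u0 \<in> points S"
  then have u0: "u0 \<in> \<T>" by simp
  show "\<beta> u0 (X u0) \<in> tangent_space S u0" by (rule \<beta>_tangent[OF u0 pi_tangent[OF X u0]])
  obtain c where c: "c \<in> M" "fst u0 \<in> fst c" by (rule base_chart_exists)
  obtain f where f: "cutoff c (fst u0) f" by (rule cutoff_exists[OF c])
  define C where "C = slit_chart M c"
  note C = slit_chart_atlas[OF c(1), folded C_def] slit_chartI[OF u0 c(2), folded C_def]
  define L where "L u e = D u (tvec_of S C u e) fundamental_field c" for u e
  have linL: "linear (L u)" if "u \<in> fst C" for u
  proof -
    have us: "u \<in> \<T>" using that by (simp add: C_def slit_chart_simps)
    have *: "L u (a *\<^sub>R e + b *\<^sub>R e') = a *\<^sub>R L u e + b *\<^sub>R L u e'" for a b e e'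
      unfolding L_def slit.tvec_of_linear[OF C(1) that]
      by (subst D_linear_vec[OF us slit.tvec_of_tangent[OF C(1) that] slit.tvec_of_tangent[OF C(1) that] fundamental_field_pi])
         (simp add: tvec_simps)
    show ?thesis using *[of 1 _ 1] *[of _ _ 0] by (intro linearI) auto
  qed
  have expL: "L u (x, y) = (\<Sum>i\<in>UNIV. (x $ i) *\<^sub>R L u (axis i 1, 0)) + (\<Sum>i\<in>UNIV. (y $ i) *\<^sub>R L u (0, axis i 1))"
    if "u \<in> fst C" for u x y
  proof -
    note l = linL[OF that]
    have "L u (x, y) = L u (x, 0) + L u (0, y)" using linear_add[OF l, of "(x, 0)" "(0, y)"] by simp
    moreover have "linear (\<lambda>x. L u (x, 0))" "linear (\<lambda>y. L u (0, y))"
      using linear_compose[OF _ l, of "\<lambda>x. (x, 0)"] linear_compose[OF _ l, of "\<lambda>y. (0, y)"]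
      by (simp_all add: comp_def linear_iff)
    ultimately show ?thesis
      using linear_axis_expansion[of "\<lambda>x. L u (x, 0)" x] linear_axis_expansion[of "\<lambda>y. L u (0, y)" y] by simp
  qed
  have smL: "smooth_germ S (\<lambda>u. L u e) u0" for e
  proof -
    have "pi_vector_field M (\<lambda>u. D u (f (fst u) *\<^sub>v tvec_of S C u e) fundamental_field)"
      unfolding C_def by (rule D_smooth[OF cutoff_vector_field[OF c(1) f] fundamental_field_pi])
    from pi_smooth[OF this c(1) u0 c(2)]
    show ?thesis
      by (rule slit.smooth_germ_cong[rotated])
         (use eventually_cutoff[OF c(1) f u0] u0 in \<open>auto simp: L_def vscale_def elim!: eventually_mono\<close>)
  qed
  define b where "b u = snd (\<beta> u (X u) C)" for u
  have \<beta>C: "\<beta> u (X u) C = (X u c, b u)" if u: "u \<in> \<T>" "fst u \<in> fst c" for u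
    using rho_component[OF u(1) \<beta>_tangent[OF u(1) pi_tangent[OF X u(1)]] c(1) u(2)] rho_\<beta>[OF u(1) pi_tangent[OF X u(1)]]
    unfolding b_def C_def by (simp add: prod_eq_iff)
  have "smooth_germ S b u0"
  proof (rule slit.smooth_germ_linear_solution)
    show "u0 \<in> points S" using u0 by simp
    show "smooth_germ S (\<lambda>u. (\<chi> k i. L u (0, axis i 1) $ k) $ k $ i) u0" for k i
      using slit.smooth_germ_linear[OF bounded_linear_vec_nth smL] by simp
    show "smooth_germ S (\<lambda>u. (- (\<Sum>i\<in>UNIV. (X u c $ i) *\<^sub>R L u (axis i 1, 0))) $ k) u0" for k
    proof -
      have "smooth_germ S (\<lambda>u. (-1) *\<^sub>R (\<Sum>i\<in>UNIV. (X u c $ i) *\<^sub>R L u (axis i 1, 0))) u0"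
        by (intro slit.smooth_germ_scaleR slit.smooth_germ_sum smL slit.smooth_germ_const
            slit.smooth_germ_linear[OF bounded_linear_vec_nth] pi_smooth[OF X c(1) u0 c(2)])
      from slit.smooth_germ_linear[OF bounded_linear_vec_nth this] show ?thesis by simp
    qed
    have mult: "(\<chi> k i. L u (0, axis i 1) $ k) *v y = (\<Sum>i\<in>UNIV. (y $ i) *\<^sub>R L u (0, axis i 1))" for u y
      by (simp add: vec_eq_iff matrix_vector_mult_def mult.commute)
    \<comment> \<open>a solution of the homogeneous system is a vector both vertical and horizontal\<close>
    show "w = 0" if "(\<chi> k i. L u0 (0, axis i 1) $ k) *v w = 0" for w
    proof -
      let ?v = "tvec_of S C u0 (0, w)"
      have v: "?v \<in> tangent_space S u0" by (rule slit.tvec_of_tangent[OF C])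
      have "L u0 (0, w) = 0" using expL[OF C(2), of 0 w] that by (simp add: mult)
      then have "D u0 ?v fundamental_field = vzero"
        by (intro base.tangent_eqI[OF D_tangent[OF u0 v fundamental_field_pi] _ c]) (auto simp: L_def vzero_def base.vzero_tangent[unfolded vzero_def])
      moreover have "rho M u0 ?v = vzero"
        by (intro base.tangent_eqI[OF rho_tangent[OF u0 v] base.vzero_tangent c])
           (simp add: rho_component[OF u0 v c, folded C_def] slit.tvec_of_component[OF C] vzero_def)
      ultimately have "?v \<in> vertical_space M u0 \<inter> horizontal_space M D u0"
        using v by (simp add: vertical_space_def horizontal_space_def)
      then have "?v = vzero" using regular u0 unfolding regular_connection_def by blast
      then show "w = 0" using slit.tvec_of_component[OF C, of "(0, w)"] by (simp add: vzero_def zero_prod_def)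
    qed
    show "\<forall>\<^sub>F u in point_nhds S u0. (\<chi> k i. L u (0, axis i 1) $ k) *v b u =
        - (\<Sum>i\<in>UNIV. (X u c $ i) *\<^sub>R L u (axis i 1, 0))"
      using slit.eventually_in_chart[OF C]
    proof eventually_elim
      case (elim u)
      then have u: "u \<in> \<T>" "fst u \<in> fst c" by (auto simp: C_def slit_chart_simps)
      note B = \<beta>_horizontal[OF u(1) pi_tangent[OF X u(1)]]
      have "tvec_of S C u (X u c, b u) = \<beta> u (X u)"
        using slit.tvec_of_component_eq[OF horizontal_tangent[OF B] C(1) elim] \<beta>C[OF u] by simp
      then have "L u (X u c, b u) = 0"
        using B by (simp add: L_def horizontal_space_def vzero_def)
      then show ?case using expL[OF elim, of "X u c" "b u"] by (simp add: mult eq_neg_iff_add_eq_0 add.commute)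
    qed
  qed
  then have "smooth_germ S (\<lambda>u. (X u c, b u)) u0"
    using pi_smooth[OF X c(1) u0 c(2)] smooth_at_Pair unfolding smooth_germ_def by blast
  then have "smooth_germ S (\<lambda>u. \<beta> u (X u) C) u0"
    by (rule slit.smooth_germ_cong[rotated])
       (use slit.eventually_in_chart[OF C] u0 in \<open>auto simp: C_def slit_chart_simps \<beta>C[unfolded C_def] elim!: eventually_mono\<close>)
  then show "\<exists>C\<in>S. u0 \<in> fst C \<and> smooth_germ S (\<lambda>u. \<beta> u (X u) C) u0" using C by blast
qed

end

section \<open>Curvature\<close>

lemma (in smooth_atlas) lie_bracket_cong_right:
  assumes "\<And>p. p \<in> points M \<Longrightarrow> Y p = Z p"
  shows "lie_bracket M X Y p = lie_bracket M X Z p"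
proof
  fix c
  show "lie_bracket M X Y p c = lie_bracket M X Z p c"
  proof (cases "c \<in> M \<and> p \<in> fst c")
    case True
    then have c: "c \<in> M" "p \<in> fst c" by auto
    have "\<forall>\<^sub>F x in nhds (snd c p). Y (chart_inv c x) c = Z (chart_inv c x) c"
      using eventually_overlap[OF c(1,1) c(2,2)]
      by eventually_elim (auto simp: chart_inv_eq[OF c(1)] assms pointsI[OF c(1)])
    then have "frechet_derivative (\<lambda>x. Y (chart_inv c x) c) (at (snd c p)) =
        frechet_derivative (\<lambda>x. Z (chart_inv c x) c) (at (snd c p))"
      by (rule frechet_derivative_cong)
    then show ?thesis using True assms[OF pointsI[OF c]] by (simp add: lie_bracket_def)
  qed (auto simp: lie_bracket_def)
qed

context tangent_atlas
begin

text \<open>In two charts the matrices of \<open>F\<close> are conjugate under the Jacobian, and conjugate matrices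
  have the same trace.\<close>

lemma endo_trace_chart:
  assumes F: "\<And>v. v \<in> tangent_space M p \<Longrightarrow> F v \<in> tangent_space M p"
    and lin: "\<And>v w a b. v \<in> tangent_space M p \<Longrightarrow> w \<in> tangent_space M p \<Longrightarrow>
      F (a *\<^sub>v v +\<^sub>v b *\<^sub>v w) = a *\<^sub>v F v +\<^sub>v b *\<^sub>v F w"
    and c: "c \<in> M" "p \<in> fst c"
  shows "endo_trace M p F = (\<Sum>i\<in>UNIV. F (tvec_of M c p (axis i 1)) c $ i)"
proof -
  define c0 where "c0 = chart_at M p"
  have c0: "c0 \<in> M" "p \<in> fst c0" using base.chart_at'[OF c] by (auto simp: c0_def)
  define G where "G c e = F (tvec_of M c p e) c" for c e
  have the: "(THE v. v \<in> tangent_space M p \<and> v c0 = e) = tvec_of M c0 p e" for e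
    by (rule the_equality)
       (auto simp: base.tvec_of_tangent[OF c0] base.tvec_of_component[OF c0] intro: base.tangent_eqI[OF _ _ c0])
  have linG: "linear (G c)" if "c \<in> M" "p \<in> fst c" for c
  proof -
    have *: "G c (a *\<^sub>R e + b *\<^sub>R e') = a *\<^sub>R G c e + b *\<^sub>R G c e'" for a b e e'
      unfolding G_def base.tvec_of_linear[OF that]
      using lin[OF base.tvec_of_tangent[OF that] base.tvec_of_tangent[OF that], of a e b e'] by (simp add: tvec_simps)
    show ?thesis using *[of 1 _ 1] *[of _ _ 0] by (intro linearI) auto
  qed
  let ?J = "jac c c0 p" and ?K = "jac c0 c p"
  have J: "linear ?J" and K: "linear ?K" using base.linear_jac c c0 by auto
  have "G c0 e = ?J (G c (?K e))" for e
  proof -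
    have t: "tvec_of M c0 p e = tvec_of M c p (?K e)"
      by (rule base.tangent_eqI[OF base.tvec_of_tangent[OF c0] base.tvec_of_tangent[OF c] c])
         (use c c0 in \<open>simp add: base.tvec_of_component tvec_of_def[of M c0] base.jac_self\<close>)
    show ?thesis unfolding G_def t
      by (rule base.tangent_jac[OF F[OF base.tvec_of_tangent[OF c]] c c0])
  qed
  then have "G c0 = ?J \<circ> (G c \<circ> ?K)" by (simp add: fun_eq_iff)
  then have "matrix (G c0) = matrix ?J ** (matrix (G c) ** matrix ?K)"
    by (simp add: matrix_compose J K linG[OF c] linear_compose)
  then have "trace (matrix (G c0)) = trace (matrix (G c) ** matrix ?K ** matrix ?J)"
    by (simp only: trace_mul_sym[of "matrix ?J"])
  also have "matrix (G c) ** matrix ?K ** matrix ?J = matrix (G c \<circ> (?K \<circ> ?J))"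
    by (simp add: matrix_compose J K linG[OF c] linear_compose matrix_mul_assoc)
  also have "?K \<circ> ?J = id"
    using base.jac_jac[OF c c0 c] base.jac_self[OF c] by (simp add: fun_eq_iff)
  finally have "trace (matrix (G c0)) = trace (matrix (G c))" by simp
  then show ?thesis
    unfolding endo_trace_def Let_def c0_def[symmetric] the G_def[symmetric]
    by (simp add: trace_def matrix_def G_def)
qed

end

context pi_connection
begin

lemma smooth_fun_vec_deriv:
  "vector_field S V \<Longrightarrow> smooth_fun S f \<Longrightarrow> smooth_fun S (\<lambda>u. vec_deriv S u (V u) f)"
  unfolding smooth_fun_slit_iff by (intro ballI slit.smooth_germ_vec_deriv) auto

lemma field_tangent: "vector_field S V \<Longrightarrow> u \<in> \<T> \<Longrightarrow> V u \<in> tangent_space S u"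
  using slit.vector_field_tangent by simp

lemma curvature_pi:
  assumes V: "vector_field S V" and W: "vector_field S W" and Z: "pi_vector_field M Z"
  shows "pi_vector_field M (curvature M D V W Z)"
  unfolding curvature_def[abs_def]
  by (intro pi_add pi_sub D_smooth slit.lie_bracket_vector_field V W Z)

context
  fixes V W
  assumes V: "vector_field S V" and W: "vector_field S W"
begin

lemma bracket_tangent: "lie_bracket S V W u \<in> tangent_space S u"
  by (rule slit.lie_bracket_tangent[OF V W])

lemma curvature_add_section:
  assumes X: "pi_vector_field M X" and Y: "pi_vector_field M Y" and u: "u \<in> \<T>"
  shows "curvature M D V W (\<lambda>u. X u +\<^sub>v Y u) u = curvature M D V W X u +\<^sub>v curvature M D V W Y u"
proof -
  have *: "D u (W u) (\<lambda>u. D u (V u) (\<lambda>u. X u +\<^sub>v Y u)) = D u (W u) (\<lambda>u. D u (V u) X) +\<^sub>v D u (W u) (\<lambda>u. D u (V u) Y)"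
    if V: "vector_field S V" and W: "vector_field S W" for V W
  proof -
    have "D u (W u) (\<lambda>u. D u (V u) (\<lambda>u. X u +\<^sub>v Y u)) = D u (W u) (\<lambda>u. D u (V u) X +\<^sub>v D u (V u) Y)"
      by (rule D_cong[OF u field_tangent[OF W u]])
         (auto intro!: D_smooth pi_add D_add V W X Y field_tangent)
    then show ?thesis using D_add[OF u field_tangent[OF W u] D_smooth[OF V X] D_smooth[OF V Y]] by simp
  qed
  show ?thesis unfolding curvature_def *[OF V W] *[OF W V] D_add[OF u bracket_tangent X Y]
    by (simp add: tvec_simps fun_eq_iff algebra_simps)
qed

text \<open>The first-order terms in \<open>f\<close> cancel between the two mixed second derivatives. The second-order
  terms add up to \<open>W (V f) - V (W f)\<close>, which the bracket term compensates.\<close>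

lemma curvature_scale_section:
  assumes X: "pi_vector_field M X" and f: "smooth_fun S f" and u: "u \<in> \<T>"
  shows "curvature M D V W (\<lambda>u. f u *\<^sub>v X u) u = f u *\<^sub>v curvature M D V W X u"
proof -
  have *: "D u (W u) (\<lambda>u. D u (V u) (\<lambda>u. f u *\<^sub>v X u)) =
      vec_deriv S u (W u) (\<lambda>u. vec_deriv S u (V u) f) *\<^sub>v X u +\<^sub>v vec_deriv S u (V u) f *\<^sub>v D u (W u) X +\<^sub>v
      (vec_deriv S u (W u) f *\<^sub>v D u (V u) X +\<^sub>v f u *\<^sub>v D u (W u) (\<lambda>u. D u (V u) X))"
    if V: "vector_field S V" and W: "vector_field S W" for V W
  proof -
    note Vf = smooth_fun_vec_deriv[OF V f] and DX = D_smooth[OF V X] and Wu = field_tangent[OF W u]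
    have "D u (W u) (\<lambda>u. D u (V u) (\<lambda>u. f u *\<^sub>v X u)) =
        D u (W u) (\<lambda>u. vec_deriv S u (V u) f *\<^sub>v X u +\<^sub>v f u *\<^sub>v D u (V u) X)"
      by (rule D_cong[OF u Wu])
         (auto intro!: D_smooth pi_add pi_scale D_scale V X f Vf field_tangent)
    then show ?thesis
      using D_add[OF u Wu pi_scale[OF X Vf] pi_scale[OF DX f]] D_scale[OF u Wu Vf X] D_scale[OF u Wu f DX] by simp
  qed
  have "vec_deriv S u (lie_bracket S V W u) f =
     vec_deriv S u (V u) (\<lambda>u. vec_deriv S u (W u) f) - vec_deriv S u (W u) (\<lambda>u. vec_deriv S u (V u) f)"
    by (rule slit.commutator_deriv[OF V W]) (use u f in \<open>simp_all add: smooth_fun_slit_iff\<close>)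
  note comm = this
  show ?thesis unfolding curvature_def *[OF V W] *[OF W V] D_scale[OF u bracket_tangent f X] comm
    by (simp add: tvec_simps fun_eq_iff algebra_simps)
qed

lemma curvature_cong_section:
  assumes X: "pi_vector_field M X" and Y: "pi_vector_field M Y" and u: "u \<in> \<T>"
    and eq: "\<And>u. u \<in> \<T> \<Longrightarrow> X u = Y u"
  shows "curvature M D V W X u = curvature M D V W Y u"
proof -
  have *: "D u (V u) X = D u (V u) Y" if "u \<in> \<T>" "vector_field S V" for u V
    by (rule D_cong[OF that(1) field_tangent[OF that(2,1)] X Y]) (rule eq)
  have **: "D u (W u) (\<lambda>u. D u (V u) X) = D u (W u) (\<lambda>u. D u (V u) Y)"
    if V: "vector_field S V" and W: "vector_field S W" for V W
    by (rule D_cong[OF u field_tangent[OF W u]]) (auto intro: D_smooth V X Y *)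
  have 3: "D u (lie_bracket S V W u) X = D u (lie_bracket S V W u) Y"
    by (rule D_cong[OF u bracket_tangent X Y]) (rule eq)
  show ?thesis unfolding curvature_def **[OF V W] **[OF W V] 3 ..
qed

text \<open>The bracket contributes \<open>(V f) W\<close>, which compensates the derivative of \<open>f\<close> in \<open>D\<^sub>V (f D\<^sub>W X)\<close>.\<close>

lemma curvature_scale_right:
  assumes X: "pi_vector_field M X" and f: "smooth_fun S f" and u: "u \<in> \<T>"
  shows "curvature M D V (\<lambda>u. f u *\<^sub>v W u) X u = f u *\<^sub>v curvature M D V W X u"
proof -
  note Vu = field_tangent[OF V u] and Wu = field_tangent[OF W u]
  note DV = D_smooth[OF V X] and DW = D_smooth[OF W X]
  have 1: "D u (V u) (\<lambda>u. D u (f u *\<^sub>v W u) X) = vec_deriv S u (V u) f *\<^sub>v D u (W u) X +\<^sub>v f u *\<^sub>v D u (V u) (\<lambda>u. D u (W u) X)"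
  proof -
    have "D u (V u) (\<lambda>u. D u (f u *\<^sub>v W u) X) = D u (V u) (\<lambda>u. f u *\<^sub>v D u (W u) X)"
      by (rule D_cong[OF u Vu])
         (auto intro!: D_smooth[OF slit.vector_field_scale[OF W f] X] pi_scale DW f D_scale_vec X field_tangent[OF W])
    then show ?thesis using D_scale[OF u Vu f DW] by simp
  qed
  have 2: "lie_bracket S V (\<lambda>u. f u *\<^sub>v W u) u = vec_deriv S u (V u) f *\<^sub>v W u +\<^sub>v f u *\<^sub>v lie_bracket S V W u"
    by (rule slit.lie_bracket_scale_right[OF V W f]) (use u in simp)
  show ?thesis unfolding curvature_def 1 2 D_scale_vec[OF u Wu DV] D_linear_vec[OF u Wu bracket_tangent X]
    by (simp add: tvec_simps fun_eq_iff algebra_simps)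
qed

lemma curvature_add_right:
  assumes X: "pi_vector_field M X" and W': "vector_field S W'" and u: "u \<in> \<T>"
  shows "curvature M D V (\<lambda>u. W u +\<^sub>v W' u) X u = curvature M D V W X u +\<^sub>v curvature M D V W' X u"
proof -
  note Vu = field_tangent[OF V u] and Wu = field_tangent[OF W u] field_tangent[OF W' u]
  note DV = D_smooth[OF V X] and DW = D_smooth[OF W X] D_smooth[OF W' X]
  have 1: "D u (V u) (\<lambda>u. D u (W u +\<^sub>v W' u) X) = D u (V u) (\<lambda>u. D u (W u) X) +\<^sub>v D u (V u) (\<lambda>u. D u (W' u) X)"
  proof -
    have "D u (V u) (\<lambda>u. D u (W u +\<^sub>v W' u) X) = D u (V u) (\<lambda>u. D u (W u) X +\<^sub>v D u (W' u) X)"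
      by (rule D_cong[OF u Vu])
         (auto intro!: D_smooth[OF slit.vector_field_add[OF W W'] X] pi_add DW D_add_vec X field_tangent[OF W] field_tangent[OF W'])
    then show ?thesis using D_add[OF u Vu DW] by simp
  qed
  have 2: "lie_bracket S V (\<lambda>u. W u +\<^sub>v W' u) u = lie_bracket S V W u +\<^sub>v lie_bracket S V W' u"
    by (rule slit.lie_bracket_add_right[OF V W W']) (use u in simp)
  show ?thesis unfolding curvature_def 1 2 D_add_vec[OF u Wu DV]
      D_add_vec[OF u bracket_tangent slit.lie_bracket_tangent[OF V W'] X]
    by (simp add: tvec_simps fun_eq_iff algebra_simps)
qed

lemma curvature_cong_right:
  assumes X: "pi_vector_field M X" and W': "vector_field S W'" and u: "u \<in> \<T>"
    and eq: "\<And>u. u \<in> \<T> \<Longrightarrow> W u = W' u"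
  shows "curvature M D V W X u = curvature M D V W' X u"
proof -
  have 1: "D u (V u) (\<lambda>u. D u (W u) X) = D u (V u) (\<lambda>u. D u (W' u) X)"
    by (rule D_cong[OF u field_tangent[OF V u] D_smooth[OF W X] D_smooth[OF W' X]]) (simp add: eq)
  have 2: "lie_bracket S V W u = lie_bracket S V W' u"
    by (rule slit.lie_bracket_cong_right) (simp add: eq)
  show ?thesis unfolding curvature_def 1 2 eq[OF u] ..
qed

end

end

section \<open>The horizontal Ricci tensor\<close>

context regular_pi_connection
begin

abbreviation "R \<equiv> h_curvature M D"

abbreviation "Ric \<equiv> h_ricci M D"

lemma \<beta>_add:
  "u \<in> \<T> \<Longrightarrow> v \<in> tangent_space M (fst u) \<Longrightarrow> w \<in> tangent_space M (fst u) \<Longrightarrow>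
   \<beta> u (v +\<^sub>v w) = \<beta> u v +\<^sub>v \<beta> u w"
  using \<beta>_linear[of u v w 1 1] by (simp add: tvec_simps)

lemma \<beta>_scale:
  "u \<in> \<T> \<Longrightarrow> v \<in> tangent_space M (fst u) \<Longrightarrow> \<beta> u (a *\<^sub>v v) = a *\<^sub>v \<beta> u v"
  using \<beta>_linear[of u v v a 0] by (simp add: tvec_simps)

lemma R_pi: "pi_vector_field M X \<Longrightarrow> pi_vector_field M Y \<Longrightarrow> pi_vector_field M Z \<Longrightarrow> pi_vector_field M (R X Y Z)"
  unfolding h_curvature_def by (intro curvature_pi \<beta>_vector_field)

lemma h_nabla_pi: "pi_vector_field M W \<Longrightarrow> pi_vector_field M X \<Longrightarrow> pi_vector_field M (h_nabla M D W X)"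
  unfolding h_nabla_def[abs_def] by (intro D_smooth \<beta>_vector_field)

context
  fixes X
  assumes X: "pi_vector_field M X"
begin

text \<open>The trace in the Ricci tensor is taken over the middle argument, which is why tensoriality in this
  argument matters.\<close>

lemma R_middle_expansion:
  assumes Y: "pi_vector_field M Y" and Z: "pi_vector_field M Z" and u: "u \<in> \<T>"
    and c: "c \<in> M" and f: "cutoff c (fst u) f"
  shows "R X Y Z u d = (\<Sum>i\<in>UNIV. (Y u c $ i) *\<^sub>R R X (frame c f i) Z u d)"
proof (rule tensor_expansion[of "\<lambda>Y. R X Y Z u d" u c f Y, OF _ _ _ c f Y u])
  note bX = \<beta>_vector_field[OF X]
  fix Y assume Y: "pi_vector_field M Y"
  note bY = \<beta>_vector_field[OF Y]
  {
    fix f assume f: "smooth_fun S f"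
    have "curvature M D (\<lambda>u. \<beta> u (X u)) (\<lambda>u. \<beta> u (f u *\<^sub>v Y u)) Z u =
      curvature M D (\<lambda>u. \<beta> u (X u)) (\<lambda>u. f u *\<^sub>v \<beta> u (Y u)) Z u"
      by (rule curvature_cong_right[OF bX \<beta>_vector_field[OF pi_scale[OF Y f]] Z slit.vector_field_scale[OF bY f] u])
         (simp add: \<beta>_scale pi_tangent[OF Y])
    then show "R X (\<lambda>u. f u *\<^sub>v Y u) Z u d = f u *\<^sub>R R X Y Z u d"
      unfolding h_curvature_def curvature_scale_right[OF bX bY Z f u] by (simp add: vscale_def)
  }
  fix Y' assume Y': "pi_vector_field M Y'"
  note bY' = \<beta>_vector_field[OF Y']
  have "curvature M D (\<lambda>u. \<beta> u (X u)) (\<lambda>u. \<beta> u (Y u +\<^sub>v Y' u)) Z u =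
      curvature M D (\<lambda>u. \<beta> u (X u)) (\<lambda>u. \<beta> u (Y u) +\<^sub>v \<beta> u (Y' u)) Z u"
    by (rule curvature_cong_right[OF bX \<beta>_vector_field[OF pi_add[OF Y Y']] Z slit.vector_field_add[OF bY bY'] u])
       (simp add: \<beta>_add pi_tangent[OF Y] pi_tangent[OF Y'])
  then show "R X (\<lambda>u. Y u +\<^sub>v Y' u) Z u d = R X Y Z u d + R X Y' Z u d"
    unfolding h_curvature_def curvature_add_right[OF bX bY Z bY' u] by (simp add: vadd_def)
  assume eq: "\<forall>u\<in>\<T>. Y u = Y' u"
  show "R X Y Z u d = R X Y' Z u d"
    unfolding h_curvature_def by (subst curvature_cong_right[OF bX bY Z bY' u]) (use eq in auto)
qed

lemma R_middle_pointwise: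
  assumes "pi_vector_field M Y" "pi_vector_field M Y'" "pi_vector_field M Z" "u \<in> \<T>" "Y u = Y' u"
  shows "R X Y Z u = R X Y' Z u"
proof
  fix d
  obtain c where c: "c \<in> M" "fst u \<in> fst c" by (rule base_chart_exists)
  obtain f where f: "cutoff c (fst u) f" by (rule cutoff_exists[OF c])
  show "R X Y Z u d = R X Y' Z u d"
    using R_middle_expansion[OF assms(1,3,4) c(1) f] R_middle_expansion[OF assms(2,3,4) c(1) f] assms(5) by simp
qed

text \<open>By tensoriality it does not matter which section through \<open>Z u\<close> is selected.\<close>

lemma fibre_map_R:
  assumes Y: "pi_vector_field M Y" and Z: "pi_vector_field M Z" and u: "u \<in> \<T>"
  shows "fibre_map M (\<lambda>Z. R X Z Y) u (Z u) = R X Z Y u"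
proof -
  let ?Z = "SOME Z'. pi_vector_field M Z' \<and> Z' u = Z u"
  have "pi_vector_field M ?Z \<and> ?Z u = Z u" by (rule someI[of _ Z]) (simp add: Z)
  then show ?thesis unfolding fibre_map_def using R_middle_pointwise[OF _ Z Y u] by blast
qed

text \<open>The point \<open>u\<close> may be anywhere in the region where the cutoff is \<open>1\<close>, so that the formula can be
  differentiated.\<close>

lemma ricci_chart:
  assumes Y: "pi_vector_field M Y" and u: "u \<in> \<T>" and c: "c \<in> M" "fst u \<in> fst c"
    and f: "cutoff c p f" "f (fst u) = 1"
  shows "Ric X Y u = (\<Sum>i\<in>UNIV. R X (frame c f i) Y u c $ i)"
proof -
  let ?F = "fibre_map M (\<lambda>Z. R X Z Y) u"
  have "endo_trace M (fst u) ?F = (\<Sum>i\<in>UNIV. ?F (tvec_of M c (fst u) (axis i 1)) c $ i)"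
  proof (rule endo_trace_chart[OF _ _ c])
    fix v assume v: "v \<in> tangent_space M (fst u)"
    obtain Z where Z: "pi_vector_field M Z" "Z u = v" by (rule pi_field_through[OF u v])
    show "?F v \<in> tangent_space M (fst u)"
      using fibre_map_R[OF Y Z(1) u] pi_tangent[OF R_pi[OF X Z(1) Y] u] Z(2) by simp
  next
    fix v w a b assume vw: "v \<in> tangent_space M (fst u)" "w \<in> tangent_space M (fst u)"
    obtain Z where Z1: "pi_vector_field M Z" "Z u = v" by (rule pi_field_through[OF u vw(1)])
    obtain Z' where Z': "pi_vector_field M Z'" "Z' u = w" by (rule pi_field_through[OF u vw(2)])
    note Z = Z1 Z'
    let ?Z = "\<lambda>u. a *\<^sub>v Z u +\<^sub>v b *\<^sub>v Z' u"
    have Z2: "pi_vector_field M ?Z" by (intro pi_add pi_scale Z smooth_fun_const)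
    obtain h where h: "cutoff c (fst u) h" by (rule cutoff_exists[OF c])
    have "R X ?Z Y u d = a *\<^sub>R R X Z Y u d + b *\<^sub>R R X Z' Y u d" for d
      unfolding R_middle_expansion[OF Z2 Y u c(1) h] R_middle_expansion[OF Z(1) Y u c(1) h]
        R_middle_expansion[OF Z(3) Y u c(1) h]
      by (simp add: tvec_simps algebra_simps sum.distrib scaleR_sum_right)
    then have "R X ?Z Y u = a *\<^sub>v R X Z Y u +\<^sub>v b *\<^sub>v R X Z' Y u" by (simp add: tvec_simps fun_eq_iff)
    then show "?F (a *\<^sub>v v +\<^sub>v b *\<^sub>v w) = a *\<^sub>v ?F v +\<^sub>v b *\<^sub>v ?F w"
      using fibre_map_R[OF Y Z2 u] fibre_map_R[OF Y Z(1) u] fibre_map_R[OF Y Z(3) u] Z by simp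
  qed
  moreover have "tvec_of M c (fst u) (axis i 1) = frame c f i u" for i
    by (simp add: frame_def f vscale_def)
  ultimately show ?thesis
    unfolding h_ricci_def using fibre_map_R[OF Y frame_pi[OF c(1) f(1)] u] by simp
qed

lemma ricci_chart_near:
  assumes Y: "pi_vector_field M Y" and u: "u \<in> \<T>" and c: "c \<in> M" "fst u \<in> fst c"
    and f: "cutoff c (fst u) f"
  shows "\<forall>\<^sub>F w in point_nhds S u. (\<Sum>i\<in>UNIV. R X (frame c f i) Y w c $ i) = Ric X Y w"
  using eventually_slit[OF u] eventually_cutoff[OF c(1) f u refl] eventually_pullback[OF u base.eventually_in_chart[OF c]]
  by eventually_elim (simp add: ricci_chart[OF Y _ c(1) _ f])

lemma ricci_smooth:
  assumes Y: "pi_vector_field M Y" shows "smooth_fun S (Ric X Y)"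
  unfolding smooth_fun_slit_iff
proof
  fix u assume u: "u \<in> \<T>"
  obtain c where c: "c \<in> M" "fst u \<in> fst c" by (rule base_chart_exists)
  obtain f where f: "cutoff c (fst u) f" by (rule cutoff_exists[OF c])
  have "smooth_germ S (\<lambda>w. \<Sum>i\<in>UNIV. R X (frame c f i) Y w c $ i) u"
    by (intro slit.smooth_germ_sum slit.smooth_germ_linear[OF bounded_linear_vec_nth]
        pi_smooth[OF R_pi[OF X frame_pi[OF c(1) f] Y] c(1) u c(2)])
  then show "smooth_germ S (Ric X Y) u"
    by (rule slit.smooth_germ_cong[rotated]) (use ricci_chart_near[OF Y u c f] u in auto)
qed

lemma ricci_expansion:
  assumes Y: "pi_vector_field M Y" and u: "u \<in> \<T>"
    and c: "c \<in> M" "fst u \<in> fst c" and f: "cutoff c (fst u) f"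
  shows "Ric X Y u = (\<Sum>i\<in>UNIV. (Y u c $ i) * Ric X (frame c f i) u)"
proof -
  note bX = \<beta>_vector_field[OF X]
  note rc = ricci_chart[OF _ u c f cutoff_center[OF c(1) f]]
  have "Ric X Y u = (\<Sum>i\<in>UNIV. (Y u c $ i) *\<^sub>R Ric X (frame c f i) u)"
  proof (rule tensor_expansion[of "\<lambda>Y. Ric X Y u" u c f Y, OF _ _ _ c(1) f Y u])
    fix Y assume Y: "pi_vector_field M Y"
    show "Ric X (\<lambda>u. g u *\<^sub>v Y u) u = g u *\<^sub>R Ric X Y u" if g: "smooth_fun S g" for g
      unfolding rc[OF Y] rc[OF pi_scale[OF Y g]] h_curvature_def
        curvature_scale_section[OF bX \<beta>_vector_field[OF frame_pi[OF c(1) f]] Y g u]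
      by (simp add: vscale_def sum_distrib_left)
    fix Y' assume Y': "pi_vector_field M Y'"
    show "Ric X (\<lambda>u. Y u +\<^sub>v Y' u) u = Ric X Y u + Ric X Y' u"
      unfolding rc[OF Y] rc[OF Y'] rc[OF pi_add[OF Y Y']] h_curvature_def
        curvature_add_section[OF bX \<beta>_vector_field[OF frame_pi[OF c(1) f]] Y Y' u]
      by (simp add: vadd_def sum.distrib)
    assume eq: "\<forall>u\<in>\<T>. Y u = Y' u"
    have "R X (frame c f i) Y u = R X (frame c f i) Y' u" for i
      unfolding h_curvature_def
      by (rule curvature_cong_section[OF bX \<beta>_vector_field[OF frame_pi[OF c(1) f]] Y Y' u]) (use eq in auto)
    then show "Ric X Y u = Ric X Y' u" unfolding rc[OF Y] rc[OF Y'] by simp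
  qed
  then show ?thesis by simp
qed

end

text \<open>Differentiate the trace \<open>R X E\<^sub>i Y\<close> over the coordinate frame. The recurrence of \<open>R\<close> turns this
  into the expected terms, up to two sums with the connection coefficients: one comes from
  differentiating the frame in the middle argument and one from passing to components of the
  covariant derivative.
  They are the same double sum and cancel, i.e. the trace commutes with covariant derivatives.\<close>

lemma ricci_recurrence:
  assumes A: "recurrent_tensor M D A R" and W: "pi_vector_field M W" and X: "pi_vector_field M X"
    and Y: "pi_vector_field M Y" and u: "u \<in> \<T>"
  shows "vec_deriv S u (\<beta> u (W u)) (Ric X Y) =
    A u (W u) * Ric X Y u + Ric (h_nabla M D W X) Y u + Ric X (h_nabla M D W Y) u"
proof -
  obtain c where c: "c \<in> M" "fst u \<in> fst c" by (rule base_chart_exists)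
  obtain f where f: "cutoff c (fst u) f" by (rule cutoff_exists[OF c])
  define v where "v = \<beta> u (W u)"
  have v: "v \<in> tangent_space S u" unfolding v_def by (rule \<beta>_tangent[OF u pi_tangent[OF W u]])
  define E where "E = frame c f"
  have E: "pi_vector_field M (E i)" for i unfolding E_def by (rule frame_pi[OF c(1) f])
  note nX = h_nabla_pi[OF W X] and nY = h_nabla_pi[OF W Y] and nE = h_nabla_pi[OF W E]
  note rc = ricci_chart[OF _ _ u c f cutoff_center[OF c(1) f], folded E_def]
  define \<Gamma> where "\<Gamma> j i = D u v (E j) c $ i" for j i
  have RE: "D u v (R X (E i) Y) = A u (W u) *\<^sub>v R X (E i) Y u +\<^sub>v R (h_nabla M D W X) (E i) Y u
     +\<^sub>v R X (h_nabla M D W (E i)) Y u +\<^sub>v R X (E i) (h_nabla M D W Y) u" for i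
  proof -
    have "h_nabla_tensor M D R W X (E i) Y u = A u (W u) *\<^sub>v R X (E i) Y u"
      using A W X Y E[of i] u unfolding recurrent_tensor_def by blast
    then show ?thesis
      unfolding h_nabla_tensor_def h_nabla_def[of M D W "R X (E i) Y"] v_def[symmetric]
      by (simp add: tvec_simps fun_eq_iff algebra_simps)
  qed
  have RG: "R X (h_nabla M D W (E i)) Y u c = (\<Sum>j\<in>UNIV. \<Gamma> i j *\<^sub>R R X (E j) Y u c)" for i
    using R_middle_expansion[OF X nE[of i] Y u c(1) f, of c] by (simp add: E_def[symmetric] \<Gamma>_def h_nabla_def v_def)
  have "vec_deriv S u v (Ric X Y) = vec_deriv S u v (\<lambda>w. \<Sum>i\<in>UNIV. R X (E i) Y w c $ i)"
    by (rule slit.vec_deriv_cong)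
       (use u ricci_chart_near[OF X Y u c f] in \<open>auto simp: E_def elim!: eventually_mono\<close>)
  also have "\<dots> = (\<Sum>i\<in>UNIV. vec_deriv S u v (\<lambda>w. R X (E i) Y w c) $ i)"
    using pi_smooth[OF R_pi[OF X E Y] c(1) u c(2)]
    by (simp add: slit.vec_deriv_sum slit.smooth_germ_linear[OF bounded_linear_vec_nth]
        slit.vec_deriv_bounded_linear[OF bounded_linear_vec_nth])
  also have "\<dots> = (\<Sum>i\<in>UNIV. (D u v (R X (E i) Y) c - (\<Sum>j\<in>UNIV. (R X (E i) Y u c $ j) *\<^sub>R D u v (E j) c)) $ i)"
    using D_chart[OF u v R_pi[OF X E Y] c f] by (simp add: E_def[symmetric])
  also have "\<dots> = (\<Sum>i\<in>UNIV. A u (W u) * R X (E i) Y u c $ i + R (h_nabla M D W X) (E i) Y u c $ i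
      + R X (E i) (h_nabla M D W Y) u c $ i)
      + ((\<Sum>i\<in>UNIV. \<Sum>j\<in>UNIV. \<Gamma> i j * R X (E j) Y u c $ i) - (\<Sum>i\<in>UNIV. \<Sum>j\<in>UNIV. R X (E i) Y u c $ j * \<Gamma> j i))"
    unfolding RE by (simp add: tvec_simps RG \<Gamma>_def sum.distrib sum_subtractf)
  also have "(\<Sum>i\<in>UNIV. \<Sum>j\<in>UNIV. R X (E i) Y u c $ j * \<Gamma> j i) = (\<Sum>i\<in>UNIV. \<Sum>j\<in>UNIV. \<Gamma> i j * R X (E j) Y u c $ i)"
    by (subst sum.swap) (simp add: mult.commute)
  finally show ?thesis
    unfolding v_def rc[OF X Y] rc[OF nX Y] rc[OF X nY] by (simp add: sum.distrib sum_distrib_left)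
qed

end

section \<open>The Finsler metric and the Ricci operator\<close>

locale cartan_finsler = regular_pi_connection M D
  for M :: "('a::{t2_space, second_countable_topology}, real^'n::finite) chart set"
    and D :: "('a, 'n) connection" +
  fixes L :: "('a, 'n) tpoint \<Rightarrow> real"
  assumes finsler: "finsler_manifold M L"
    and metric: "metric_connection M L D"
begin

abbreviation "g \<equiv> finsler_metric L"

lemma g_positive: "u \<in> \<T> \<Longrightarrow> w \<in> tangent_space M (fst u) \<Longrightarrow> w \<noteq> vzero \<Longrightarrow> g u w w > 0"
  using finsler unfolding finsler_manifold_def by blast

definition energy_chart :: "('a, real^'n) chart \<Rightarrow> (real^'n) \<times> (real^'n) \<Rightarrow> real" where
  "energy_chart c z = (L (chart_inv (slit_chart M c) z))\<^sup>2"

lemma energy_chart_smooth: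
  assumes "c \<in> M" "u \<in> \<T>" "fst u \<in> fst c"
  shows "smooth_at (energy_chart c) (snd (slit_chart M c) u)"
proof -
  have "smooth_germ S L u"
    using finsler assms unfolding finsler_manifold_def smooth_fun_slit_iff by blast
  then have "smooth_germ S (\<lambda>u. (L u)\<^sup>2) u" unfolding power2_eq_square by (intro slit.smooth_germ_mult)
  then show ?thesis
    unfolding slit.smooth_germ_iff[OF slit_chart_atlas[OF assms(1)] slit_chartI[OF assms(2,3)]] energy_chart_def[abs_def] .
qed

text \<open>The metric is defined by iterated one-variable derivatives along lines in the fibre. In bundle
  coordinates they are directional derivatives in directions \<open>(0, v)\<close>, as long as the line avoids
  the zero vector; it does so for small parameters.\<close>

lemma g_chart:
  assumes u: "u \<in> \<T>" and c: "c \<in> M" "fst u \<in> fst c"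
    and v: "v \<in> tangent_space M (fst u)" and w: "w \<in> tangent_space M (fst u)"
  shows "g u v w = 1/2 * frechet_derivative (\<lambda>z. frechet_derivative (energy_chart c) (at z) (0, w c))
    (at (snd (slit_chart M c) u)) (0, v c)"
proof -
  define p where "p = fst u"
  define x where "x = snd c p"
  define y where "y = snd u c"
  have uT: "snd u \<in> tangent_space M p" using u by (simp add: slit_bundle_iff p_def)
  have Cu: "snd (slit_chart M c) u = (x, y)" by (simp add: slit_chart_simps x_def y_def p_def)
  have slit': "(p, a) \<in> \<T> \<and> chart_inv (slit_chart M c) (x, a c) = (p, a)"
    if "a \<in> tangent_space M p" "a c \<noteq> 0" for a
  proof -
    have "(p, a) \<in> \<T>" using that by (auto simp: slit_bundle_iff vzero_def)
    then show ?thesis using slit_chart_inv_Pair[OF c(1)] c(2) by (simp add: x_def p_def)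
  qed
  have T: "snd u +\<^sub>v s *\<^sub>v v +\<^sub>v t *\<^sub>v w \<in> tangent_space M p" for s t
    using uT v w unfolding p_def by (intro base.vadd_tangent base.vscale_tangent)
  have inner: "deriv (\<lambda>t. (L (p, snd u +\<^sub>v s *\<^sub>v v +\<^sub>v t *\<^sub>v w))\<^sup>2) 0 =
      frechet_derivative (energy_chart c) (at ((x, y) + s *\<^sub>R (0, v c))) (0, w c)" if ne: "y + s *\<^sub>R v c \<noteq> 0" for s
  proof -
    have "((\<lambda>t. y + s *\<^sub>R v c + t *\<^sub>R w c) \<longlongrightarrow> y + s *\<^sub>R v c + 0 *\<^sub>R w c) (nhds 0)"
      by (intro tendsto_intros filterlim_ident)
    then have "\<forall>\<^sub>F t in nhds 0. y + s *\<^sub>R v c + t *\<^sub>R w c \<noteq> 0"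
      using ne by (intro tendsto_imp_eventually_ne) auto
    then have ev: "\<forall>\<^sub>F t in nhds 0. (L (p, snd u +\<^sub>v s *\<^sub>v v +\<^sub>v t *\<^sub>v w))\<^sup>2 =
        energy_chart c ((x, y) + s *\<^sub>R (0, v c) + t *\<^sub>R (0, w c))"
    proof eventually_elim
      case (elim t)
      then show ?case using slit'[OF T, of s t] by (simp add: energy_chart_def tvec_simps y_def)
    qed
    have "smooth_at (energy_chart c) ((x, y) + s *\<^sub>R (0, v c) + 0 *\<^sub>R (0, w c))"
    proof -
      have "(p, snd u +\<^sub>v s *\<^sub>v v +\<^sub>v 0 *\<^sub>v w) \<in> \<T>"
        using slit'[OF T, of s 0] ne by (simp add: tvec_simps y_def)
      from energy_chart_smooth[OF c(1) this] c(2) show ?thesis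
        by (simp add: slit_chart_simps p_def x_def y_def tvec_simps)
    qed
    from smooth_at_has_real_derivative_line[OF this]
    have "deriv (\<lambda>t. energy_chart c ((x, y) + s *\<^sub>R (0, v c) + t *\<^sub>R (0, w c))) 0 =
        frechet_derivative (energy_chart c) (at ((x, y) + s *\<^sub>R (0, v c))) (0, w c)"
      using DERIV_imp_deriv by fastforce
    then show ?thesis using deriv_cong_ev[OF ev refl] by simp
  qed
  have "((\<lambda>s. y + s *\<^sub>R v c) \<longlongrightarrow> y + 0 *\<^sub>R v c) (nhds 0)"
    by (intro tendsto_intros filterlim_ident)
  then have "\<forall>\<^sub>F s in nhds 0. y + s *\<^sub>R v c \<noteq> 0"
    using slit_component_nonzero[OF u c] by (intro tendsto_imp_eventually_ne) (auto simp: y_def)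
  then have ev: "\<forall>\<^sub>F s in nhds 0. deriv (\<lambda>t. (L (p, snd u +\<^sub>v s *\<^sub>v v +\<^sub>v t *\<^sub>v w))\<^sup>2) 0 =
      frechet_derivative (energy_chart c) (at ((x, y) + s *\<^sub>R (0, v c))) (0, w c)"
    by eventually_elim (rule inner)
  have "smooth_at (\<lambda>z. frechet_derivative (energy_chart c) (at z) (0, w c)) ((x, y) + 0 *\<^sub>R (0, v c))"
    using smooth_at_frechet_derivative[OF energy_chart_smooth[OF c(1) u c(2)] smooth_at_const] by (simp add: Cu)
  from DERIV_imp_deriv[OF smooth_at_has_real_derivative_line[OF this]]
  show ?thesis unfolding finsler_metric_def p_def[symmetric] deriv_cong_ev[OF ev refl] Cu by simp
qed

lemma
  assumes u: "u \<in> \<T>"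
    and v: "v \<in> tangent_space M (fst u)" "v' \<in> tangent_space M (fst u)" and w: "w \<in> tangent_space M (fst u)"
  shows g_linear_left: "g u (a *\<^sub>v v +\<^sub>v b *\<^sub>v v') w = a * g u v w + b * g u v' w"
    and g_linear_right: "g u w (a *\<^sub>v v +\<^sub>v b *\<^sub>v v') = a * g u w v + b * g u w v'"
proof -
  obtain c where c: "c \<in> M" "fst u \<in> fst c" by (rule base_chart_exists)
  let ?z = "snd (slit_chart M c) u" and ?D = "\<lambda>e z. frechet_derivative (energy_chart c) (at z) e"
  note s = energy_chart_smooth[OF c(1) u c(2)]
  have sD: "smooth_at (?D e) ?z" for e by (rule smooth_at_frechet_derivative[OF s smooth_at_const])
  have vv: "a *\<^sub>v v +\<^sub>v b *\<^sub>v v' \<in> tangent_space M (fst u)"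
    by (intro base.vadd_tangent base.vscale_tangent v)
  have e: "(0, (a *\<^sub>v v +\<^sub>v b *\<^sub>v v') c) = a *\<^sub>R (0::real^'n, v c) + b *\<^sub>R (0, v' c)" by (simp add: tvec_simps)
  have lin: "linear (frechet_derivative h (at z))" if "smooth_at h z" for h :: "(real^'n) \<times> (real^'n) \<Rightarrow> real" and z
    using that smooth_at_has_derivative has_derivative_linear by blast
  show "g u (a *\<^sub>v v +\<^sub>v b *\<^sub>v v') w = a * g u v w + b * g u v' w"
    unfolding g_chart[OF u c vv w] g_chart[OF u c v(1) w] g_chart[OF u c v(2) w] e
    by (simp add: linear_add[OF lin[OF sD]] linear_scale[OF lin[OF sD]] algebra_simps del: scaleR_Pair add_Pair)
  have "\<forall>\<^sub>F z in nhds ?z. ?D (a *\<^sub>R (0, v c) + b *\<^sub>R (0, v' c)) z = a * ?D (0, v c) z + b * ?D (0, v' c) z"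
    using eventually_smooth_at[OF s]
    by eventually_elim (simp add: linear_add[OF lin] linear_scale[OF lin] del: scaleR_Pair add_Pair)
  then have "frechet_derivative (?D (a *\<^sub>R (0, v c) + b *\<^sub>R (0, v' c))) (at ?z) =
     frechet_derivative (\<lambda>z. a * ?D (0, v c) z + b * ?D (0, v' c) z) (at ?z)"
    by (rule frechet_derivative_cong)
  also have "\<dots> = (\<lambda>h. a * frechet_derivative (?D (0, v c)) (at ?z) h + b * frechet_derivative (?D (0, v' c)) (at ?z) h)"
    by (rule frechet_derivative_at[symmetric])
       (intro has_derivative_add has_derivative_mult_right smooth_at_has_derivative sD)
  finally show "g u w (a *\<^sub>v v +\<^sub>v b *\<^sub>v v') = a * g u w v + b * g u w v'"
    unfolding g_chart[OF u c w vv] g_chart[OF u c w v(1)] g_chart[OF u c w v(2)] e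
    by (simp add: algebra_simps del: scaleR_Pair add_Pair)
qed

lemma g_expand_right:
  assumes u: "u \<in> \<T>" and c: "c \<in> M" "fst u \<in> fst c"
    and v: "v \<in> tangent_space M (fst u)" and w: "w \<in> tangent_space M (fst u)"
  shows "g u v w = (\<Sum>j\<in>UNIV. (w c $ j) * g u v (tvec_of M c (fst u) (axis j 1)))"
proof -
  note t = base.tvec_of_tangent[OF c]
  have *: "g u v (tvec_of M c (fst u) (a *\<^sub>R e + b *\<^sub>R e')) =
      a * g u v (tvec_of M c (fst u) e) + b * g u v (tvec_of M c (fst u) e')" for a b e e'
    unfolding base.tvec_of_linear[OF c] by (rule g_linear_right[OF u t t v])
  have "linear (\<lambda>e. g u v (tvec_of M c (fst u) e))"
    using *[of 1 _ 1] *[of _ _ 0] by (intro linearI) auto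
  from linear_axis_expansion[OF this, of "w c"] show ?thesis
    by (simp add: base.tvec_of_component_eq[OF w c])
qed

lemma g_expand_left:
  assumes u: "u \<in> \<T>" and c: "c \<in> M" "fst u \<in> fst c"
    and v: "v \<in> tangent_space M (fst u)" and w: "w \<in> tangent_space M (fst u)"
  shows "g u v w = (\<Sum>i\<in>UNIV. (v c $ i) * g u (tvec_of M c (fst u) (axis i 1)) w)"
proof -
  note t = base.tvec_of_tangent[OF c]
  have *: "g u (tvec_of M c (fst u) (a *\<^sub>R e + b *\<^sub>R e')) w =
      a * g u (tvec_of M c (fst u) e) w + b * g u (tvec_of M c (fst u) e') w" for a b e e'
    unfolding base.tvec_of_linear[OF c] by (rule g_linear_left[OF u t t w])
  have "linear (\<lambda>e. g u (tvec_of M c (fst u) e) w)"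
    using *[of 1 _ 1] *[of _ _ 0] by (intro linearI) auto
  from linear_axis_expansion[OF this, of "v c"] show ?thesis
    by (simp add: base.tvec_of_component_eq[OF v c])
qed

lemma g_coordinates_smooth:
  assumes u: "u \<in> \<T>" and c: "c \<in> M" "fst u \<in> fst c"
  shows "smooth_germ S (\<lambda>u. g u (tvec_of M c (fst u) e) (tvec_of M c (fst u) e')) u"
proof -
  note C = slit_chart_atlas[OF c(1)] slit_chartI[OF u c(2)]
  have up: "u \<in> points S" using u by simp
  have "smooth_germ S (\<lambda>u. 1/2 * frechet_derivative (\<lambda>z. frechet_derivative (energy_chart c) (at z) (0, e'))
    (at (snd (slit_chart M c) u)) (0, e)) u"
    by (intro slit.smooth_germ_mult slit.smooth_germ_const slit.smooth_germ_frechet_derivative[OF up slit.smooth_germ_chart[OF C]]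
        smooth_at_frechet_derivative[OF energy_chart_smooth[OF c(1) u c(2)] smooth_at_const])
  then show ?thesis
  proof (rule slit.smooth_germ_cong[OF up])
    show "\<forall>\<^sub>F u in point_nhds S u. 1/2 * frechet_derivative (\<lambda>z. frechet_derivative (energy_chart c) (at z) (0, e'))
        (at (snd (slit_chart M c) u)) (0, e) = g u (tvec_of M c (fst u) e) (tvec_of M c (fst u) e')"
      using slit.eventually_in_chart[OF C]
    proof eventually_elim
      case (elim u)
      then have u: "u \<in> \<T>" "fst u \<in> fst c" by (auto simp: slit_chart_simps)
      note t = base.tvec_of_tangent[OF c(1) u(2)]
      show ?case using g_chart[OF u(1) c(1) u(2) t t, of e e'] by (simp add: base.tvec_of_component[OF c(1) u(2)])
    qed
  qed
qed

lemma g_smooth: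
  assumes X: "pi_vector_field M X" and Y: "pi_vector_field M Y"
  shows "smooth_fun S (\<lambda>u. g u (X u) (Y u))"
  unfolding smooth_fun_slit_iff
proof
  fix u assume u: "u \<in> \<T>"
  obtain c where c: "c \<in> M" "fst u \<in> fst c" by (rule base_chart_exists)
  note C = slit_chart_atlas[OF c(1)] slit_chartI[OF u c(2)]
  let ?t = "\<lambda>i u. tvec_of M c (fst u) (axis i 1)"
  have "smooth_germ S (\<lambda>u. \<Sum>i\<in>UNIV. \<Sum>j\<in>UNIV. (X u c $ i) * ((Y u c $ j) * g u (?t i u) (?t j u))) u"
    by (intro slit.smooth_germ_sum slit.smooth_germ_mult g_coordinates_smooth[OF u c]
        slit.smooth_germ_linear[OF bounded_linear_vec_nth] pi_smooth[OF X c(1) u c(2)] pi_smooth[OF Y c(1) u c(2)])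
  then show "smooth_germ S (\<lambda>u. g u (X u) (Y u)) u"
  proof (rule slit.smooth_germ_cong[rotated])
    show "\<forall>\<^sub>F u in point_nhds S u. (\<Sum>i\<in>UNIV. \<Sum>j\<in>UNIV. (X u c $ i) * ((Y u c $ j) * g u (?t i u) (?t j u))) = g u (X u) (Y u)"
      using slit.eventually_in_chart[OF C]
    proof eventually_elim
      case (elim u)
      then have u: "u \<in> \<T>" "fst u \<in> fst c" by (auto simp: slit_chart_simps)
      note t = base.tvec_of_tangent[OF c(1) u(2)]
      have "g u (?t i u) (Y u) = (\<Sum>j\<in>UNIV. (Y u c $ j) * g u (?t i u) (?t j u))" for i
        by (rule g_expand_right[OF u(1) c(1) u(2) t pi_tangent[OF Y u(1)]])
      then show ?case
        using g_expand_left[OF u(1) c(1) u(2) pi_tangent[OF X u(1)] pi_tangent[OF Y u(1)]]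
        by (simp add: sum_distrib_left)
    qed
  qed (use u in simp)
qed

lemma g_compatible:
  assumes "u \<in> \<T>" "v \<in> tangent_space S u" "pi_vector_field M X" "pi_vector_field M Y"
  shows "vec_deriv S u v (\<lambda>u. g u (X u) (Y u)) = g u (D u v X) (Y u) + g u (X u) (D u v Y)"
  using metric assms unfolding metric_connection_def dir_deriv_eq_vec_deriv by blast

text \<open>Positive definiteness of the metric, in coordinates.\<close>

lemma gram_injective:
  assumes u: "u \<in> \<T>" and c: "c \<in> M" "fst u \<in> fst c"
    and w: "(\<chi> j i. g u (tvec_of M c (fst u) (axis i 1)) (tvec_of M c (fst u) (axis j 1))) *v w = 0"
  shows "w = 0"
proof (rule ccontr)
  assume "w \<noteq> 0"
  let ?w = "tvec_of M c (fst u) w" and ?t = "\<lambda>i. tvec_of M c (fst u) (axis i 1)"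
  note t = base.tvec_of_tangent[OF c] and comp = base.tvec_of_component[OF c]
  have "g u ?w (?t j) = 0" for j
    using w g_expand_left[OF u c t t, of w "axis j 1"]
    by (simp add: vec_eq_iff matrix_vector_mult_def comp mult.commute)
  then have "g u ?w ?w = 0" using g_expand_right[OF u c t t, of w w] by simp
  moreover have "?w \<noteq> vzero" using comp[of w] \<open>w \<noteq> 0\<close> by (auto simp: vzero_def)
  ultimately show False using g_positive[OF u t, of w] by simp
qed

abbreviation "Ric\<^sub>o \<equiv> ricci_op M L D"

lemma g_determines_vector:
  assumes u: "u \<in> \<T>"
    and w: "w \<in> tangent_space M (fst u)" "w' \<in> tangent_space M (fst u)"
    and eq: "\<And>Y. pi_vector_field M Y \<Longrightarrow> g u w (Y u) = g u w' (Y u)"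
  shows "w = w'"
proof -
  let ?z = "1 *\<^sub>v w +\<^sub>v (-1) *\<^sub>v w'"
  have z: "?z \<in> tangent_space M (fst u)" by (intro base.vadd_tangent base.vscale_tangent w)
  obtain Y where Y: "pi_vector_field M Y" "Y u = ?z" by (rule pi_field_through[OF u z])
  have "g u ?z ?z = 0" using g_linear_left[OF u w z, of 1 "-1"] eq[OF Y(1)] Y(2) by simp
  then have "?z = vzero" using g_positive[OF u z] by force
  then show ?thesis by (simp add: tvec_simps fun_eq_iff)
qed

text \<open>The Gram matrix is invertible, so the defining equations can be solved on the frame; tensoriality
  of the Ricci tensor extends the solution to all sections.\<close>

lemma ricci_op_exists:
  assumes X: "pi_vector_field M X" and u: "u \<in> \<T>"
  shows "\<exists>w\<in>tangent_space M (fst u). \<forall>Y. pi_vector_field M Y \<longrightarrow> g u w (Y u) = Ric X Y u"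
proof -
  obtain c where c: "c \<in> M" "fst u \<in> fst c" by (rule base_chart_exists)
  obtain f where f: "cutoff c (fst u) f" by (rule cutoff_exists[OF c])
  let ?t = "\<lambda>i. tvec_of M c (fst u) (axis i 1)"
  let ?A = "\<chi> j i. g u (?t i) (?t j)"
  note t = base.tvec_of_tangent[OF c] and comp = base.tvec_of_component[OF c]
  have "inj ((*v) ?A)" using gram_injective[OF u c] by (simp add: linear_injective_0)
  then have "surj ((*v) ?A)" by (rule linear_inj_imp_surj[OF matrix_vector_mul_linear])
  then obtain b where b: "?A *v b = (\<chi> j. Ric X (frame c f j) u)"
    using surjD[of "(*v) ?A" "\<chi> j. Ric X (frame c f j) u"] by (metis (no_types))
  let ?w = "tvec_of M c (fst u) b"
  have *: "g u ?w (?t j) = Ric X (frame c f j) u" for j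
    using b g_expand_left[OF u c t t, of b "axis j 1"]
    by (simp add: vec_eq_iff matrix_vector_mult_def comp mult.commute)
  have "g u ?w (Y u) = Ric X Y u" if Y: "pi_vector_field M Y" for Y
    using g_expand_right[OF u c t pi_tangent[OF Y u], of b] ricci_expansion[OF X Y u c f] * by simp
  then show ?thesis using t by blast
qed

lemma
  assumes X: "pi_vector_field M X" and u: "u \<in> \<T>"
  shows ricci_op_tangent: "Ric\<^sub>o X u \<in> tangent_space M (fst u)"
    and g_ricci_op: "pi_vector_field M Y \<Longrightarrow> g u (Ric\<^sub>o X u) (Y u) = Ric X Y u"
proof -
  have "\<exists>!w. w \<in> tangent_space M (fst u) \<and> (\<forall>Y. pi_vector_field M Y \<longrightarrow> g u w (Y u) = Ric X Y u)"
    using ricci_op_exists[OF X u] g_determines_vector[OF u] by (intro ex_ex1I) auto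
  from theI'[OF this]
  show "Ric\<^sub>o X u \<in> tangent_space M (fst u)" "pi_vector_field M Y \<Longrightarrow> g u (Ric\<^sub>o X u) (Y u) = Ric X Y u"
    unfolding ricci_op_def by auto
qed

lemma ricci_op_pi:
  assumes X: "pi_vector_field M X" shows "pi_vector_field M (Ric\<^sub>o X)"
proof (rule pi_vector_fieldI[OF ricci_op_tangent[OF X]])
  fix u assume u: "u \<in> \<T>"
  obtain c where c: "c \<in> M" "fst u \<in> fst c" by (rule base_chart_exists)
  obtain f where f: "cutoff c (fst u) f" by (rule cutoff_exists[OF c])
  let ?t = "\<lambda>u i. tvec_of M c (fst u) (axis i 1)"
  have "smooth_germ S (\<lambda>u. Ric\<^sub>o X u c) u"
  proof (rule slit.smooth_germ_linear_solution)
    show "u \<in> points S" using u by simp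
    show "smooth_germ S (\<lambda>u. (\<chi> j i. g u (?t u i) (?t u j)) $ j $ i) u" for j i
      using g_coordinates_smooth[OF u c] by simp
    show "smooth_germ S (\<lambda>u. (\<chi> j. Ric X (frame c f j) u) $ j) u" for j
      using ricci_smooth[OF X frame_pi[OF c(1) f]] u by (simp add: smooth_fun_slit_iff)
    show "w = 0" if "(\<chi> j i. g u (?t u i) (?t u j)) *v w = 0" for w by (rule gram_injective[OF u c that])
    show "\<forall>\<^sub>F u in point_nhds S u. (\<chi> j i. g u (?t u i) (?t u j)) *v Ric\<^sub>o X u c = (\<chi> j. Ric X (frame c f j) u)"
      using eventually_slit[OF u] eventually_cutoff[OF c(1) f u refl] eventually_pullback[OF u base.eventually_in_chart[OF c]]
    proof eventually_elim
      case (elim u)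
      note t = base.tvec_of_tangent[OF c(1) elim(3)]
      have "g u (Ric\<^sub>o X u) (?t u j) = Ric X (frame c f j) u" for j
        using g_ricci_op[OF X elim(1) frame_pi[OF c(1) f]] elim(2) by (simp add: frame_def vscale_def)
      then show ?case using g_expand_left[OF elim(1) c(1) elim(3) ricci_op_tangent[OF X elim(1)] t]
        by (simp add: vec_eq_iff matrix_vector_mult_def mult.commute)
    qed
  qed
  then show "\<exists>c\<in>M. fst u \<in> fst c \<and> smooth_germ S (\<lambda>u. Ric\<^sub>o X u c) u" using c by blast
qed

section \<open>Recurrence of the m-projective curvature tensor\<close>

text \<open>The part of the m-projective curvature tensor built from the Ricci tensor, without its constant
  factor.\<close>

definition ricci_part :: "('a, 'n) pi_field \<Rightarrow> ('a, 'n) pi_field \<Rightarrow> ('a, 'n) pi_field \<Rightarrow> ('a, 'n) pi_field" where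
  "ricci_part X Y Z = (\<lambda>u. Ric X Z u *\<^sub>v Y u -\<^sub>v Ric Y Z u *\<^sub>v X u
     +\<^sub>v g u (X u) (Z u) *\<^sub>v Ric\<^sub>o Y u -\<^sub>v g u (Y u) (Z u) *\<^sub>v Ric\<^sub>o X u)"

lemma ricci_part_pi:
  assumes "pi_vector_field M X" "pi_vector_field M Y" "pi_vector_field M Z"
  shows "pi_vector_field M (ricci_part X Y Z)"
  unfolding ricci_part_def
  by (intro pi_add pi_sub pi_scale ricci_smooth g_smooth ricci_op_pi assms)

lemma m_projective_eq:
  "m_projective_curvature M L D X Y Z = (\<lambda>u. R X Y Z u -\<^sub>v (1 / (2 * (real CARD('n) - 1))) *\<^sub>v ricci_part X Y Z u)"
  by (simp add: fun_eq_iff m_projective_curvature_def ricci_part_def)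

context
  fixes A W
  assumes A: "recurrent_tensor M D A (h_curvature M D)" and W: "pi_vector_field M W"
begin

text \<open>Differentiate \<open>g (Ric\<^sub>o X) Y = Ric X Y\<close>. As the connection is metric, the left-hand side gives
  no further terms, and the recurrence of the Ricci tensor passes to the operator because \<open>g\<close> is
  nondegenerate.\<close>

lemma ricci_op_recurrence:
  assumes X: "pi_vector_field M X" and u: "u \<in> \<T>"
  shows "D u (\<beta> u (W u)) (Ric\<^sub>o X) = A u (W u) *\<^sub>v Ric\<^sub>o X u +\<^sub>v Ric\<^sub>o (h_nabla M D W X) u"
proof (rule g_determines_vector[OF u])
  define v where "v = \<beta> u (W u)"
  have v: "v \<in> tangent_space S u" unfolding v_def by (rule \<beta>_tangent[OF u pi_tangent[OF W u]])
  note RX = ricci_op_pi[OF X] and nX = h_nabla_pi[OF W X]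
  note RT = ricci_op_tangent[OF X u] ricci_op_tangent[OF nX u]
  show "D u (\<beta> u (W u)) (Ric\<^sub>o X) \<in> tangent_space M (fst u)"
    using D_tangent[OF u v RX] by (simp add: v_def)
  show "A u (W u) *\<^sub>v Ric\<^sub>o X u +\<^sub>v Ric\<^sub>o (h_nabla M D W X) u \<in> tangent_space M (fst u)"
    by (intro base.vadd_tangent base.vscale_tangent RT)
  fix Y assume Y: "pi_vector_field M Y"
  note nY = h_nabla_pi[OF W Y]
  have "vec_deriv S u v (\<lambda>u. g u (Ric\<^sub>o X u) (Y u)) = vec_deriv S u v (Ric X Y)"
    by (rule slit.vec_deriv_cong)
       (use u eventually_slit[OF u] in \<open>auto simp: g_ricci_op[OF X _ Y] elim!: eventually_mono\<close>)
  moreover have "g u (Ric\<^sub>o X u) (D u v Y) = Ric X (h_nabla M D W Y) u"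
    using g_ricci_op[OF X u nY] by (simp add: h_nabla_def v_def)
  ultimately have "g u (D u v (Ric\<^sub>o X)) (Y u) = A u (W u) * Ric X Y u + Ric (h_nabla M D W X) Y u"
    using g_compatible[OF u v RX Y] ricci_recurrence[OF A W X Y u] by (simp add: v_def)
  moreover have "g u (A u (W u) *\<^sub>v Ric\<^sub>o X u +\<^sub>v 1 *\<^sub>v Ric\<^sub>o (h_nabla M D W X) u) (Y u) =
      A u (W u) * Ric X Y u + 1 * Ric (h_nabla M D W X) Y u"
    using g_linear_left[OF u RT pi_tangent[OF Y u]] g_ricci_op[OF X u Y] g_ricci_op[OF nX u Y] by simp
  ultimately show "g u (D u (\<beta> u (W u)) (Ric\<^sub>o X)) (Y u) =
      g u (A u (W u) *\<^sub>v Ric\<^sub>o X u +\<^sub>v Ric\<^sub>o (h_nabla M D W X) u) (Y u)"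
    by (simp add: v_def tvec_simps)
qed

text \<open>Every summand is a product of one recurrent factor (\<open>Ric\<close> or \<open>Ric\<^sub>o\<close>) with a parallel one (an
  argument or \<open>g\<close>), so the Leibniz rule makes it recurrent with the same form.\<close>

lemma ricci_part_recurrence:
  assumes X: "pi_vector_field M X" and Y: "pi_vector_field M Y" and Z: "pi_vector_field M Z"
    and u: "u \<in> \<T>"
  shows "D u (\<beta> u (W u)) (ricci_part X Y Z) = A u (W u) *\<^sub>v ricci_part X Y Z u
    +\<^sub>v ricci_part (h_nabla M D W X) Y Z u +\<^sub>v ricci_part X (h_nabla M D W Y) Z u
    +\<^sub>v ricci_part X Y (h_nabla M D W Z) u"
proof -
  define v where "v = \<beta> u (W u)"
  have v: "v \<in> tangent_space S u" unfolding v_def by (rule \<beta>_tangent[OF u pi_tangent[OF W u]])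
  have ric: "D u v (\<lambda>u. Ric X Z u *\<^sub>v Y u) = (A u (W u) * Ric X Z u + Ric (h_nabla M D W X) Z u
      + Ric X (h_nabla M D W Z) u) *\<^sub>v Y u +\<^sub>v Ric X Z u *\<^sub>v h_nabla M D W Y u"
    if X: "pi_vector_field M X" and Y: "pi_vector_field M Y" for X Y
    using D_scale[OF u v ricci_smooth[OF X Z] Y] ricci_recurrence[OF A W X Z u] by (simp add: v_def h_nabla_def)
  have met: "D u v (\<lambda>u. g u (X u) (Z u) *\<^sub>v Ric\<^sub>o Y u) =
      (g u (h_nabla M D W X u) (Z u) + g u (X u) (h_nabla M D W Z u)) *\<^sub>v Ric\<^sub>o Y u
      +\<^sub>v g u (X u) (Z u) *\<^sub>v (A u (W u) *\<^sub>v Ric\<^sub>o Y u +\<^sub>v Ric\<^sub>o (h_nabla M D W Y) u)"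
    if X: "pi_vector_field M X" and Y: "pi_vector_field M Y" for X Y
    using D_scale[OF u v g_smooth[OF X Z] ricci_op_pi[OF Y]] g_compatible[OF u v X Z] ricci_op_recurrence[OF Y u]
    by (simp add: v_def h_nabla_def)
  note p1 = pi_scale[OF Y ricci_smooth[OF X Z]] and p2 = pi_scale[OF X ricci_smooth[OF Y Z]]
    and p3 = pi_scale[OF ricci_op_pi[OF Y] g_smooth[OF X Z]] and p4 = pi_scale[OF ricci_op_pi[OF X] g_smooth[OF Y Z]]
  have "D u v (ricci_part X Y Z) = D u v (\<lambda>u. Ric X Z u *\<^sub>v Y u) -\<^sub>v D u v (\<lambda>u. Ric Y Z u *\<^sub>v X u)
     +\<^sub>v D u v (\<lambda>u. g u (X u) (Z u) *\<^sub>v Ric\<^sub>o Y u) -\<^sub>v D u v (\<lambda>u. g u (Y u) (Z u) *\<^sub>v Ric\<^sub>o X u)"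
    unfolding ricci_part_def D_sub[OF u v pi_add[OF pi_sub[OF p1 p2] p3] p4] D_add[OF u v pi_sub[OF p1 p2] p3]
      D_sub[OF u v p1 p2] ..
  then show ?thesis
    unfolding ric[OF X Y] ric[OF Y X] met[OF X Y] met[OF Y X] v_def[symmetric]
    by (simp add: ricci_part_def tvec_simps fun_eq_iff algebra_simps)
qed

lemma m_projective_recurrence:
  assumes X: "pi_vector_field M X" and Y: "pi_vector_field M Y" and Z: "pi_vector_field M Z"
    and u: "u \<in> \<T>"
  shows "h_nabla_tensor M D (m_projective_curvature M L D) W X Y Z u =
    A u (W u) *\<^sub>v m_projective_curvature M L D X Y Z u"
proof -
  define v where "v = \<beta> u (W u)"
  define k where "k = 1 / (2 * (real CARD('n) - 1))"
  have v: "v \<in> tangent_space S u" unfolding v_def by (rule \<beta>_tangent[OF u pi_tangent[OF W u]])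
  note P = ricci_part_pi[OF X Y Z]
  have "h_nabla_tensor M D R W X Y Z u = A u (W u) *\<^sub>v R X Y Z u"
    using A W X Y Z u unfolding recurrent_tensor_def by blast
  then have DR: "D u v (R X Y Z) = A u (W u) *\<^sub>v R X Y Z u +\<^sub>v R (h_nabla M D W X) Y Z u
      +\<^sub>v R X (h_nabla M D W Y) Z u +\<^sub>v R X Y (h_nabla M D W Z) u"
    unfolding h_nabla_tensor_def h_nabla_def[of M D W "R X Y Z"] v_def[symmetric]
    by (simp add: tvec_simps fun_eq_iff algebra_simps)
  have "D u v (\<lambda>u. R X Y Z u -\<^sub>v k *\<^sub>v ricci_part X Y Z u) = D u v (R X Y Z) -\<^sub>v k *\<^sub>v D u v (ricci_part X Y Z)"
    unfolding D_sub[OF u v R_pi[OF X Y Z] pi_scale[OF P smooth_fun_const]] D_scale[OF u v smooth_fun_const P]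
    by (simp add: slit.vec_deriv_const tvec_simps)
  then show ?thesis
    unfolding h_nabla_tensor_def m_projective_eq k_def[symmetric] h_nabla_def[of M D W "\<lambda>u. R X Y Z u -\<^sub>v _ u"]
      v_def[symmetric] DR ricci_part_recurrence[OF X Y Z u, folded v_def]
    by (simp add: tvec_simps fun_eq_iff algebra_simps)
qed

end

end

theorem theorem3p5:
  fixes M :: "('a::{t2_space, second_countable_topology}, real^'n::finite) chart set"
    and L :: "('a, 'n) tpoint \<Rightarrow> real"
    and D :: "('a, 'n) connection"
  assumes "finsler_manifold M L"
    and "CARD('n) \<ge> 3"
    and "cartan_connection M L D"
    and "\<exists>X Y. pi_vector_field M X \<and> pi_vector_field M Y \<and>
           (\<exists>u\<in>slit_bundle M. h_ricci M D X Y u \<noteq> 0)"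
    and "recurrent M D"
  shows "m_projectively_recurrent M L D"
proof -
  interpret cartan_finsler M D L
    using assms(1,3)
    by unfold_locales (auto simp: finsler_manifold_def cartan_connection_def regular_connection_def)
  obtain A where A: "nonzero_pi_form M A" "recurrent_tensor M D A (h_curvature M D)"
    using assms(5) unfolding recurrent_def by blast
  have "recurrent_tensor M D A (m_projective_curvature M L D)"
    unfolding recurrent_tensor_def using m_projective_recurrence[OF A(2)] by blast
  with A(1) show ?thesis unfolding m_projectively_recurrent_def by blast
qed

end
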